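(* Let $n\ge1$. The map $$\Lambda\longrightarrow\mathcal H_n,\qquad F\mapsto F(J_1,J_3,\ldots,J_{2n-1})\cdot\varepsilon_{B_n},$$ is a surjective ring homomorphism. Under this map, the elementary symmetric polynomial $e_k$ is sent to $H_{n-k}$ for $k\in\{0,\ldots,n-1\}$. Consequently, for all $n$, the Hecke ring $\mathcal H_n$ is generated by the elements $e_k(J_1,J_3,\ldots,J_{2n-1})\cdot\varepsilon_{B_n}$ for $k=0,\ldots,n-1$.
   Context: $\Lambda$ is the ring of symmetric functions with integer coefficients; $F(J_1,J_3,\dots,J_{2n-1})$ is the evaluation of $F$, specialized to $n$ variables, at the listed elements. $S_{2n}$ is the symmetric group on $\{1,\dots,2n\}$ and $B_n\subset S_{2n}$ is the hyperoctahedral subgroup, the centralizer of $t=(1\,2)(3\,4)\cdots(2n-1\,2n)$. The Jucys–Murphy elements are $J_1=0$ and $J_k=(1,k)+(2,k)+\cdots+(k-1,k)\in\mathbb Z[S_{2n}]$ for $k\ge2$; they commute pairwise. $\varepsilon_{B_n}=\frac1{|B_n|}\sum_{b\in B_n}b\in\mathbb Q[S_{2n}]$. $\mathcal H_n=H_{\mathbb Z}(S_{2n},B_n)$ is the ring of functions $f:S_{2n}\to\mathbb Z$ with $f(kgk')=f(g)$ for all $k,k'\in B_n$, with product $(f*g)(x)=\frac1{|B_n|}\sum_{y\in S_{2n}}f(xy^{-1})g(y)$. It is identified with a subring of $\varepsilon_{B_n}\mathbb Q[S_{2n}]\varepsilon_{B_n}$ (with unit $\varepsilon_{B_n}$) via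 the injective ring homomorphism $f\mapsto\frac1{|B_n|}\sum_{w}f(w)\,w$. For $w\in S_{2n}$, $\varGamma(w)$ is the multigraph on $\{1,\dots,2n\}$ with, for each $k=1,\dots,n$, an edge joining $2k-1$ and $2k$ and an edge joining $w^{-1}(2k-1)$ and $w^{-1}(2k)$; it is a disjoint union of cycles (a double edge is a cycle of length 2), and $c(w)$ is the number of these cycles. $H_i\in\mathcal H_n$ ($1\le i\le n$) is the indicator function of $\{w\in S_{2n}:c(w)=i\}$; thus under the identification of $\mathcal H_n$ with a subring of $\varepsilon_{B_n}\mathbb Q[S_{2n}]\varepsilon_{B_n}$ via $f\mapsto\frac1{|B_n|}\sum_{w\in S_{2n}}f(w)\,w$, the element $H_i$ corresponds to $\frac1{|B_n|}\sum_{c(w)=i}w$. *)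

theory Defs
  imports
    "HOL-Library.Poly_Mapping"
    "HOL-Library.Multiset"
    "HOL-Algebra.Algebra"
begin

section \<open>The ring of symmetric functions\<close>

text \<open>
  A monomial in the countably many variables \<open>x\<^sub>0, x\<^sub>1, \<dots>\<close> is its finitely supported exponent
  function. Symmetric functions are the formal power series of bounded degree (given by their
  coefficient functions) that are invariant under all permutations of the variables.
\<close>

type_synonym mono = "nat \<Rightarrow>\<^sub>0 nat"

definition mono_degree :: "mono \<Rightarrow> nat" where
  "mono_degree m = (\<Sum>i\<in>Poly_Mapping.keys m. Poly_Mapping.lookup m i)"

definition sym_fun_ring :: "(mono \<Rightarrow> int) ring" where
  "sym_fun_ring =
    \<lparr> carrier = {F. (\<exists>d. \<forall>m. F m \<noteq> 0 \<longrightarrow> mono_degree m \<le> d) \<and>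
                    (\<forall>\<pi> m. bij \<pi> \<longrightarrow> F (Poly_Mapping.map_key \<pi> m) = F m)},
      monoid.mult = (\<lambda>F G m. \<Sum>(a, b)\<in>{(a, b). a + b = m}. F a * G b),
      one = (\<lambda>m. of_bool (m = 0)),
      ring.zero = (\<lambda>m. 0),
      add = (\<lambda>F G m. F m + G m) \<rparr>"

text \<open>\<open>e\<^sub>k\<close> is the sum of the monomials \<open>\<Prod>i\<in>A. x\<^sub>i\<close> over all sets \<open>A\<close> of \<open>k\<close> variables.\<close>

definition elem_sym :: "nat \<Rightarrow> mono \<Rightarrow> int" where
  "elem_sym k m =
    of_bool (\<exists>A. finite A \<and> card A = k \<and> m = (\<Sum>i\<in>A. Poly_Mapping.single i 1))"

text \<open>The set of pairs in the definition of the product is finite, so that the sum there is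
  not degenerate.\<close>

lemma finite_bounded_monos:
  "finite {m :: mono. Poly_Mapping.keys m \<subseteq> A \<and> (\<forall>i. Poly_Mapping.lookup m i \<le> d)}"
  if "finite A"
proof (rule finite_imageD[where f = Poly_Mapping.lookup])
  have "Poly_Mapping.lookup ` {m :: mono. Poly_Mapping.keys m \<subseteq> A \<and> (\<forall>i. Poly_Mapping.lookup m i \<le> d)}
      \<subseteq> {f. \<forall>i. (i \<in> A \<longrightarrow> f i \<in> {..d}) \<and> (i \<notin> A \<longrightarrow> f i = 0)}"
    by (auto simp: in_keys_iff)
  moreover have "finite {f :: nat \<Rightarrow> nat. \<forall>i. (i \<in> A \<longrightarrow> f i \<in> {..d}) \<and> (i \<notin> A \<longrightarrow> f i = 0)}"
    using that by (intro finite_set_of_finite_funs) auto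
  ultimately show "finite (Poly_Mapping.lookup `
      {m :: mono. Poly_Mapping.keys m \<subseteq> A \<and> (\<forall>i. Poly_Mapping.lookup m i \<le> d)})"
    by (rule finite_subset)
qed (simp add: inj_on_def)

lemma lookup_le_mono_degree: "Poly_Mapping.lookup m i \<le> mono_degree m"
proof (cases "i \<in> Poly_Mapping.keys m")
  case True
  then show ?thesis
    unfolding mono_degree_def by (intro member_le_sum) auto
next
  case False
  then show ?thesis by (simp add: in_keys_iff)
qed

lemma finite_mono_antidiagonal: "finite {(a :: mono, b). a + b = m}"
proof -
  let ?X = "{a :: mono. Poly_Mapping.keys a \<subseteq> Poly_Mapping.keys m \<and>
                        (\<forall>i. Poly_Mapping.lookup a i \<le> mono_degree m)}"
  have le: "Poly_Mapping.lookup a i \<le> Poly_Mapping.lookup m i"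
           "Poly_Mapping.lookup b i \<le> Poly_Mapping.lookup m i" if "a + b = m" for a b :: mono and i
    using that by (auto simp: lookup_add)
  have mem: "a \<in> ?X" "b \<in> ?X" if "a + b = m" for a b :: mono
  proof -
    have "Poly_Mapping.lookup a i \<le> mono_degree m" "Poly_Mapping.lookup b i \<le> mono_degree m" for i
      using le[OF that, of i] lookup_le_mono_degree[of m i] by linarith+
    moreover have "i \<in> Poly_Mapping.keys m"
      if "i \<in> Poly_Mapping.keys a \<or> i \<in> Poly_Mapping.keys b" for i
      using le[OF \<open>a + b = m\<close>, of i] that unfolding in_keys_iff by linarith
    ultimately show "a \<in> ?X" "b \<in> ?X"
      by blast+
  qed
  have "{(a :: mono, b). a + b = m} \<subseteq> ?X \<times> ?X"
  proof (intro subsetI)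
    fix p assume "p \<in> {(a :: mono, b). a + b = m}"
    then obtain a b where "p = (a, b)" "a + b = m" by blast
    then show "p \<in> ?X \<times> ?X" using mem[of a b] by simp
  qed
  moreover have "finite (?X \<times> ?X)"
    using finite_bounded_monos[of "Poly_Mapping.keys m" "mono_degree m"] by simp
  ultimately show ?thesis by (rule finite_subset)
qed


section \<open>The rational group algebra\<close>

definition group_algebra :: "('g, 'm) monoid_scheme \<Rightarrow> ('g \<Rightarrow> rat) ring" where
  "group_algebra G =
    \<lparr> carrier = {f. \<forall>w. w \<notin> carrier G \<longrightarrow> f w = 0},
      monoid.mult = (\<lambda>f g w. \<Sum>(u, v)\<in>{(u, v). u \<in> carrier G \<and> v \<in> carrier G \<and> u \<otimes>\<^bsub>G\<^esub> v = w}. f u * g v),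
      one = (\<lambda>w. of_bool (w = \<one>\<^bsub>G\<^esub>)),
      ring.zero = (\<lambda>w. 0),
      add = (\<lambda>f g w. f w + g w) \<rparr>"

abbreviation sym_algebra :: "nat \<Rightarrow> ((nat \<Rightarrow> nat) \<Rightarrow> rat) ring" where
  "sym_algebra n \<equiv> group_algebra (sym_group (2 * n))"

text \<open>
  \<open>sym_fun_eval G n F a\<close> is \<open>F(a\<^sub>0, \<dots>, a\<^sub>n\<^sub>-\<^sub>1)\<close> in the group algebra of \<open>G\<close>: the variables \<open>x\<^sub>i\<close> with
  \<open>i \<ge> n\<close> are set to zero, i.e. only the (finitely many) monomials of \<open>F\<close> in \<open>x\<^sub>0, \<dots>, x\<^sub>n\<^sub>-\<^sub>1\<close>
  contribute. The factors of a monomial are multiplied in increasing order of \<open>i\<close>; the order is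
  immaterial when the \<open>a\<^sub>i\<close> commute pairwise.
\<close>

definition mono_eval ::
    "('g, 'm) monoid_scheme \<Rightarrow> nat \<Rightarrow> mono \<Rightarrow> (nat \<Rightarrow> 'g \<Rightarrow> rat) \<Rightarrow> 'g \<Rightarrow> rat" where
  "mono_eval G n m a =
    foldr (\<lambda>i p. (a i [^]\<^bsub>group_algebra G\<^esub> Poly_Mapping.lookup m i) \<otimes>\<^bsub>group_algebra G\<^esub> p)
      [0..<n] \<one>\<^bsub>group_algebra G\<^esub>"

definition sym_fun_eval ::
    "('g, 'm) monoid_scheme \<Rightarrow> nat \<Rightarrow> (mono \<Rightarrow> int) \<Rightarrow> (nat \<Rightarrow> 'g \<Rightarrow> rat) \<Rightarrow> 'g \<Rightarrow> rat" where
  "sym_fun_eval G n F a =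
    (\<lambda>w. \<Sum>m\<in>{m. Poly_Mapping.keys m \<subseteq> {..<n} \<and> F m \<noteq> 0}. of_int (F m) * mono_eval G n m a w)"

lemma finite_monos_eval:
  assumes "F \<in> carrier sym_fun_ring"
  shows "finite {m. Poly_Mapping.keys m \<subseteq> {..<n} \<and> F m \<noteq> 0}"
proof -
  obtain d where d: "\<And>m. F m \<noteq> 0 \<Longrightarrow> mono_degree m \<le> d"
    using assms by (auto simp: sym_fun_ring_def)
  have "{m. Poly_Mapping.keys m \<subseteq> {..<n} \<and> F m \<noteq> 0}
      \<subseteq> {m. Poly_Mapping.keys m \<subseteq> {..<n} \<and> (\<forall>i. Poly_Mapping.lookup m i \<le> d)}"
    using d lookup_le_mono_degree order_trans by blast
  then show ?thesis
    by (rule finite_subset) (intro finite_bounded_monos, simp)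
qed

definition jucys_murphy :: "nat \<Rightarrow> (nat \<Rightarrow> nat) \<Rightarrow> rat" where
  "jucys_murphy k = (\<lambda>w. \<Sum>i\<in>{1..<k}. of_bool (w = Transposition.transpose i k))"


section \<open>The hyperoctahedral group and the Hecke ring\<close>

text \<open>The involution \<open>(1 2)(3 4)\<cdots>(2n-1 2n)\<close>.\<close>

definition std_involution :: "nat \<Rightarrow> nat \<Rightarrow> nat" where
  "std_involution n i = (if i \<in> {1..2 * n} then (if odd i then i + 1 else i - 1) else i)"

definition hyperoct :: "nat \<Rightarrow> (nat \<Rightarrow> nat) set" where
  "hyperoct n =
    {b \<in> carrier (sym_group (2 * n)). b \<circ> std_involution n = std_involution n \<circ> b}"

definition hyperoct_idem :: "nat \<Rightarrow> (nat \<Rightarrow> nat) \<Rightarrow> rat" where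
  "hyperoct_idem n = (\<lambda>w. 1 / of_nat (card (hyperoct n)) * of_bool (w \<in> hyperoct n))"

text \<open>
  Integer-valued functions on \<open>S\<^sub>2\<^sub>n\<close> are represented as rational-valued functions with values
  in \<open>\<int>\<close>, so that the normalising factor in the product is an honest division, and they are extended
  by zero outside \<open>S\<^sub>2\<^sub>n\<close>.
\<close>

definition hecke_ring :: "nat \<Rightarrow> ((nat \<Rightarrow> nat) \<Rightarrow> rat) ring" where
  "hecke_ring n =
    \<lparr> carrier = {f. (\<forall>w. f w \<in> \<int>) \<and>
                    (\<forall>w. w \<notin> carrier (sym_group (2 * n)) \<longrightarrow> f w = 0) \<and>
                    (\<forall>w\<in>carrier (sym_group (2 * n)). \<forall>k\<in>hyperoct n. \<forall>k'\<in>hyperoct n.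
                       f (k \<circ> w \<circ> k') = f w)},
      monoid.mult = (\<lambda>f g x. 1 / of_nat (card (hyperoct n)) *
                (\<Sum>y\<in>carrier (sym_group (2 * n)). f (x \<circ> inv' y) * g y)),
      one = (\<lambda>w. of_bool (w \<in> hyperoct n)),
      ring.zero = (\<lambda>w. 0),
      add = (\<lambda>f g w. f w + g w) \<rparr>"

text \<open>The identification of the Hecke ring with a subring of \<open>\<epsilon> \<rat>[S\<^sub>2\<^sub>n] \<epsilon>\<close>.\<close>

definition hecke_embed :: "nat \<Rightarrow> ((nat \<Rightarrow> nat) \<Rightarrow> rat) \<Rightarrow> (nat \<Rightarrow> nat) \<Rightarrow> rat" where
  "hecke_embed n f = (\<lambda>w. 1 / of_nat (card (hyperoct n)) * f w)"

lemma card_hyperoct_pos: "card (hyperoct n) > 0"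
proof -
  have "finite {p. p permutes {1..2 * n}}"
    by (simp add: finite_permutations)
  then have "finite (hyperoct n)"
    by (rule rev_finite_subset) (auto simp: hyperoct_def sym_group_carrier)
  moreover have "id \<in> hyperoct n"
    by (simp add: hyperoct_def sym_group_carrier permutes_id)
  ultimately show ?thesis
    by (auto simp: card_gt_0_iff)
qed

lemma inj_hecke_embed: "inj (hecke_embed n)"
proof (rule injI)
  fix f g :: "(nat \<Rightarrow> nat) \<Rightarrow> rat"
  assume eq: "hecke_embed n f = hecke_embed n g"
  have nz: "(of_nat (card (hyperoct n)) :: rat) \<noteq> 0"
    using card_hyperoct_pos[of n] by simp
  show "f = g"
  proof
    fix w
    have "hecke_embed n f w = hecke_embed n g w"
      by (simp only: eq)
    then show "f w = g w"
      using nz by (simp add: hecke_embed_def)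
  qed
qed

lemma hecke_embed_one: "hecke_embed n \<one>\<^bsub>hecke_ring n\<^esub> = hyperoct_idem n"
  unfolding hecke_embed_def hyperoct_idem_def hecke_ring_def monoid.select_convs by (rule refl)

lemma hecke_embed_add:
  "hecke_embed n (f \<oplus>\<^bsub>hecke_ring n\<^esub> g) = hecke_embed n f \<oplus>\<^bsub>sym_algebra n\<^esub> hecke_embed n g"
  unfolding hecke_embed_def hecke_ring_def group_algebra_def ring.select_convs
  by (simp only: distrib_left)

lemma hecke_embed_mult:
  assumes "f \<in> carrier (hecke_ring n)" "g \<in> carrier (hecke_ring n)"
  shows "hecke_embed n (f \<otimes>\<^bsub>hecke_ring n\<^esub> g) = hecke_embed n f \<otimes>\<^bsub>sym_algebra n\<^esub> hecke_embed n g"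
proof
  fix x
  define S where "S = carrier (sym_group (2 * n))"
  define P where "P = {(u, v). u \<in> S \<and> v \<in> S \<and> u \<circ> v = x}"
  define c where "c = 1 / (of_nat (card (hyperoct n)) :: rat)"
  have S: "w \<in> S \<longleftrightarrow> w permutes {1..2 * n}" for w
    by (simp add: S_def sym_group_carrier)
  have fin: "finite S"
    unfolding S_def sym_group_def by (simp add: finite_permutations)
  have supp: "f w = 0" if "w \<notin> S" for w
    using assms(1) that by (simp add: hecke_ring_def S_def)
  have "(\<Sum>y\<in>S. f (x \<circ> inv' y) * g y) = (\<Sum>y\<in>{y \<in> S. x \<circ> inv' y \<in> S}. f (x \<circ> inv' y) * g y)"
    using fin by (intro sum.mono_neutral_right) (simp_all add: supp)
  also have "\<dots> = (\<Sum>p\<in>P. f (fst p) * g (snd p))"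
  proof (rule sum.reindex_bij_witness[where i = snd and j = "\<lambda>y. (x \<circ> inv' y, y)"])
    fix y assume "y \<in> {y \<in> S. x \<circ> inv' y \<in> S}"
    moreover have "x \<circ> inv' y \<circ> y = x"
      using calculation permutes_inv_o(2)[of y "{1..2 * n}"] by (simp only: S mem_Collect_eq comp_assoc comp_id)
    ultimately show "(x \<circ> inv' y, y) \<in> P"
      by (simp add: P_def)
  next
    fix p assume "p \<in> P"
    then obtain u v where p: "p = (u, v)" "u \<in> S" "v \<in> S" "u \<circ> v = x"
      by (force simp: P_def)
    have "x \<circ> inv' v = u"
      using p(3) permutes_inv_o(1)[of v "{1..2 * n}"]
      by (simp only: p(4)[symmetric] S comp_assoc comp_id)
    then show "(x \<circ> inv' (snd p), snd p) = p" "snd p \<in> {y \<in> S. x \<circ> inv' y \<in> S}"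
      using p by simp_all
  qed simp_all
  finally have *: "(\<Sum>y\<in>S. f (x \<circ> inv' y) * g y) = (\<Sum>p\<in>P. f (fst p) * g (snd p))" .
  have "hecke_embed n (f \<otimes>\<^bsub>hecke_ring n\<^esub> g) x = c * (c * (\<Sum>y\<in>S. f (x \<circ> inv' y) * g y))"
    by (simp add: hecke_embed_def hecke_ring_def S_def c_def)
  also have "\<dots> = (\<Sum>p\<in>P. (c * f (fst p)) * (c * g (snd p)))"
    unfolding * sum_distrib_left by (simp only: mult_ac)
  also have "\<dots> = (hecke_embed n f \<otimes>\<^bsub>sym_algebra n\<^esub> hecke_embed n g) x"
    by (simp add: hecke_embed_def group_algebra_def sym_group_mult S_def[symmetric] P_def c_def
                  case_prod_unfold)
  finally show "hecke_embed n (f \<otimes>\<^bsub>hecke_ring n\<^esub> g) x =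
    (hecke_embed n f \<otimes>\<^bsub>sym_algebra n\<^esub> hecke_embed n g) x" .
qed


section \<open>The multigraph of a permutation\<close>

definition perm_multigraph :: "nat \<Rightarrow> (nat \<Rightarrow> nat) \<Rightarrow> nat set multiset" where
  "perm_multigraph n w =
    {#{2 * k - 1, 2 * k}. k \<in># mset_set {1..n}#} +
    {#{inv' w (2 * k - 1), inv' w (2 * k)}. k \<in># mset_set {1..n}#}"

text \<open>
  The cycle through the distinct vertices \<open>v\<^sub>0, \<dots>, v\<^sub>r\<^sub>-\<^sub>1\<close> has the multiset of edges
  \<open>{v\<^sub>i, v\<^sub>i\<^sub>+\<^sub>1}\<close>, indices modulo \<open>r\<close>; for \<open>r = 2\<close> this is a double edge. Cycles are identified with
  their edge multisets, so the starting point and the orientation do not matter.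
\<close>

definition cycle_edges :: "'a list \<Rightarrow> 'a set multiset" where
  "cycle_edges vs = {#{vs ! i, vs ! (Suc i mod length vs)}. i \<in># mset_set {..<length vs}#}"

definition multigraph_cycles :: "'a set multiset \<Rightarrow> 'a set multiset set" where
  "multigraph_cycles E = {cycle_edges vs | vs. length vs \<ge> 2 \<and> distinct vs \<and> cycle_edges vs \<subseteq># E}"

definition num_cycles :: "nat \<Rightarrow> (nat \<Rightarrow> nat) \<Rightarrow> nat" where
  "num_cycles n w = card (multigraph_cycles (perm_multigraph n w))"

definition hecke_H :: "nat \<Rightarrow> nat \<Rightarrow> (nat \<Rightarrow> nat) \<Rightarrow> rat" where
  "hecke_H n i = (\<lambda>w. of_bool (w \<in> carrier (sym_group (2 * n)) \<and> num_cycles n w = i))"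


section \<open>The map from symmetric functions to the Hecke ring\<close>

definition jm_eval :: "nat \<Rightarrow> (mono \<Rightarrow> int) \<Rightarrow> (nat \<Rightarrow> nat) \<Rightarrow> rat" where
  "jm_eval n F =
    sym_fun_eval (sym_group (2 * n)) n F (\<lambda>i. jucys_murphy (2 * i + 1))
      \<otimes>\<^bsub>sym_algebra n\<^esub> hyperoct_idem n"

text \<open>
  The element of the Hecke ring identified with \<open>F(J\<^sub>1, J\<^sub>3, \<dots>, J\<^sub>2\<^sub>n\<^sub>-\<^sub>1) \<epsilon>\<close>. It is unique if it exists,
  by injectivity of the embedding; existence is part of the theorem.
\<close>

definition jm_map :: "nat \<Rightarrow> (mono \<Rightarrow> int) \<Rightarrow> (nat \<Rightarrow> nat) \<Rightarrow> rat" where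
  "jm_map n F = inv_into (carrier (hecke_ring n)) (hecke_embed n) (jm_eval n F)"

end

theory Submission
  imports Defs
begin

text \<open>
  A coset \<open>w B\<^sub>n\<close> is the same as the perfect matching \<open>w t w\<inverse>\<close>, so \<open>F(J\<^sub>1, J\<^sub>3, \<dots>) \<epsilon>\<close> can be computed on
  matchings, where a transposition \<open>(a c)\<close> either merges two components of the union with the standard
  matching \<open>t\<close> or does not decrease their number. A matching that is standard beyond the pair
  \<open>{2i+1, 2i+2}\<close> arises from exactly one that is standard already from that pair on, by at most one
  transposition \<open>(a, 2i+1)\<close>; by induction on \<open>i\<close> this gives \<open>e\<^sub>k(J\<^sub>1, J\<^sub>3, \<dots>) \<epsilon> = H\<^sub>n\<^sub>-\<^sub>k\<close>. Since the \<open>e\<^sub>k\<close> generate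
  the symmetric polynomials and their values are left invariant under \<open>B\<^sub>n\<close>, every \<open>F(J\<^sub>1, J\<^sub>3, \<dots>) \<epsilon>\<close> is
  bi-invariant, which also makes the map multiplicative.

  For surjectivity, order the coset types lexicographically by the number of merges needed and the
  number of nontrivial components. The leading part of a monomial \<open>J\<^sup>\<gamma> \<epsilon>\<close> consists, with coefficient \<open>1\<close>,
  of the matchings that have for every \<open>i\<close> with \<open>\<gamma>\<^sub>i > 0\<close> a component of size \<open>2(\<gamma>\<^sub>i + 1)\<close> with largest pair
  \<open>{2i+1, 2i+2}\<close> and no other nontrivial component. Hence a monomial symmetric function is, up to
  smaller types, the indicator function of one double coset.
\<close>

section \<open>Pairs of fixed-point free involutions\<close>

text \<open>In general a single monomial in the odd Jucys-Murphy elements times epsilon is not left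
  invariant under the hyperoctahedral group; only symmetric combinations are. Bi-invariance
  therefore cannot be checked monomial by monomial but has to pass through sums and products of the
  generators. For products: once G(J) epsilon is left invariant, it equals epsilon G(J) epsilon, so
  F(J) G(J) epsilon is the product of F(J) epsilon and G(J) epsilon. The second entry of the
  lexicographic order deals with the matchings that a monomial reaches in top degree by merging two
  nontrivial components, with multiplicities that are hard to control. Every such merge costs a
  nontrivial component, so these matchings have fewer of them than the monomial has variables and
  fall below the leading part. That the leading coefficient is 1, and not merely nonzero, makes the
  elimination possible over the integers.\<close>

definition fpf_involution :: "'a set \<Rightarrow> ('a \<Rightarrow> 'a) \<Rightarrow> bool" where
  "fpf_involution V m \<longleftrightarrow> (\<forall>x\<in>V. m x \<in> V \<and> m x \<noteq> x \<and> m (m x) = x)"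

lemma even_card_fpf_involution:
  assumes "finite A" "fpf_involution A f"
  shows "even (card A)"
  using assms
proof (induction "card A" arbitrary: A rule: less_induct)
  case less
  show ?case
  proof (cases "A = {}")
    case False
    then obtain x where x: "x \<in> A" by blast
    let ?B = "A - {x, f x}"
    have fx: "f x \<in> A" "f x \<noteq> x" "f (f x) = x"
      using x less.prems by (auto simp: fpf_involution_def)
    have "card {x, f x} = 2" "{x, f x} \<subseteq> A"
      using x fx by auto
    then have card: "card A = card ?B + 2"
      using less.prems(1) card_Diff_subset[of "{x, f x}" A] card_mono[of A "{x, f x}"] by simp
    have "fpf_involution ?B f"
      unfolding fpf_involution_def
    proof
      fix y assume "y \<in> ?B"
      then show "f y \<in> ?B \<and> f y \<noteq> y \<and> f (f y) = y"
        using less.prems(2) fx by (auto simp: fpf_involution_def)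
    qed
    then have "even (card ?B)"
      using less.hyps[of ?B] less.prems(1) card by auto
    then show ?thesis using card by simp
  qed simp
qed

text \<open>The vertex set of a connected component of the graph with edges {x, t x} and {x, m x}.
  Closure under the maps alone suffices because they will be involutions; symmetry of the relation
  is \<open>comp_sym\<close>.\<close>

inductive_set component :: "('a \<Rightarrow> 'a) \<Rightarrow> ('a \<Rightarrow> 'a) \<Rightarrow> 'a \<Rightarrow> 'a set" for t m x where
  base: "x \<in> component t m x"
| fst: "y \<in> component t m x \<Longrightarrow> t y \<in> component t m x"
| snd: "y \<in> component t m x \<Longrightarrow> m y \<in> component t m x"

lemma component_least:
  assumes "x \<in> S" "\<And>y. y \<in> S \<Longrightarrow> t y \<in> S" "\<And>y. y \<in> S \<Longrightarrow> m y \<in> S"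
  shows "component t m x \<subseteq> S"
proof
  fix y assume "y \<in> component t m x"
  then show "y \<in> S" by induction (use assms in auto)
qed

lemma component_trans: "y \<in> component t m x \<Longrightarrow> component t m y \<subseteq> component t m x"
  by (rule component_least) (auto intro: component.intros)

locale involution_pair =
  fixes V :: "'a set" and t m :: "'a \<Rightarrow> 'a"
  assumes finite_V: "finite V"
    and fpf_t: "fpf_involution V t"
    and fpf_m: "fpf_involution V m"
begin

abbreviation comp_of :: "'a \<Rightarrow> 'a set" where
  "comp_of \<equiv> component t m"

definition comps :: "'a set set" where
  "comps = comp_of ` V"

lemma t_simps [simp]: "x \<in> V \<Longrightarrow> t x \<in> V" "x \<in> V \<Longrightarrow> t x \<noteq> x" "x \<in> V \<Longrightarrow> t (t x) = x"
  using fpf_t by (auto simp: fpf_involution_def)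

lemma m_simps [simp]: "x \<in> V \<Longrightarrow> m x \<in> V" "x \<in> V \<Longrightarrow> m x \<noteq> x" "x \<in> V \<Longrightarrow> m (m x) = x"
  using fpf_m by (auto simp: fpf_involution_def)

lemma comp_subset: "x \<in> V \<Longrightarrow> comp_of x \<subseteq> V"
  by (rule component_least) auto

lemma finite_comp: "x \<in> V \<Longrightarrow> finite (comp_of x)"
  using comp_subset finite_V finite_subset by blast

lemma comp_sym:
  assumes "x \<in> V" "y \<in> comp_of x" shows "x \<in> comp_of y"
  using assms(2)
proof induction
  case (fst y)
  then have "y \<in> V" using comp_subset assms(1) by blast
  then have "y \<in> comp_of (t y)" using component.fst[OF component.base[of "t y" t m]] by simp
  from subsetD[OF component_trans[OF this] fst.IH] show ?case .
next
  case (snd y)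
  then have "y \<in> V" using comp_subset assms(1) by blast
  then have "y \<in> comp_of (m y)" using component.snd[OF component.base[of "m y" t m]] by simp
  from subsetD[OF component_trans[OF this] snd.IH] show ?case .
qed (rule component.base)

lemma comp_eq: "x \<in> V \<Longrightarrow> y \<in> comp_of x \<Longrightarrow> comp_of y = comp_of x"
  by (rule equalityI[OF component_trans component_trans[OF comp_sym]])

lemma comp_disjoint:
  "x \<in> V \<Longrightarrow> y \<in> V \<Longrightarrow> y \<notin> comp_of x \<Longrightarrow> comp_of x \<inter> comp_of y = {}"
  using comp_eq component.base by (metis disjoint_iff)

lemma finite_comps: "finite comps"
  by (simp add: comps_def finite_V)

lemma Union_comps: "\<Union>comps = V"
  using comp_subset by (auto simp: comps_def intro: component.base)

lemma comp_eq_iff: "x \<in> V \<Longrightarrow> y \<in> V \<Longrightarrow> comp_of x = comp_of y \<longleftrightarrow> x \<in> comp_of y"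
  using comp_eq[of y x] component.base[of x t m] by auto

lemma comps_eqI:
  assumes "K \<in> comps" "x \<in> K" shows "K = comp_of x"
proof -
  obtain y where "y \<in> V" "K = comp_of y" using assms(1) by (auto simp: comps_def)
  then show ?thesis using comp_eq assms(2) by metis
qed

lemma comps_disjoint: "K \<in> comps \<Longrightarrow> L \<in> comps \<Longrightarrow> K \<noteq> L \<Longrightarrow> K \<inter> L = {}"
  using comps_eqI by (metis disjoint_iff)

lemma even_card_comp: "x \<in> V \<Longrightarrow> even (card (comp_of x))"
proof (rule even_card_fpf_involution)
  assume "x \<in> V"
  then show "finite (comp_of x)" "fpf_involution (comp_of x) t"
    using finite_comp subsetD[OF comp_subset] by (auto simp: fpf_involution_def intro: component.fst)
qed

lemma comp_trivial:
  assumes "x \<in> V" "m x = t x" shows "comp_of x = {x, t x}"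
proof
  have "m (t x) = x" using assms m_simps(3)[of x] by simp
  then show "comp_of x \<subseteq> {x, t x}" using assms by (intro component_least) auto
qed (auto intro: component.intros)

lemma card_comp_eq_2_iff:
  assumes "x \<in> V" shows "card (comp_of x) = 2 \<longleftrightarrow> m x = t x"
proof
  assume "m x = t x"
  then show "card (comp_of x) = 2" using comp_trivial[OF assms] t_simps(2)[OF assms] by (simp add: card_insert_if)
next
  assume "card (comp_of x) = 2"
  moreover have "{x, t x, m x} \<subseteq> comp_of x" by (auto intro: component.intros)
  ultimately have "card {x, t x, m x} \<le> 2"
    using finite_comp[OF assms] by (metis card_mono)
  moreover have "t x \<noteq> x" "m x \<noteq> x" using assms by auto
  ultimately show "m x = t x" by (auto simp: card_insert_if split: if_splits)
qed

lemma card_comp_ge_2: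
  assumes "x \<in> V" shows "card (comp_of x) \<ge> 2"
proof -
  have "{x, t x} \<subseteq> comp_of x" by (auto intro: component.intros)
  moreover have "card {x, t x} = 2" using assms by (simp add: card_2_iff') 
  ultimately show ?thesis using finite_comp[OF assms] card_mono by metis
qed

end

subsection \<open>Conjugating one involution by a transposition\<close>

text \<open>This is what left multiplication of w by the transposition (a c) does to the matching of
  w, see \<open>perm_matching_transpose\<close>.\<close>

abbreviation swap_conj :: "'a \<Rightarrow> 'a \<Rightarrow> ('a \<Rightarrow> 'a) \<Rightarrow> 'a \<Rightarrow> 'a" where
  "swap_conj a c m \<equiv> Transposition.transpose a c \<circ> m \<circ> Transposition.transpose a c"

lemma swap_conj_swap_conj: "swap_conj a c (swap_conj a c m) = m"
  by (simp add: fun_eq_iff)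

locale involution_pair_swap = involution_pair +
  fixes a c
  assumes a: "a \<in> V" and c: "c \<in> V" and ac: "a \<noteq> c"
begin

definition m' where "m' = swap_conj a c m"

sublocale swapped: involution_pair V t m'
proof
  show "fpf_involution V m'"
    unfolding fpf_involution_def m'_def using a c
    by (auto simp: Transposition.transpose_def) (metis m_simps)+
qed (use finite_V fpf_t in auto)

text \<open>Under the hypothesis a, c, m a, m c are four distinct points; the swap replaces the
  edges {a, m a}, {c, m c} by {a, m c}, {c, m a} and leaves all others alone.\<close>

lemma m'_eqs:
  assumes "m a \<noteq> c"
  shows "m' a = m c" "m' c = m a" "m' (m a) = c" "m' (m c) = a"
    "x \<notin> {a, c, m a, m c} \<Longrightarrow> x \<in> V \<Longrightarrow> m' x = m x"
proof -
  have "m a \<noteq> a" "m c \<noteq> c" "m c \<noteq> a" "m (m a) = a" "m (m c) = c"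
    using assms a c m_simps by metis+
  then show "m' a = m c" "m' c = m a" "m' (m a) = c" "m' (m c) = a"
    using assms by (auto simp: m'_def Transposition.transpose_def)
  show "m' x = m x" if "x \<notin> {a, c, m a, m c}" "x \<in> V"
  proof -
    have "m x \<noteq> a" "m x \<noteq> c" using that m_simps(3)[of x] by auto
    then show ?thesis using that by (auto simp: m'_def Transposition.transpose_def)
  qed
qed

lemma m'_trivial: "m a = c \<Longrightarrow> x \<in> V \<Longrightarrow> m' x = m x"
proof -
  assume "m a = c" "x \<in> V"
  moreover have "m c = a" using calculation a m_simps(3)[of a] by simp
  moreover have "m x = a \<longleftrightarrow> x = c" "m x = c \<longleftrightarrow> x = a"
    using calculation m_simps(3)[of x] m_simps(3)[of a] a by metis+
  ultimately show ?thesis by (auto simp: m'_def Transposition.transpose_def)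
qed

text \<open>All edges changed by the swap have their ends in the component of a, so no new edge
  joins two different components.\<close>

lemma comp_refine:
  assumes "c \<in> comp_of a" "x \<in> V" shows "swapped.comp_of x \<subseteq> comp_of x"
proof -
  have "swapped.comp_of x \<subseteq> comp_of x \<inter> V"
  proof (rule component_least)
    fix y assume "y \<in> comp_of x \<inter> V"
    then have y: "y \<in> comp_of x" "y \<in> V" by auto
    then show "t y \<in> comp_of x \<inter> V" by (auto intro: component.intros)
    have "m' y \<in> comp_of y"
    proof (cases "m a = c \<or> y \<notin> {a, c, m a, m c}")
      case True
      then have "m' y = m y" using y m'_trivial m'_eqs by blast
      then show ?thesis by (auto intro: component.intros)
    next
      case False
      have "{a, c, m a, m c} \<subseteq> comp_of a"
        using assms(1) by (auto intro: component.intros)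
      moreover have "m' y \<in> {a, c, m a, m c}" using False m'_eqs by auto
      ultimately show ?thesis
        using False comp_eq[OF a] by blast
    qed
    then show "m' y \<in> comp_of x \<inter> V"
      using y swapped.m_simps(1) subsetD[OF component_trans[OF y(1)]] by simp
  qed (use assms component.base in auto)
  then show ?thesis by blast
qed

text \<open>Every old component is a union of new ones, so sending a new component to the old one
  around it is surjective.\<close>

lemma card_comps_refine:
  assumes "c \<in> comp_of a" shows "card comps \<le> card swapped.comps"
proof -
  have "(\<Union>y\<in>swapped.comp_of x. comp_of y) = comp_of x" if "x \<in> V" for x
  proof -
    have "(\<Union>y\<in>swapped.comp_of x. comp_of y) = (\<Union>y\<in>swapped.comp_of x. comp_of x)"
      using comp_eq[OF that] comp_refine[OF assms that] by (intro SUP_cong) (auto dest!: subsetD)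
    then show ?thesis using component.base[of x t m'] by auto
  qed
  then have "comps = (\<lambda>K. \<Union>y\<in>K. comp_of y) ` swapped.comps"
    by (simp add: comps_def swapped.comps_def image_image)
  then show ?thesis using card_image_le[OF swapped.finite_comps] by metis
qed

context
  assumes not_conn: "c \<notin> comp_of a"
begin

lemma m_ac: "m a \<noteq> c" "m a \<in> comp_of a" "m c \<in> comp_of c" "m a \<notin> comp_of c" "m c \<notin> comp_of a"
  "a \<in> comp_of a" "c \<in> comp_of c" "a \<notin> comp_of c"
proof -
  have "comp_of a \<inter> comp_of c = {}" using comp_disjoint[OF a c not_conn] .
  moreover show "m a \<in> comp_of a" "m c \<in> comp_of c" "a \<in> comp_of a" "c \<in> comp_of c"
    by (auto intro: component.intros)
  ultimately show "m a \<noteq> c" "m a \<notin> comp_of c" "m c \<notin> comp_of a" "a \<notin> comp_of c" by auto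
qed

lemmas m'_vals = m'_eqs[OF m_ac(1)]

lemma m'_on_comp: "x \<in> comp_of a \<Longrightarrow> x \<noteq> a \<Longrightarrow> x \<noteq> m a \<Longrightarrow> m' x = m x"
  using m'_vals(5) m_ac not_conn comp_subset[OF a] by blast

lemma swapped_comp_mem: "m a \<in> swapped.comp_of a"
proof (rule ccontr)
  \<comment> \<open>Otherwise \<open>t\<close> acts on the set \<open>D\<close> below, and \<open>m\<close> acts on \<open>D - {a}\<close>, both without fixed points.\<close>
  assume not: "m a \<notin> swapped.comp_of a"
  define D where "D = swapped.comp_of a \<inter> comp_of a"
  have D: "finite D" "a \<in> D" "D \<subseteq> V"
    using finite_comp[OF a] comp_subset[OF a] by (auto simp: D_def intro: component.base)
  have "fpf_involution D t"
    using D(3) by (auto simp: fpf_involution_def D_def intro: component.intros)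
  then have "even (card D)" using D(1) even_card_fpf_involution by blast
  moreover have "fpf_involution (D - {a}) m"
    unfolding fpf_involution_def
  proof
    fix x assume x: "x \<in> D - {a}"
    then have "x \<in> V" "x \<noteq> m a" using D not by (auto simp: D_def)
    moreover have "m' x = m x" using x calculation m'_on_comp by (auto simp: D_def)
    moreover have "m x \<noteq> a" using calculation m_simps(3)[of x] by auto
    ultimately show "m x \<in> D - {a} \<and> m x \<noteq> x \<and> m (m x) = x"
      using x by (auto simp: D_def intro: component.snd component.snd[of _ _ m', simplified])
        (metis component.snd)
  qed
  then have "even (card (D - {a}))" using D(1) even_card_fpf_involution by blast
  ultimately show False
    using D card_Suc_Diff1[OF D(1,2)] by (metis even_Suc)
qed

text \<open>On this component the two matchings differ only at a and m a, and
  \<open>swapped_comp_mem\<close> provides a connection that replaces the lost edge between these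
  two.\<close>

lemma comp_subset_swapped: "comp_of a \<subseteq> swapped.comp_of a"
proof -
  have "comp_of a \<subseteq> swapped.comp_of a \<inter> comp_of a"
  proof (rule component_least)
    fix y assume y: "y \<in> swapped.comp_of a \<inter> comp_of a"
    then show "t y \<in> swapped.comp_of a \<inter> comp_of a" by (auto intro: component.intros)
    have "m y \<in> swapped.comp_of a"
    proof (cases "y = a \<or> y = m a")
      case True
      then show ?thesis using swapped_comp_mem a component.base[of a t m'] by auto
    next
      case False
      then show ?thesis using m'_on_comp y component.snd[of y t m' a] by auto
    qed
    then show "m y \<in> swapped.comp_of a \<inter> comp_of a" using y by (auto intro: component.intros)
  qed (auto intro: component.base)
  then show ?thesis by blast
qed

lemma c_in_swapped: "c \<in> swapped.comp_of a"
  using component.snd[OF swapped_comp_mem] m'_vals(3) by simp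

end

end

context involution_pair_swap
begin

text \<open>The swap is symmetric in a and c, so what was shown for the component of a transfers to
  that of c.\<close>

lemma flip: "involution_pair_swap V t m c a"
  using a c ac by unfold_locales auto

lemma flip_m': "involution_pair_swap.m' m c a = m'"
  using involution_pair_swap.m'_def[OF flip] m'_def by (simp add: transpose_commute)

text \<open>The union of the two old components is stable under t and m', which bounds the new
  component from above; \<open>comp_subset_swapped\<close>, applied to a and through
  \<open>flip\<close> to c, bounds it from below. Elsewhere m and m' agree.\<close>

lemma comp_merged:
  assumes "c \<notin> comp_of a"
  shows "x \<in> comp_of a \<union> comp_of c \<Longrightarrow> swapped.comp_of x = comp_of a \<union> comp_of c"
    and "x \<in> V \<Longrightarrow> x \<notin> comp_of a \<union> comp_of c \<Longrightarrow> swapped.comp_of x = comp_of x"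
proof -
  note v = m'_eqs[OF m_ac(1)[OF assms]] m_ac[OF assms]
  have "a \<notin> comp_of c" using v by blast
  then have "comp_of c \<subseteq> swapped.comp_of c"
    using involution_pair_swap.comp_subset_swapped[OF flip] flip_m' by simp
  moreover have eq: "swapped.comp_of c = swapped.comp_of a"
    using swapped.comp_eq[OF a c_in_swapped[OF assms]] .
  ultimately have sup: "comp_of a \<union> comp_of c \<subseteq> swapped.comp_of a"
    using comp_subset_swapped[OF assms] by blast
  have sub: "swapped.comp_of a \<subseteq> comp_of a \<union> comp_of c"
  proof (rule component_least)
    fix y assume y: "y \<in> comp_of a \<union> comp_of c"
    then show "t y \<in> comp_of a \<union> comp_of c" by (auto intro: component.intros)
    have "y \<in> V" using y comp_subset a c by blast
    then show "m' y \<in> comp_of a \<union> comp_of c"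
      using y v by (cases "y \<in> {a, c, m a, m c}") (auto intro: component.intros)
  qed (auto intro: component.base)
  show "swapped.comp_of x = comp_of a \<union> comp_of c" if "x \<in> comp_of a \<union> comp_of c"
    using that sup sub swapped.comp_eq[OF a, of x] by auto
  show "swapped.comp_of x = comp_of x" if x: "x \<in> V" "x \<notin> comp_of a \<union> comp_of c"
  proof
    have dis: "y \<notin> {a, c, m a, m c}" "y \<in> V" if "y \<in> comp_of x" for y
    proof -
      have "y \<notin> comp_of a \<union> comp_of c"
        using x a c that comp_eq comp_sym component.base by (metis UnE UnI1 UnI2)
      then show "y \<notin> {a, c, m a, m c}" using v by blast
      show "y \<in> V" using comp_subset x that by blast
    qed
    show "swapped.comp_of x \<subseteq> comp_of x"
      using dis v(5) by (intro component_least) (auto intro: component.intros)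
    have "comp_of x \<subseteq> swapped.comp_of x \<inter> comp_of x"
    proof (rule component_least)
      fix y assume y: "y \<in> swapped.comp_of x \<inter> comp_of x"
      then have "m y = m' y" using dis v(5) by auto
      then have "m y \<in> swapped.comp_of x" using y component.snd[of y t m'] by auto
      then show "m y \<in> swapped.comp_of x \<inter> comp_of x" using y by (auto intro: component.snd)
    qed (auto intro: component.intros)
    then show "comp_of x \<subseteq> swapped.comp_of x" by blast
  qed
qed

lemma card_comps_merged:
  assumes "c \<notin> comp_of a" shows "card comps = card swapped.comps + 1"
proof -
  let ?R = "comps - {comp_of a, comp_of c}"
  have neq: "comp_of a \<noteq> comp_of c" using assms component.base by metis
  have R: "?R = comp_of ` (V - (comp_of a \<union> comp_of c))"
  proof -
    have "?R = comp_of ` {x \<in> V. comp_of x \<noteq> comp_of a \<and> comp_of x \<noteq> comp_of c}"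
      by (auto simp: comps_def)
    also have "{x \<in> V. comp_of x \<noteq> comp_of a \<and> comp_of x \<noteq> comp_of c} = V - (comp_of a \<union> comp_of c)"
      using comp_eq_iff a c by blast
    finally show ?thesis .
  qed
  have "swapped.comps = insert (comp_of a \<union> comp_of c) ?R"
  proof -
    have "V = (V - (comp_of a \<union> comp_of c)) \<union> (comp_of a \<union> comp_of c)"
      using comp_subset a c by blast
    then have "swapped.comps = swapped.comp_of ` (V - (comp_of a \<union> comp_of c))
        \<union> swapped.comp_of ` (comp_of a \<union> comp_of c)"
      unfolding swapped.comps_def by (metis image_Un)
    moreover have "swapped.comp_of ` (comp_of a \<union> comp_of c) = {comp_of a \<union> comp_of c}"
      using comp_merged(1)[OF assms] component.base[of a t m] by auto
    moreover have "swapped.comp_of ` (V - (comp_of a \<union> comp_of c)) = ?R"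
      unfolding R using comp_merged(2)[OF assms] by (intro image_cong) auto
    ultimately show ?thesis by simp
  qed
  moreover have "comp_of a \<union> comp_of c \<notin> ?R"
    using comps_eqI[of "comp_of a \<union> comp_of c" a] assms component.base by (metis DiffD1 UnI1 UnI2)
  moreover have "card comps = card ?R + 2"
    using neq a c finite_comps card_Diff_subset[of "{comp_of a, comp_of c}" comps]
      card_mono[of comps "{comp_of a, comp_of c}"]
    by (auto simp: comps_def)
  ultimately show ?thesis using finite_comps by simp
qed

end

subsection \<open>Alternating walks\<close>

text \<open>A cyclic listing of a component in which t pairs positions 2j and 2j+1, and m pairs 2j+1
  with the next position modulo the length. Adding \<open>length vs\<close> before subtracting 1
  gives the right predecessor of position 0.\<close>

definition alt_walk :: "('a \<Rightarrow> 'a) \<Rightarrow> ('a \<Rightarrow> 'a) \<Rightarrow> 'a list \<Rightarrow> bool" where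
  "alt_walk t m vs \<longleftrightarrow> distinct vs \<and> even (length vs) \<and> vs \<noteq> [] \<and>
    (\<forall>i<length vs. t (vs ! i) = vs ! (if even i then i + 1 else i - 1)) \<and>
    (\<forall>i<length vs. m (vs ! i) = vs ! (if odd i then (i + 1) mod length vs
                                    else (i + length vs - 1) mod length vs))"

lemma nonempty_even_length: "vs \<noteq> [] \<Longrightarrow> even (length vs) \<Longrightarrow> length vs \<ge> 2"
  by (cases "length vs" rule: nat.exhaust) (auto simp: Suc_le_eq elim: oddE intro!: Nat.gr0I)

context involution_pair
begin

lemma in_compsE:
  assumes "x \<in> V" obtains K where "K \<in> comps" "x \<in> K"
  using assms component.base by (metis comps_def imageI)

lemma comps_subset: "K \<in> comps \<Longrightarrow> x \<in> K \<Longrightarrow> x \<in> V"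
  using Union_comps by blast

fun walk :: "'a \<Rightarrow> nat \<Rightarrow> 'a" where
  "walk x 0 = x"
| "walk x (Suc i) = (if even i then t else m) (walk x i)"

lemma walk_in: "x \<in> V \<Longrightarrow> walk x i \<in> V"
  by (induction i) auto

lemma walk_comp: "walk x i \<in> comp_of x"
  by (induction i) (auto intro: component.intros)

lemma walk_back:
  "x \<in> V \<Longrightarrow> odd i \<Longrightarrow> t (walk x i) = walk x (i - 1)"
  "x \<in> V \<Longrightarrow> even i \<Longrightarrow> i > 0 \<Longrightarrow> m (walk x i) = walk x (i - 1)"
  using walk_in[of x "i - 1"] by (cases i; simp)+

text \<open>The involution that leads on from the earlier time is the one that leads back from the
  later time. Applying it to a coincidence moves both times inward, until at distance 1 it would
  have a fixed point.\<close>

lemma walk_odd_distance: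
  assumes "x \<in> V" "odd d" shows "walk x i \<noteq> walk x (i + d)"
  using assms(2)
proof (induction d arbitrary: i rule: less_induct)
  case (less d)
  have "d = 1 \<or> d \<ge> 3" using less.prems by presburger
  then consider "d = 1" | "d \<ge> 3" by blast
  then show ?case
  proof cases
    case 1
    then show ?thesis using walk_in[OF assms(1), of i] t_simps(2) m_simps(2) by (auto simp: eq_commute)
  next
    case 2
    show ?thesis
    proof
      assume eq: "walk x i = walk x (i + d)"
      have "walk x (Suc i) = walk x (i + d - 1)"
      proof (cases "even i")
        case True
        then have "t (walk x (i + d)) = walk x (i + d - 1)"
          using walk_back(1)[OF assms(1), of "i + d"] less.prems by simp
        then show ?thesis using True eq by simp
      next
        case False
        then have "m (walk x (i + d)) = walk x (i + d - 1)"
          using walk_back(2)[OF assms(1), of "i + d"] less.prems 2 by simp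
        then show ?thesis using False eq by simp
      qed
      moreover have "i + d - 1 = Suc i + (d - 2)" using 2 by simp
      moreover have "walk x (Suc i) \<noteq> walk x (Suc i + (d - 2))"
        using less.IH[of "d - 2" "Suc i"] less.prems 2 by simp
      ultimately show False by simp
    qed
  qed
qed

text \<open>At even distance both times are entered by the same involution, so a coincidence can be
  moved back step by step to time 0.\<close>

lemma walk_even_distance:
  assumes "x \<in> V" "walk x i = walk x (i + d)" "even d" shows "walk x d = x"
  using assms(2)
proof (induction i)
  case (Suc i)
  let ?f = "if even i then t else m"
  have "?f (walk x i) = ?f (walk x (i + d))"
    using Suc.prems assms(3) by simp
  then have "?f (?f (walk x i)) = ?f (?f (walk x (i + d)))" by simp
  then have "walk x i = walk x (i + d)"
    using walk_in[OF assms(1)] by (auto split: if_splits)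
  then show ?case by (rule Suc.IH)
qed simp

lemma exists_alt_walk:
  assumes x: "x \<in> V"
  shows "\<exists>vs. alt_walk t m vs \<and> set vs = comp_of x"
proof -
  \<comment> \<open>Only even times are compared: after a return to x at an even time the walk goes
    on with t, hence repeats itself.\<close>
  have "\<not> inj (\<lambda>i. walk x (2 * i))"
    using walk_in[OF x] finite_V by (metis finite_subset image_subsetI infinite_UNIV_nat range_inj_infinite)
  then obtain k l where kl: "walk x (2 * k) = walk x (2 * l)" "k \<noteq> l"
    unfolding inj_def by blast
  define i j where "i = min k l" and "j = max k l"
  have "i < j" "walk x (2 * i) = walk x (2 * j)"
    using kl by (auto simp: i_def j_def min_def max_def)
  then have ex: "walk x (2 * (j - i)) = x" "j - i > 0"
    using walk_even_distance[OF x, of "2 * i" "2 * (j - i)"] by (auto simp: algebra_simps)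
  \<comment> \<open>Half the least even return time. Minimality excludes repetitions at even
    distance within one period; those at odd distance never occur.\<close>
  define p where "p = (LEAST p. p > 0 \<and> walk x (2 * p) = x)"
  have p: "p > 0" "walk x (2 * p) = x"
    using LeastI[of "\<lambda>p. p > 0 \<and> walk x (2 * p) = x" "j - i"] ex unfolding p_def by auto
  have min: "walk x (2 * q) \<noteq> x" if "q > 0" "q < p" for q
    using not_less_Least[of q "\<lambda>p. p > 0 \<and> walk x (2 * p) = x"] that unfolding p_def by auto
  have inj: "walk x i \<noteq> walk x j" if "i < j" "j < 2 * p" for i j
  proof
    assume eq: "walk x i = walk x j"
    show False
    proof (cases "even (j - i)")
      case True
      then obtain q where q: "j - i = 2 * q" by blast
      have "walk x (j - i) = x"
        using walk_even_distance[OF x, of i "j - i"] True that eq by simp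
      then show False using min[of q] q that by simp
    next
      case False
      then show False using walk_odd_distance[OF x False, of i] that eq by simp
    qed
  qed
  define vs where "vs = map (walk x) [0..<2 * p]"
  have len: "length vs = 2 * p" and nth: "\<And>i. i < 2 * p \<Longrightarrow> vs ! i = walk x i"
    by (simp_all add: vs_def)
  have "distinct vs"
    unfolding distinct_conv_nth len using inj nth by (metis linorder_neqE_nat)
  moreover have tvs: "t (vs ! i) = vs ! (if even i then i + 1 else i - 1)" if "i < length vs" for i
    using that walk_back(1)[OF x, of i] p(1) unfolding len
    by (auto simp: nth)
  moreover have mvs: "m (vs ! i) = vs ! (if odd i then (i + 1) mod length vs else (i + length vs - 1) mod length vs)"
    if "i < length vs" for i
  proof -
    consider "odd i" "i + 1 < 2 * p" | "odd i" "i + 1 = 2 * p" | "even i" "i > 0" | "i = 0"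
      using \<open>i < length vs\<close> len by linarith
    then show ?thesis
    proof cases
      case 1
      then show ?thesis using that unfolding len by (simp add: nth)
    next
      case 2
      have "walk x (2 * p) = m (walk x i)" unfolding 2(2)[symmetric] using 2(1) by simp
      then show ?thesis using 2 that p unfolding len by (simp add: nth)
    next
      case 3
      then have "(i + 2 * p - 1) mod (2 * p) = i - 1"
        using that unfolding len by (simp add: mod_if)
      then show ?thesis using 3 walk_back(2)[OF x, of i] that unfolding len by (simp add: nth)
    next
      case 4
      have "m (walk x (2 * p)) = walk x (2 * p - 1)"
        using walk_back(2)[OF x, of "2 * p"] p(1) by simp
      then show ?thesis using 4 p unfolding len by (simp add: nth)
    qed
  qed
  ultimately have aw: "alt_walk t m vs"
    unfolding alt_walk_def using len p(1) by auto
  have "comp_of x \<subseteq> set vs"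
  proof (rule component_least)
    show "x \<in> set vs" using p(1) nth[of 0] len by (metis nth_mem walk.simps(1) nat_0_less_mult_iff zero_less_numeral)
    fix y assume "y \<in> set vs"
    then obtain i where i: "i < length vs" "y = vs ! i" by (metis in_set_conv_nth)
    have "(if even i then i + 1 else i - 1) < length vs"
      using i(1) len by (auto; presburger)
    then show "t y \<in> set vs" using tvs[OF i(1)] i(2) by (metis nth_mem)
    have "(if odd i then (i + 1) mod length vs else (i + length vs - 1) mod length vs) < length vs"
      using p(1) len by simp
    then show "m y \<in> set vs" using mvs[OF i(1)] i(2) by (metis nth_mem)
  qed
  moreover have "set vs \<subseteq> comp_of x" by (auto simp: vs_def walk_comp)
  ultimately show ?thesis using aw by blast
qed

end

subsection \<open>Isomorphism of pairs of involutions\<close>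

lemma bij_betw_same_fibre_card:
  assumes "finite A" "finite B" "\<And>s. card {a \<in> A. f a = s} = card {b \<in> B. g b = s}"
  shows "\<exists>h. bij_betw h A B \<and> (\<forall>a\<in>A. g (h a) = f a)"
proof -
  have "\<exists>h. bij_betw h {a \<in> A. f a = s} {b \<in> B. g b = s}" for s
    using assms by (intro finite_same_card_bij) auto
  then obtain h where h: "\<And>s. bij_betw (h s) {a \<in> A. f a = s} {b \<in> B. g b = s}" by metis
  let ?h = "\<lambda>a. h (f a) a"
  have img: "?h a \<in> B" "g (?h a) = f a" if "a \<in> A" for a
    using bij_betwE[OF h[of "f a"]] that by auto
  have "inj_on ?h A"
  proof (rule inj_onI)
    fix a b assume ab: "a \<in> A" "b \<in> A" "?h a = ?h b"
    then have "f a = f b" using img by metis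
    then show "a = b" using ab inj_onD[OF bij_betw_imp_inj_on[OF h[of "f b"]], of a b] by auto
  qed
  moreover have "B \<subseteq> ?h ` A"
  proof
    fix b assume "b \<in> B"
    then have "b \<in> h (g b) ` {a \<in> A. f a = g b}"
      using bij_betw_imp_surj_on[OF h[of "g b"]] by auto
    then obtain a where "a \<in> A" "f a = g b" "b = h (g b) a" by auto
    then show "b \<in> ?h ` A" by (intro image_eqI[of _ _ a]) simp_all
  qed
  ultimately have "bij_betw ?h A B" using img by (auto simp: bij_betw_def)
  then show ?thesis using img by blast
qed

text \<open>Components of equal size are paired up, and their alternating walks are mapped to each
  other position by position. How both involutions act on the positions of a walk depends only on
  its length.\<close>

lemma involution_pair_iso:
  assumes "involution_pair V t m" "involution_pair V t m2"
    and card: "\<And>s. card {K \<in> involution_pair.comps V t m. card K = s} =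
                  card {K \<in> involution_pair.comps V t m2. card K = s}"
  shows "\<exists>b. b permutes V \<and> (\<forall>x\<in>V. b (t x) = t (b x)) \<and> (\<forall>x\<in>V. b (m x) = m2 (b x))"
proof -
  interpret P: involution_pair V t m by fact
  interpret Q: involution_pair V t m2 by fact
  obtain h where h: "bij_betw h P.comps Q.comps" and hc: "\<And>K. K \<in> P.comps \<Longrightarrow> card (h K) = card K"
    using bij_betw_same_fibre_card[OF P.finite_comps Q.finite_comps card] by blast
  have "\<forall>K\<in>P.comps. \<exists>vs. alt_walk t m vs \<and> set vs = K" "\<forall>K\<in>Q.comps. \<exists>vs. alt_walk t m2 vs \<and> set vs = K"
    using P.exists_alt_walk Q.exists_alt_walk by (auto simp: P.comps_def Q.comps_def)
  then obtain L L2 where L: "\<And>K. K \<in> P.comps \<Longrightarrow> alt_walk t m (L K) \<and> set (L K) = K"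
    and L2: "\<And>K. K \<in> Q.comps \<Longrightarrow> alt_walk t m2 (L2 K) \<and> set (L2 K) = K" by metis
  have hK: "h K \<in> Q.comps" if "K \<in> P.comps" for K using h that bij_betwE by blast
  have len: "length (L2 (h K)) = length (L K)" if "K \<in> P.comps" for K
    using L[OF that] L2[OF hK[OF that]] hc[OF that] unfolding alt_walk_def by (metis distinct_card)
  define ix where "ix x = (THE i. i < length (L (P.comp_of x)) \<and> L (P.comp_of x) ! i = x)" for x
  define b where "b x = (if x \<in> V then L2 (h (P.comp_of x)) ! ix x else x)" for x
  have compK: "P.comp_of x = K" if "K \<in> P.comps" "x \<in> K" for K x
    using P.comps_eqI[OF that] by simp
  have b_nth: "b (L K ! i) = L2 (h K) ! i" if "K \<in> P.comps" "i < length (L K)" for K i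
  proof -
    have mem: "L K ! i \<in> K" using L[OF that(1)] that(2) by (metis nth_mem)
    then have "P.comp_of (L K ! i) = K" "L K ! i \<in> V"
      using compK[OF that(1)] P.comps_subset[OF that(1)] by simp_all
    moreover have "ix (L K ! i) = i"
      unfolding ix_def calculation using L[OF that(1)] that(2)
      by (intro the_equality) (auto simp: alt_walk_def nth_eq_iff_index_eq)
    ultimately show ?thesis by (simp add: b_def)
  qed
  have ex: "\<exists>K i. K \<in> P.comps \<and> i < length (L K) \<and> x = L K ! i" if "x \<in> V" for x
  proof -
    obtain K where K: "K \<in> P.comps" "x \<in> K" by (rule P.in_compsE[OF \<open>x \<in> V\<close>])
    then have "x \<in> set (L K)" using L by simp
    then show ?thesis using K(1) by (metis in_set_conv_nth)
  qed
  have Kne: "length (L K) > 0" "even (length (L K))" if "K \<in> P.comps" for K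
    using L[OF that] by (auto simp: alt_walk_def)
  have hom: "b (t x) = t (b x)" "b (m x) = m2 (b x)" if "x \<in> V" for x
  proof -
    obtain K i where K: "K \<in> P.comps" "i < length (L K)" "x = L K ! i" using ex[OF \<open>x \<in> V\<close>] by blast
    let ?i = "if even i then i + 1 else i - 1"
    let ?j = "if odd i then (i + 1) mod length (L K) else (i + length (L K) - 1) mod length (L K)"
    have ij: "?i < length (L K)" "?j < length (L K)"
    proof -
      show "?i < length (L K)"
      proof (cases "even i")
        case True
        then have "Suc i < length (L K)" using K(2) Kne(2)[OF K(1)] by (metis Suc_lessI even_Suc)
        then show ?thesis using True by simp
      qed (use K(2) in simp)
      show "?j < length (L K)" using Kne(1)[OF K(1)] by simp
    qed
    have "t x = L K ! ?i" "t (L2 (h K) ! i) = L2 (h K) ! ?i"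
      using L[OF K(1)] L2[OF hK[OF K(1)]] K len[OF K(1)] unfolding alt_walk_def by metis+
    then show "b (t x) = t (b x)" using b_nth[OF K(1)] ij K by metis
    have "m x = L K ! ?j" "m2 (L2 (h K) ! i) = L2 (h K) ! ?j"
      using L[OF K(1)] L2[OF hK[OF K(1)]] K len[OF K(1)] unfolding alt_walk_def by metis+
    then show "b (m x) = m2 (b x)" using b_nth[OF K(1)] ij K by metis
  qed
  have "V \<subseteq> b ` V"
  proof
    fix y assume "y \<in> V"
    then obtain M where M: "M \<in> Q.comps" "y \<in> M" by (rule Q.in_compsE)
    then obtain K where K: "K \<in> P.comps" "M = h K" using h by (auto simp: bij_betw_def)
    have "y \<in> set (L2 (h K))" using L2 M K by simp
    then obtain i where i: "i < length (L K)" "y = L2 (h K) ! i"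
      using len[OF K(1)] by (metis in_set_conv_nth)
    have "L K ! i \<in> K" using L[OF K(1)] nth_mem[OF i(1)] by simp
    then have "L K ! i \<in> V" using P.comps_subset K(1) by simp
    then show "y \<in> b ` V"
      using b_nth[OF K(1) i(1)] i(2) by (intro image_eqI[of _ _ "L K ! i"]) simp_all
  qed
  moreover have "b ` V \<subseteq> V"
  proof
    fix y assume "y \<in> b ` V"
    then obtain x where "x \<in> V" "y = b x" by blast
    then obtain K i where K: "K \<in> P.comps" "i < length (L K)" "x = L K ! i" using ex by blast
    have "y \<in> set (L2 (h K))" using \<open>y = b x\<close> b_nth[OF K(1,2)] K len[OF K(1)] by simp
    then show "y \<in> V" using L2[OF hK[OF K(1)]] Q.comps_subset[OF hK[OF K(1)]] by simp
  qed
  ultimately have surj: "b ` V = V" by blast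
  then have "inj_on b V" using P.finite_V by (intro eq_card_imp_inj_on) auto
  then have "b permutes V"
    using surj by (intro bij_imp_permutes) (auto simp: bij_betw_def b_def)
  then show ?thesis using hom by blast
qed

subsection \<open>Cycles of the multigraph of two involutions\<close>

text \<open>For length 2 the two listed edges coincide as sets, and the multiset then records the
  double edge.\<close>

lemma filter_cycle_edges:
  assumes "distinct vs" "length vs \<ge> 2" "j < length vs"
  shows "filter_mset (\<lambda>e. vs ! j \<in> e) (cycle_edges vs) =
    {#{vs ! j, vs ! (Suc j mod length vs)}, {vs ! ((j + length vs - 1) mod length vs), vs ! j}#}"
proof -
  let ?r = "length vs" let ?k = "(j + length vs - 1) mod length vs"
  have k: "?k < ?r" "Suc ?k mod ?r = j" "?k \<noteq> j"
  proof -
    show "?k < ?r" using assms by (intro mod_less_divisor) linarith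
    have "Suc (j + ?r - 1) = j + ?r" using assms by linarith
    then show suc: "Suc ?k mod ?r = j" using assms(3) mod_Suc_eq[of "j + ?r - 1" ?r] by simp
    show "?k \<noteq> j"
    proof
      assume "?k = j"
      then have "Suc j mod ?r = j" using suc by simp
      then show False using assms by (cases "Suc j = ?r") auto
    qed
  qed
  have iff: "vs ! j \<in> {vs ! i, vs ! (Suc i mod ?r)} \<longleftrightarrow> i \<in> {j, ?k}" if "i < ?r" for i
  proof -
    have "vs ! j = vs ! i \<longleftrightarrow> i = j" using assms that by (auto simp: nth_eq_iff_index_eq)
    moreover have "Suc i mod ?r < ?r" using assms by (intro mod_less_divisor) linarith
    then have "vs ! j = vs ! (Suc i mod ?r) \<longleftrightarrow> Suc i mod ?r = j"
      using assms that by (auto simp: nth_eq_iff_index_eq)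
    moreover have "Suc i mod ?r = j \<longleftrightarrow> i = ?k"
    proof
      assume "Suc i mod ?r = j"
      then have "Suc i mod ?r = Suc ?k mod ?r" using k by simp
      then show "i = ?k" using that k(1) by (auto simp: mod_Suc split: if_splits)
    qed (use k in simp)
    ultimately show ?thesis by auto
  qed
  have "filter_mset (\<lambda>i. vs ! j \<in> {vs ! i, vs ! (Suc i mod ?r)}) (mset_set {..<?r}) = mset_set {j, ?k}"
  proof -
    have "{i \<in> {..<?r}. vs ! j \<in> {vs ! i, vs ! (Suc i mod ?r)}} = {j, ?k}"
      using iff assms k by blast
    then show ?thesis by (simp add: filter_mset_mset_set)
  qed
  then show ?thesis
    using k by (simp add: cycle_edges_def filter_mset_image_mset)
qed

context involution_pair
begin

context
  fixes E :: "'a set multiset"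
  assumes E_at: "\<And>v. v \<in> V \<Longrightarrow> filter_mset (\<lambda>e. v \<in> e) E = {#{v, t v}, {v, m v}#}"
    and E_sub: "\<And>e. e \<in># E \<Longrightarrow> e \<subseteq> V"
begin

lemma cycle_edges_at:
  assumes "alt_walk t m vs" "j < length vs"
  shows "filter_mset (\<lambda>e. vs ! j \<in> e) (cycle_edges vs) = {#{vs ! j, t (vs ! j)}, {vs ! j, m (vs ! j)}#}"
proof -
  have aw: "distinct vs" "even (length vs)" "vs \<noteq> []"
    "t (vs ! j) = vs ! (if even j then j + 1 else j - 1)"
    "m (vs ! j) = vs ! (if odd j then (j + 1) mod length vs else (j + length vs - 1) mod length vs)"
    using assms by (auto simp: alt_walk_def)
  have len: "length vs \<ge> 2" using nonempty_even_length aw by blast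
  show ?thesis
  proof (cases "even j")
    case True
    then have "Suc j < length vs" using aw(2) assms(2) by presburger
    then show ?thesis
      using filter_cycle_edges[OF aw(1) len assms(2)] aw(4,5) True by (simp add: insert_commute)
  next
    case False
    then have "j > 0" by (cases j) auto
    then have "(j + length vs - 1) mod length vs = j - 1" using assms(2) by (simp add: mod_if)
    then show ?thesis
      using filter_cycle_edges[OF aw(1) len assms(2)] aw(4,5) False by (simp add: insert_commute)
  qed
qed

text \<open>Every edge counted on either side contains a vertex of the list, and its multiplicity
  can be read off at that vertex.\<close>

lemma cycle_edges_eq_filter:
  assumes "\<And>v. v \<in> set vs \<Longrightarrow> filter_mset (\<lambda>e. v \<in> e) (cycle_edges vs) = filter_mset (\<lambda>e. v \<in> e) E"
  shows "cycle_edges vs = filter_mset (\<lambda>e. e \<inter> set vs \<noteq> {}) E"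
proof (rule multiset_eqI)
  fix e
  show "count (cycle_edges vs) e = count (filter_mset (\<lambda>e. e \<inter> set vs \<noteq> {}) E) e"
  proof (cases "e \<inter> set vs = {}")
    case True
    have "e \<notin># cycle_edges vs"
    proof
      assume "e \<in># cycle_edges vs"
      then obtain i where "i < length vs" "vs ! i \<in> e" by (auto simp: cycle_edges_def)
      then show False using True nth_mem by blast
    qed
    then show ?thesis using True by (simp add: not_in_iff)
  next
    case False
    then obtain v where v: "v \<in> e" "v \<in> set vs" by blast
    have "count (cycle_edges vs) e = count (filter_mset (\<lambda>e. v \<in> e) (cycle_edges vs)) e" using v by simp
    also have "\<dots> = count E e" using assms[OF v(2)] v by simp
    finally show ?thesis using False by simp
  qed
qed

text \<open>A cycle cannot omit an edge at one of its vertices, so its vertex set is closed under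
  both involutions and fills a component. Conversely the alternating walk of a component traces such
  a cycle.\<close>

lemma multigraph_cycles_eq:
  "multigraph_cycles E = (\<lambda>K. filter_mset (\<lambda>e. e \<inter> K \<noteq> {}) E) ` comps"
proof (intro equalityI subsetI)
  fix c assume "c \<in> multigraph_cycles E"
  then obtain vs where vs: "c = cycle_edges vs" "length vs \<ge> 2" "distinct vs" "cycle_edges vs \<subseteq># E"
    by (auto simp: multigraph_cycles_def)
  have edge: "{vs ! i, vs ! (Suc i mod length vs)} \<in># E" if "i < length vs" for i
    using vs(4) that by (intro mset_subset_eqD[OF vs(4)]) (auto simp: cycle_edges_def)
  have sub: "set vs \<subseteq> V"
  proof
    fix v assume "v \<in> set vs"
    then obtain i where "i < length vs" "v = vs ! i" by (metis in_set_conv_nth)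
    then show "v \<in> V" using E_sub[OF edge] by blast
  qed
  have at: "filter_mset (\<lambda>e. v \<in> e) (cycle_edges vs) = filter_mset (\<lambda>e. v \<in> e) E" if "v \<in> set vs" for v
  proof -
    obtain j where j: "j < length vs" "v = vs ! j" using \<open>v \<in> set vs\<close> by (metis in_set_conv_nth)
    \<comment> \<open>The cycle uses two edges at each of its vertices and E has only two there, so
      the inclusion of multisets is an equality.\<close>
    have "size (filter_mset (\<lambda>e. v \<in> e) E) = size (filter_mset (\<lambda>e. v \<in> e) (cycle_edges vs))"
      using E_at sub that filter_cycle_edges[OF vs(3,2) j(1)] j(2) by (simp add: subset_iff)
    moreover have "filter_mset (\<lambda>e. v \<in> e) (cycle_edges vs) \<subseteq># filter_mset (\<lambda>e. v \<in> e) E"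
      using vs(4) by (rule multiset_filter_mono)
    ultimately show ?thesis by (metis mset_subset_size subset_mset.le_less less_irrefl)
  qed
  have ceq: "c = filter_mset (\<lambda>e. e \<inter> set vs \<noteq> {}) E"
    using cycle_edges_eq_filter[of vs] at vs(1) by blast
  have closed: "t v \<in> set vs" "m v \<in> set vs" if "v \<in> set vs" for v
  proof -
    have "{v, t v} \<in># filter_mset (\<lambda>e. v \<in> e) (cycle_edges vs)" "{v, m v} \<in># filter_mset (\<lambda>e. v \<in> e) (cycle_edges vs)"
      unfolding at[OF that] E_at[OF subsetD[OF sub that]] by simp_all
    then have "{v, t v} \<in># cycle_edges vs" "{v, m v} \<in># cycle_edges vs" by simp_all
    moreover have "e \<subseteq> set vs" if "e \<in># cycle_edges vs" for e
    proof -
      obtain i where "i < length vs" "e = {vs ! i, vs ! (Suc i mod length vs)}"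
        using \<open>e \<in># cycle_edges vs\<close> by (auto simp: cycle_edges_def)
      moreover have "Suc i mod length vs < length vs"
        using vs(2) by (intro mod_less_divisor) linarith
      ultimately show ?thesis using nth_mem by simp
    qed
    ultimately show "t v \<in> set vs" "m v \<in> set vs" by blast+
  qed
  have v0: "vs ! 0 \<in> set vs" using vs(2) by (intro nth_mem) linarith
  then have v0V: "vs ! 0 \<in> V" using sub by blast
  have in_comp: "vs ! i \<in> comp_of (vs ! 0)" if "i < length vs" for i
    using that
  proof (induction i)
    case (Suc i)
    let ?e = "{vs ! i, vs ! Suc i}"
    have e: "?e \<in># E" using edge[of i] Suc.prems by simp
    have V: "vs ! i \<in> V" using e E_sub by blast
    have "?e \<in># filter_mset (\<lambda>e. vs ! i \<in> e) E" using e by simp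
    then have "?e = {vs ! i, t (vs ! i)} \<or> ?e = {vs ! i, m (vs ! i)}" using E_at[OF V] by auto
    moreover have "vs ! i \<noteq> vs ! Suc i" using vs(3) Suc.prems by (simp add: nth_eq_iff_index_eq)
    ultimately have "vs ! Suc i = t (vs ! i) \<or> vs ! Suc i = m (vs ! i)" by (auto simp: doubleton_eq_iff)
    then show ?case using Suc by (auto intro: component.intros)
  qed (rule component.base)
  then have "set vs \<subseteq> comp_of (vs ! 0)" by (auto simp: in_set_conv_nth)
  moreover have "comp_of (vs ! 0) \<subseteq> set vs" using v0 closed by (intro component_least)
  ultimately have "set vs \<in> comps" using v0V by (auto simp: comps_def)
  then show "c \<in> (\<lambda>K. filter_mset (\<lambda>e. e \<inter> K \<noteq> {}) E) ` comps" using ceq by blast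
next
  fix c assume "c \<in> (\<lambda>K. filter_mset (\<lambda>e. e \<inter> K \<noteq> {}) E) ` comps"
  then obtain x where x: "x \<in> V" "c = filter_mset (\<lambda>e. e \<inter> comp_of x \<noteq> {}) E" by (auto simp: comps_def)
  obtain vs where vs: "alt_walk t m vs" "set vs = comp_of x" using exists_alt_walk[OF x(1)] by blast
  have "filter_mset (\<lambda>e. v \<in> e) (cycle_edges vs) = filter_mset (\<lambda>e. v \<in> e) E" if "v \<in> set vs" for v
  proof -
    have "v \<in> V" using that vs(2) comp_subset[OF x(1)] by blast
    then show ?thesis using cycle_edges_at[OF vs(1)] E_at that by (metis in_set_conv_nth)
  qed
  then have c: "c = cycle_edges vs" using cycle_edges_eq_filter[of vs] x(2) vs(2) by simp
  have "distinct vs" "length vs \<ge> 2"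
    using vs(1) by (auto simp: alt_walk_def dest!: nonempty_even_length)
  moreover have "cycle_edges vs \<subseteq># E" unfolding c[symmetric] x(2) by simp
  ultimately show "c \<in> multigraph_cycles E" using c by (auto simp: multigraph_cycles_def)
qed

text \<open>A component is recovered from its cycle as the union of the edges, so different
  components give different cycles.\<close>

lemma card_multigraph_cycles: "card (multigraph_cycles E) = card comps"
proof -
  have "\<Union>(set_mset (filter_mset (\<lambda>e. e \<inter> K \<noteq> {}) E)) = K" if "K \<in> comps" for K
  proof (intro equalityI subsetI)
    fix y assume "y \<in> \<Union>(set_mset (filter_mset (\<lambda>e. e \<inter> K \<noteq> {}) E))"
    then obtain e z where e: "e \<in># E" "y \<in> e" "z \<in> e" "z \<in> K" by auto
    have "z \<in> V" using e E_sub by blast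
    have "e \<in># filter_mset (\<lambda>e. z \<in> e) E" using e by simp
    then have "e = {z, t z} \<or> e = {z, m z}" using E_at[OF \<open>z \<in> V\<close>] by auto
    moreover have "{z, t z, m z} \<subseteq> comp_of z" by (auto intro: component.intros)
    ultimately show "y \<in> K" using comps_eqI[OF that e(4)] e(2) by auto
  next
    fix y assume y: "y \<in> K"
    then have "y \<in> V" using comps_subset that by simp
    then have "{y, t y} \<in># filter_mset (\<lambda>e. y \<in> e) E" using E_at by simp
    then show "y \<in> \<Union>(set_mset (filter_mset (\<lambda>e. e \<inter> K \<noteq> {}) E))" using y by auto
  qed
  then have "inj_on (\<lambda>K. filter_mset (\<lambda>e. e \<inter> K \<noteq> {}) E) comps"
    by (metis (no_types, lifting) inj_onI)
  then show ?thesis unfolding multigraph_cycles_eq by (rule card_image)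
qed

end

end

section \<open>Perfect matchings and coset types\<close>

definition vertices :: "nat \<Rightarrow> nat set" where
  "vertices n = {1..2 * n}"

lemma vertices_iff [simp]: "x \<in> vertices n \<longleftrightarrow> 1 \<le> x \<and> x \<le> 2 * n"
  by (simp add: vertices_def)

lemma card_vertices [simp]: "card (vertices n) = 2 * n"
  by (simp add: vertices_def)

lemma std_involution_simps:
  "x \<in> vertices n \<Longrightarrow> odd x \<Longrightarrow> std_involution n x = x + 1"
  "x \<in> vertices n \<Longrightarrow> even x \<Longrightarrow> std_involution n x = x - 1"
  "x \<notin> vertices n \<Longrightarrow> std_involution n x = x"
  by (auto simp: std_involution_def)

lemma std_involution_pair: "i < n \<Longrightarrow> std_involution n (2 * i + 1) = 2 * i + 2"
  "i < n \<Longrightarrow> std_involution n (2 * i + 2) = 2 * i + 1"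
  by (simp_all add: std_involution_def)

lemma std_involution_involution: "std_involution n (std_involution n x) = x"
proof (cases "x \<in> vertices n")
  case True
  then show ?thesis by (cases "odd x"; auto simp: std_involution_def elim!: oddE evenE; presburger)
qed (auto simp: std_involution_def)

lemma fpf_std_involution: "fpf_involution (vertices n) (std_involution n)"
  unfolding fpf_involution_def
proof
  fix x assume x: "x \<in> vertices n"
  then have "std_involution n x \<in> vertices n" "std_involution n x \<noteq> x"
    by (cases "odd x"; auto simp: std_involution_def elim!: oddE evenE; presburger)+
  then show "std_involution n x \<in> vertices n \<and> std_involution n x \<noteq> x \<and>
      std_involution n (std_involution n x) = x"
    by (simp add: std_involution_involution)
qed

text \<open>The components of size \<open>2k\<close> of a matching are encoded by their largest pair: if this is
  \<open>{2i+1, 2i+2}\<close>, the \<open>i\<close>-th entry is \<open>k - 1\<close>. All other entries are \<open>0\<close>.\<close>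

definition excess :: "nat \<Rightarrow> (nat \<Rightarrow> nat) \<Rightarrow> nat \<Rightarrow> nat" where
  "excess n m i =
    (let K = component (std_involution n) m (2 * i + 2)
     in if i < n \<and> Max K = 2 * i + 2 then card K div 2 - 1 else 0)"

text \<open>The number of merges that build the matching from the standard one, i.e. n minus the
  number of components.\<close>

definition excess_degree :: "nat \<Rightarrow> (nat \<Rightarrow> nat) \<Rightarrow> nat" where
  "excess_degree n m = (\<Sum>i<n. excess n m i)"

definition excess_length :: "nat \<Rightarrow> (nat \<Rightarrow> nat) \<Rightarrow> nat" where
  "excess_length n m = card {i. excess n m i \<noteq> 0}"

locale matching =
  fixes n :: nat and m :: "nat \<Rightarrow> nat"
  assumes fpf: "fpf_involution (vertices n) m"
begin

sublocale involution_pair "vertices n" "std_involution n" m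
  by unfold_locales (use fpf fpf_std_involution in \<open>auto simp: vertices_def\<close>)

text \<open>The standard partner of an odd vertex is its successor, so the largest vertex of a
  component is even and closes a standard pair.\<close>

lemma Max_comp:
  assumes "K \<in> comps"
  obtains i where "i < n" "Max K = 2 * i + 2" "K = comp_of (2 * i + 2)"
proof -
  obtain x where x: "x \<in> vertices n" "K = comp_of x" using assms unfolding comps_def by blast
  have fin: "finite K" "K \<noteq> {}"
    unfolding x(2) using finite_comp[OF x(1)] component.base[of x "std_involution n" m] by auto
  then have M: "Max K \<in> K" by simp
  then have V: "Max K \<in> vertices n" using comps_subset[OF assms] by simp
  have "even (Max K)"
  proof (rule ccontr)
    assume "odd (Max K)"
    then have "Max K + 1 \<in> K"
      using M V component.fst[of "Max K" "std_involution n" m x] x(2) std_involution_simps(1) by metis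
    then show False using Max_ge[OF fin(1)] by fastforce
  qed
  then obtain j where j: "Max K = 2 * j" by blast
  then have "j - 1 < n" "Max K = 2 * (j - 1) + 2" using V by auto
  then show thesis using that comps_eqI[OF assms M] by metis
qed

definition tops :: "nat set" where
  "tops = {i. i < n \<and> Max (comp_of (2 * i + 2)) = 2 * i + 2}"

lemma bij_tops: "bij_betw (\<lambda>i. comp_of (2 * i + 2)) tops comps"
  unfolding bij_betw_def
proof
  show "inj_on (\<lambda>i. comp_of (2 * i + 2)) tops"
  proof (rule inj_onI)
    fix i j assume i: "i \<in> tops" and j: "j \<in> tops"
      and eq: "comp_of (2 * i + 2) = comp_of (2 * j + 2)"
    have "Max (comp_of (2 * i + 2)) = 2 * i + 2" using i by (simp add: tops_def)
    moreover have "Max (comp_of (2 * j + 2)) = 2 * j + 2" using j by (simp add: tops_def)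
    ultimately show "i = j" unfolding eq by linarith
  qed
  show "(\<lambda>i. comp_of (2 * i + 2)) ` tops = comps"
  proof (intro equalityI subsetI)
    fix K assume "K \<in> comps"
    then obtain i where "i < n" "Max K = 2 * i + 2" "K = comp_of (2 * i + 2)" by (rule Max_comp)
    then show "K \<in> (\<lambda>i. comp_of (2 * i + 2)) ` tops"
      by (intro image_eqI[of _ _ i]) (simp_all add: tops_def)
  qed (auto simp: tops_def comps_def)
qed

lemma excess_tops: "i \<in> tops \<Longrightarrow> card (comp_of (2 * i + 2)) = 2 * (excess n m i + 1)"
proof -
  assume i: "i \<in> tops"
  then have "2 * i + 2 \<in> vertices n" by (simp add: tops_def)
  then have "even (card (comp_of (2 * i + 2)))" "card (comp_of (2 * i + 2)) \<ge> 2"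
    using even_card_comp card_comp_ge_2 by simp_all
  then show ?thesis using i by (auto simp: excess_def tops_def Let_def elim!: evenE)
qed

lemma excess_not_tops: "i \<notin> tops \<Longrightarrow> excess n m i = 0"
  by (auto simp: excess_def tops_def Let_def)

lemma excess_ge: "i \<ge> n \<Longrightarrow> excess n m i = 0"
  by (simp add: excess_def)

lemma excess_support: "{i. excess n m i \<noteq> 0} \<subseteq> {..<n}"
  by (rule subsetI, rule ccontr) (simp add: excess_ge)

lemma finite_excess: "finite {i. excess n m i \<noteq> 0}"
  using finite_subset[OF excess_support] by simp

lemma card_comps_filter:
  "card {K \<in> comps. P (card K)} = card {i \<in> tops. P (2 * (excess n m i + 1))}"
proof -
  have "bij_betw (\<lambda>i. comp_of (2 * i + 2)) {i \<in> tops. P (2 * (excess n m i + 1))} {K \<in> comps. P (card K)}"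
    by (rule bij_betw_Collect[OF bij_tops]) (simp only: excess_tops)
  then show ?thesis by (simp add: bij_betw_same_card)
qed

text \<open>The 2n vertices are counted by components: the one with top i contributes twice its
  entry plus 1.\<close>

lemma excess_degree_add_card_comps: "excess_degree n m + card comps = n"
proof -
  have "excess_degree n m = (\<Sum>i\<in>tops. excess n m i)"
    unfolding excess_degree_def using excess_not_tops
    by (intro sum.mono_neutral_right) (auto simp: tops_def)
  moreover have "card comps = card tops" using bij_tops by (simp add: bij_betw_same_card)
  ultimately have "excess_degree n m + card comps = (\<Sum>i\<in>tops. excess n m i + 1)"
    by (simp add: sum_Suc)
  then have "2 * (excess_degree n m + card comps) = (\<Sum>i\<in>tops. card (comp_of (2 * i + 2)))"
    by (simp only: sum_distrib_left excess_tops cong: sum.cong)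
  also have "\<dots> = (\<Sum>K\<in>comps. card K)"
    by (rule sum.reindex_bij_betw[OF bij_tops])
  also have "\<dots> = card (\<Union>comps)"
    using comps_disjoint finite_comp finite_V Union_comps
    by (intro card_Union_disjoint[symmetric]) (auto simp: pairwise_def disjnt_def comps_def)
  also have "\<dots> = 2 * n" by (simp add: Union_comps)
  finally show ?thesis by simp
qed

lemma excess_pos_iff:
  assumes "i \<in> tops"
  shows "excess n m i = 0 \<longleftrightarrow> m (2 * i + 1) = 2 * i + 2"
proof -
  have V: "2 * i + 1 \<in> vertices n" "2 * i + 2 \<in> vertices n" and i: "i < n"
    using assms by (auto simp: tops_def)
  have "excess n m i = 0 \<longleftrightarrow> card (comp_of (2 * i + 2)) = 2" using excess_tops[OF assms] by simp
  also have "\<dots> \<longleftrightarrow> m (2 * i + 2) = 2 * i + 1"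
    unfolding card_comp_eq_2_iff[OF V(2)] std_involution_pair(2)[OF i] ..
  also have "\<dots> \<longleftrightarrow> m (2 * i + 1) = 2 * i + 2" using m_simps(3)[OF V(1)] m_simps(3)[OF V(2)] by metis
  finally show ?thesis .
qed

lemma comp_pair: "i < n \<Longrightarrow> comp_of (2 * i + 1) = comp_of (2 * i + 2)"
  using std_involution_pair(2)[of i n] component.fst[OF component.base, of "std_involution n" "2 * i + 2" m]
  by (intro comp_eq) auto

end

text \<open>A rearrangement preserves the sizes of the nontrivial components, and n then fixes the
  number of trivial ones. Since the standard involution occurs in both pairs, the resulting
  isomorphism commutes with it.\<close>

lemma excess_rearrangement_iso:
  assumes "matching n m" "matching n m2" "bij \<pi>" "excess n m \<circ> \<pi> = excess n m2"
  shows "\<exists>b\<in>hyperoct n. \<forall>x\<in>vertices n. b (m x) = m2 (b x)"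
proof -
  interpret P: matching n m by fact
  interpret Q: matching n m2 by fact
  have e2: "excess n m2 i = excess n m (\<pi> i)" for i using assms(4) by (auto simp: fun_eq_iff)
  have bij_eq: "bij_betw \<pi> {i. S (excess n m2 i)} {i. S (excess n m i)}" for S
    using assms(3) by (auto simp: e2 bij_betw_def inj_on_def bij_def surj_def)
  then have card_eq: "card {i. S (excess n m2 i)} = card {i. S (excess n m i)}" for S
    by (rule bij_betw_same_card)
  have deg: "excess_degree n m = excess_degree n m2"
  proof -
    have "excess_degree n m = (\<Sum>i | excess n m i \<noteq> 0. excess n m i)"
      unfolding excess_degree_def by (rule sum.mono_neutral_right) (use P.excess_support in auto)
    also have "\<dots> = (\<Sum>i | excess n m2 i \<noteq> 0. excess n m2 i)"
      using bij_eq[of "\<lambda>k. k \<noteq> 0"] unfolding e2 by (rule sum.reindex_bij_betw[symmetric])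
    also have "\<dots> = excess_degree n m2"
      unfolding excess_degree_def by (rule sum.mono_neutral_left) (use Q.excess_support in auto)
    finally show ?thesis .
  qed
  have "card {K \<in> P.comps. card K = s} = card {K \<in> Q.comps. card K = s}" for s
  proof (cases "s = 2")
    case False
    have "{i \<in> matching.tops n m'. 2 * (excess n m' i + 1) = s} = {i. excess n m' i \<noteq> 0 \<and> 2 * (excess n m' i + 1) = s}"
      if "matching n m'" for m'
      using matching.excess_not_tops[OF that] False by fastforce
    then show ?thesis
      using P.card_comps_filter[of "\<lambda>k. k = s"] Q.card_comps_filter[of "\<lambda>k. k = s"] assms(1,2)
        card_eq[of "\<lambda>k. k \<noteq> 0 \<and> 2 * (k + 1) = s"] by simp
  next
    \<comment> \<open>Size 2 belongs to the entry 0, which also marks indices that are not tops. The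
      trivial components are therefore counted as n minus the degree minus the number of nonzero
      entries.\<close>
    case True
    have eq: "card {K \<in> involution_pair.comps (vertices n) (std_involution n) m'. card K = 2} + card {i. excess n m' i \<noteq> 0} = n - excess_degree n m'"
      if "matching n m'" for m'
    proof -
      interpret R: matching n m' by fact
      have "{i \<in> R.tops. 2 * (excess n m' i + 1) \<noteq> 2} = {i. excess n m' i \<noteq> 0}"
        using R.excess_not_tops by fastforce
      then have "card {K \<in> R.comps. card K \<noteq> 2} = card {i. excess n m' i \<noteq> 0}"
        using R.card_comps_filter[of "\<lambda>k. k \<noteq> 2"] by simp
      moreover have "{K \<in> R.comps. card K = 2} \<union> {K \<in> R.comps. card K \<noteq> 2} = R.comps" by blast
      then have "card {K \<in> R.comps. card K = 2} + card {K \<in> R.comps. card K \<noteq> 2} = card R.comps"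
        using R.finite_comps by (subst card_Un_disjoint[symmetric]) auto
      ultimately show ?thesis using R.excess_degree_add_card_comps by simp
    qed
    show ?thesis
      using eq[OF assms(1)] eq[OF assms(2)] deg card_eq[of "\<lambda>k. k \<noteq> 0"] True by simp
  qed
  then obtain b where b: "b permutes vertices n"
    "\<forall>x\<in>vertices n. b (std_involution n x) = std_involution n (b x)" "\<forall>x\<in>vertices n. b (m x) = m2 (b x)"
    using involution_pair_iso[OF P.involution_pair_axioms Q.involution_pair_axioms] by blast
  have "b \<circ> std_involution n = std_involution n \<circ> b"
  proof
    fix x show "(b \<circ> std_involution n) x = (std_involution n \<circ> b) x"
      using b(1,2) std_involution_simps(3)[of x n] std_involution_simps(3)[of "b x" n]
      by (cases "x \<in> vertices n") (auto simp: permutes_not_in permutes_in_image)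
  qed
  then have "b \<in> hyperoct n"
    using b(1) unfolding hyperoct_def sym_group_carrier by (simp add: vertices_def)
  then show ?thesis using b(3) by blast
qed

subsection \<open>The effect of a transposition\<close>

text \<open>Pairs {2i+1, 2i+2} are counted from 0, so the threshold 2i makes all pairs with index at
  least i standard. For i = n this is no condition, for i = 0 only the standard matching is
  left.\<close>

definition std_above :: "nat \<Rightarrow> nat \<Rightarrow> (nat \<Rightarrow> nat) \<Rightarrow> bool" where
  "std_above n i m \<longleftrightarrow> (\<forall>x\<in>vertices n. 2 * i < x \<longrightarrow> m x = std_involution n x)"

lemma std_involution_le: "x \<le> 2 * i \<Longrightarrow> std_involution n x \<le> 2 * i"
  by (cases "odd x"; auto simp: std_involution_def elim!: oddE; presburger)

lemma std_involution_gt: "2 * i < x \<Longrightarrow> 2 * i < std_involution n x"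
  using std_involution_le[of "std_involution n x" i n] std_involution_involution[of n x] by force

lemma std_above_swap_imp:
  assumes "std_above n i m" "a \<le> 2 * i" "c \<le> 2 * i"
  shows "std_above n i (swap_conj a c m)"
  unfolding std_above_def
proof (intro ballI impI)
  fix x assume x: "x \<in> vertices n" "2 * i < x"
  then have "m x = std_involution n x" using assms(1) by (simp add: std_above_def)
  moreover have "2 * i < std_involution n x" using std_involution_gt[OF x(2)] .
  ultimately show "swap_conj a c m x = std_involution n x"
    using assms(2,3) x(2) by (auto simp: Transposition.transpose_def)
qed

lemma std_above_swap:
  assumes "a \<le> 2 * i" "c \<le> 2 * i"
  shows "std_above n i (swap_conj a c m) \<longleftrightarrow> std_above n i m"
  using std_above_swap_imp[OF _ assms, of n m] std_above_swap_imp[OF _ assms, of n "swap_conj a c m"]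
  unfolding swap_conj_swap_conj by blast

lemma matching_swap:
  assumes "matching n m" "a \<in> vertices n" "c \<in> vertices n" "a \<noteq> c"
  shows "involution_pair_swap (vertices n) (std_involution n) m a c" "matching n (swap_conj a c m)"
    "involution_pair_swap.m' m a c = swap_conj a c m"
proof -
  interpret matching n m by fact
  show sw: "involution_pair_swap (vertices n) (std_involution n) m a c"
    using assms by unfold_locales auto
  interpret S: involution_pair_swap "vertices n" "std_involution n" m a c by (rule sw)
  show eq: "involution_pair_swap.m' m a c = swap_conj a c m" by (rule S.m'_def)
  show "matching n (swap_conj a c m)"
    using S.swapped.fpf_m unfolding eq by unfold_locales
qed

lemma excess_degree_swap:
  assumes "matching n m" "a \<in> vertices n" "c \<in> vertices n" "a \<noteq> c"
  shows "c \<notin> component (std_involution n) m a \<Longrightarrow> excess_degree n (swap_conj a c m) = excess_degree n m + 1"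
    "c \<in> component (std_involution n) m a \<Longrightarrow> excess_degree n (swap_conj a c m) \<le> excess_degree n m"
proof -
  interpret P: matching n m by fact
  interpret Q: matching n "swap_conj a c m" using matching_swap(2)[OF assms] .
  interpret S: involution_pair_swap "vertices n" "std_involution n" m a c using matching_swap(1)[OF assms] .
  note eqs = P.excess_degree_add_card_comps Q.excess_degree_add_card_comps matching_swap(3)[OF assms]
  show "c \<notin> component (std_involution n) m a \<Longrightarrow> excess_degree n (swap_conj a c m) = excess_degree n m + 1"
    using S.card_comps_merged eqs by simp
  show "c \<in> component (std_involution n) m a \<Longrightarrow> excess_degree n (swap_conj a c m) \<le> excess_degree n m"
    using S.card_comps_refine eqs by simp
qed

context matching
begin

text \<open>The vertices up to 2i are closed under both maps, because a vertex beyond 2i has its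
  partner beyond 2i.\<close>

lemma comp_le:
  assumes "std_above n i m" "x \<in> vertices n" "x \<le> 2 * i" "y \<in> comp_of x"
  shows "y \<le> 2 * i"
proof -
  have "comp_of x \<subseteq> {y \<in> vertices n. y \<le> 2 * i}"
  proof (rule component_least)
    fix y assume y: "y \<in> {y \<in> vertices n. y \<le> 2 * i}"
    then show "std_involution n y \<in> {y \<in> vertices n. y \<le> 2 * i}"
      using t_simps(1)[of y] std_involution_le by simp
    have my: "m y \<in> vertices n" using y m_simps(1) by simp
    have "m y \<le> 2 * i"
    proof (rule ccontr)
      assume gt: "\<not> m y \<le> 2 * i"
      then have "m (m y) = std_involution n (m y)" using assms(1) my by (simp add: std_above_def)
      then have "2 * i < m (m y)" using std_involution_gt[of i "m y" n] gt by simp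
      then show False using y m_simps(3)[of y] by simp
    qed
    then show "m y \<in> {y \<in> vertices n. y \<le> 2 * i}" using my by simp
  qed (use assms in simp)
  then show ?thesis using assms(4) by auto
qed

text \<open>If l is the top of the component of x, then x is at most 2l+2, so l is at least i; its
  entry 0 makes the component trivial.\<close>

lemma std_above_if_excess:
  assumes "\<And>k. i \<le> k \<Longrightarrow> excess n m k = 0" shows "std_above n i m"
  unfolding std_above_def
proof (intro ballI impI)
  fix x assume x: "x \<in> vertices n" "2 * i < x"
  then have "comp_of x \<in> comps" by (simp add: comps_def del: vertices_iff)
  then obtain l where l: "l < n" "Max (comp_of x) = 2 * l + 2" "comp_of x = comp_of (2 * l + 2)"
    by (rule Max_comp)
  have "x \<le> 2 * l + 2"
    using Max_ge[OF finite_comp[OF x(1)] component.base] l(2) by simp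
  then have "excess n m l = 0" using x assms by simp
  moreover have "l \<in> tops" using l by (simp add: tops_def)
  ultimately have "card (comp_of x) = 2" using excess_tops[of l] l(3) by simp
  then show "m x = std_involution n x" using card_comp_eq_2_iff[OF x(1)] by simp
qed

lemma top_if_std_above:
  assumes "i < n" "std_above n (Suc i) m"
  shows "i \<in> tops"
proof -
  have V: "2 * i + 2 \<in> vertices n" using assms(1) by simp
  have "Max (comp_of (2 * i + 2)) = 2 * i + 2"
    using finite_comp[OF V] component.base[of "2 * i + 2"] comp_le[OF assms(2) V] by (intro Max_eqI) auto
  then show ?thesis using assms(1) by (simp add: tops_def)
qed

end

text \<open>Here j is the top of the component of a. As everything beyond pair i is standard, 2i+2
  is the maximum of its own component and of the merged one, so i stays a top and j stops being one.
  Adding the sizes 2(p+1) and 2(q+1) gives 2((p+q+1)+1), whence the summand 1.\<close>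

lemma excess_merge:
  assumes m: "matching n m" and i: "i < n" and a: "1 \<le> a" "a < 2 * i + 1"
    and above: "std_above n (Suc i) m"
    and conn: "2 * i + 1 \<notin> component (std_involution n) m a"
  obtains j where "j < i" "excess n m j = 0 \<longleftrightarrow> m a = std_involution n a"
    "excess n (swap_conj a (2 * i + 1) m) = (excess n m)(j := 0, i := excess n m i + excess n m j + 1)"
proof -
  let ?c = "2 * i + 1" let ?t = "std_involution n"
  have V: "a \<in> vertices n" "?c \<in> vertices n" "a \<noteq> ?c" "2 * i + 2 \<in> vertices n" using a i by auto
  interpret P: matching n m by fact
  interpret S: involution_pair_swap "vertices n" ?t m a ?c using matching_swap(1)[OF m V(1-3)] .
  have m': "S.m' = swap_conj a ?c m" using matching_swap(3)[OF m V(1-3)] .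
  interpret Q: matching n S.m' unfolding m' using matching_swap(2)[OF m V(1-3)] .
  let ?A = "P.comp_of a" let ?C = "P.comp_of ?c"
  have C: "?C = P.comp_of (2 * i + 2)" by (rule P.comp_pair[OF i])
  have disj: "?A \<inter> ?C = {}" using P.comp_disjoint[OF V(1,2) conn] .
  have topi: "i \<in> P.tops" using P.top_if_std_above[OF i above] .
  have fin: "finite ?A" "finite ?C" using P.finite_comp[OF V(1)] P.finite_comp[OF V(2)] .
  have "?A \<in> P.comps" using V(1) unfolding P.comps_def by (rule imageI)
  then obtain j where j: "j < n" "Max ?A = 2 * j + 2" "?A = P.comp_of (2 * j + 2)" by (rule P.Max_comp)
  have topj: "j \<in> P.tops" using j by (simp add: P.tops_def)
  have jA: "2 * j + 2 \<in> ?A" unfolding j(3) by (rule component.base)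
  have "2 * j + 2 \<le> 2 * Suc i"
    using P.comp_le[OF above V(1) _ jA] a by simp
  moreover have "j \<noteq> i" using disj jA C component.base[of "2 * i + 2" ?t m] by blast
  ultimately have ji: "j < i" by simp
  have cards: "card ?A = 2 * (excess n m j + 1)" "card ?C = 2 * (excess n m i + 1)"
    using P.excess_tops[OF topj] P.excess_tops[OF topi] j(3) C by simp_all
  have MaxC: "Max ?C = 2 * i + 2" using topi C by (simp add: P.tops_def)
  have "?A \<noteq> {}" "?C \<noteq> {}" 
    using component.base[of a ?t m] component.base[of ?c ?t m] by auto
  then have Max: "Max (?A \<union> ?C) = 2 * i + 2"
    using fin MaxC j(2) ji by (simp add: Max_Un)
  have excess: "excess n S.m' k = ((excess n m)(j := 0, i := excess n m i + excess n m j + 1)) k" for k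
  proof (cases "k < n")
    case False
    then show ?thesis using ji i P.excess_ge Q.excess_ge by simp
  next
    case k: True
    then have kV: "2 * k + 2 \<in> vertices n" by simp
    show ?thesis
    proof (cases "2 * k + 2 \<in> ?A \<union> ?C")
      case True
      then have comp': "S.swapped.comp_of (2 * k + 2) = ?A \<union> ?C" using S.comp_merged(1)[OF conn] by simp
      show ?thesis
      proof (cases "k = i")
        case True
        have "card (?A \<union> ?C) = 2 * (excess n m i + excess n m j + 2)"
          using cards disj fin by (simp add: card_Un_disjoint)
        then show ?thesis unfolding excess_def[of n S.m'] comp' Let_def using Max True k by simp
      next
        case False
        then have "excess n S.m' k = 0"
          unfolding excess_def[of n S.m'] comp' Let_def using Max by simp
        moreover have "excess n m k = 0" if "k \<noteq> j"
        proof -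
          have "P.comp_of (2 * k + 2) = ?A \<or> P.comp_of (2 * k + 2) = ?C"
            using True P.comp_eq V(1,2) by blast
          then have "Max (P.comp_of (2 * k + 2)) \<noteq> 2 * k + 2" using j(2) MaxC that False by auto
          then show ?thesis by (simp add: excess_def)
        qed
        ultimately show ?thesis using False by simp
      qed
    next
      case False
      then have "S.swapped.comp_of (2 * k + 2) = P.comp_of (2 * k + 2)"
        using S.comp_merged(2)[OF conn kV] by simp
      then have "excess n S.m' k = excess n m k" by (simp add: excess_def)
      moreover have "k \<noteq> i" "k \<noteq> j" using False jA C component.base[of "2 * i + 2" ?t m] by auto
      ultimately show ?thesis by simp
    qed
  qed
  have "excess n m j = 0 \<longleftrightarrow> card ?A = 2" using cards by simp
  then have "excess n m j = 0 \<longleftrightarrow> m a = ?t a" using P.card_comp_eq_2_iff[OF V(1)] by simp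
  moreover have "excess n (swap_conj a ?c m) = (excess n m)(j := 0, i := excess n m i + excess n m j + 1)"
    unfolding m'[symmetric] by (rule ext) (rule excess)
  ultimately show thesis by (rule that[OF ji])
qed

subsection \<open>Matchings of permutations\<close>

definition perm_matching :: "nat \<Rightarrow> (nat \<Rightarrow> nat) \<Rightarrow> nat \<Rightarrow> nat" where
  "perm_matching n w = w \<circ> std_involution n \<circ> inv' w"

lemma carrier_iff_vertices: "w \<in> carrier (sym_group (2 * n)) \<longleftrightarrow> w permutes vertices n"
  by (simp add: sym_group_carrier vertices_def)

lemma hyperoct_iff:
  "b \<in> hyperoct n \<longleftrightarrow> b permutes vertices n \<and> b \<circ> std_involution n = std_involution n \<circ> b"
  unfolding hyperoct_def mem_Collect_eq carrier_iff_vertices ..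

lemma finite_carrier: "finite (carrier (sym_group (2 * n)))"
  unfolding sym_group_def by (simp add: finite_permutations)

lemma perm_matching_eq_iff:
  assumes "w permutes S"
  shows "perm_matching n w (w x) = w (std_involution n x)"
  using assms by (simp add: perm_matching_def permutes_inverses)

lemma matching_perm:
  assumes "w permutes vertices n" shows "matching n (perm_matching n w)"
proof
  show "fpf_involution (vertices n) (perm_matching n w)"
    unfolding fpf_involution_def
  proof
    fix x assume x: "x \<in> vertices n"
    define y where "y = inv' w x"
    have y: "y \<in> vertices n" "x = w y"
      using assms x permutes_in_image[OF permutes_inv[OF assms]] permutes_inverses(1)[OF assms]
      by (simp_all add: y_def del: vertices_iff)
    have t: "std_involution n y \<in> vertices n" "std_involution n y \<noteq> y"
      using fpf_std_involution[of n] y(1) by (auto simp: fpf_involution_def)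
    have "w (std_involution n y) \<noteq> w y" using t(2) permutes_inj[OF assms] by (simp add: inj_eq)
    then show "perm_matching n w x \<in> vertices n \<and> perm_matching n w x \<noteq> x \<and>
        perm_matching n w (perm_matching n w x) = x"
      unfolding y(2) perm_matching_eq_iff[OF assms] std_involution_involution
      using t(1) permutes_in_image[OF assms] by blast
  qed
qed

lemma perm_matching_transpose:
  assumes "w permutes S"
  shows "perm_matching n (Transposition.transpose a c \<circ> w) = swap_conj a c (perm_matching n w)"
proof -
  have "inv' (Transposition.transpose a c \<circ> w) = inv' w \<circ> Transposition.transpose a c"
    using o_inv_distrib[OF permutes_bij[OF permutes_swap_id[of a UNIV c]] permutes_bij[OF assms]] by simp
  then show ?thesis by (simp add: perm_matching_def comp_assoc)
qed

lemma perm_matching_outside: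
  assumes "w permutes vertices n" "x \<notin> vertices n" shows "perm_matching n w x = x"
proof -
  have "inv' w x = x" using permutes_not_in[OF permutes_inv[OF assms(1)] assms(2)] .
  then show ?thesis
    using assms std_involution_simps(3)[OF assms(2)] permutes_not_in[OF assms] by (simp add: perm_matching_def)
qed

lemma std_above_n: "std_above n n m"
  by (simp add: std_above_def)

lemma std_above_0_iff:
  assumes "w permutes vertices n"
  shows "std_above n 0 (perm_matching n w) \<longleftrightarrow> w \<in> hyperoct n"
proof
  assume std: "std_above n 0 (perm_matching n w)"
  have "w (std_involution n y) = std_involution n (w y)" for y
  proof (cases "y \<in> vertices n")
    case True
    then have "w y \<in> vertices n" using permutes_in_image[OF assms] by blast
    then have "perm_matching n w (w y) = std_involution n (w y)" using std by (simp add: std_above_def)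
    then show ?thesis by (simp add: perm_matching_eq_iff[OF assms])
  next
    case False
    then show ?thesis using std_involution_simps(3) permutes_not_in[OF assms] by metis
  qed
  then show "w \<in> hyperoct n" using assms by (auto simp: hyperoct_iff)
next
  assume "w \<in> hyperoct n"
  then have "w (std_involution n y) = std_involution n (w y)" for y
    unfolding hyperoct_iff by (metis comp_apply)
  then show "std_above n 0 (perm_matching n w)"
    using permutes_inverses(1)[OF assms] by (simp add: std_above_def perm_matching_def)
qed

text \<open>An isomorphism b commuting with the standard involution carries the matching of w to
  that of v. Then b w and v have the same matching, hence differ by a right factor from the
  hyperoctahedral group.\<close>

lemma excess_rearrangement_double_coset:
  assumes w: "w permutes vertices n" and v: "v permutes vertices n" and "bij \<pi>"
    and "excess n (perm_matching n w) \<circ> \<pi> = excess n (perm_matching n v)"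
  obtains k k' where "k \<in> hyperoct n" "k' \<in> hyperoct n" "v = k \<circ> w \<circ> k'"
proof -
  obtain b where b: "b \<in> hyperoct n"
    and bm: "\<forall>x\<in>vertices n. b (perm_matching n w x) = perm_matching n v (b x)"
    using excess_rearrangement_iso[OF matching_perm[OF w] matching_perm[OF v] assms(3,4)] by blast
  have bp: "b permutes vertices n" and bt: "\<And>x. b (std_involution n x) = std_involution n (b x)"
    using b unfolding hyperoct_iff by (blast, metis comp_apply)
  have bw: "b (w (std_involution n y)) = perm_matching n v (b (w y))" for y
  proof (cases "y \<in> vertices n")
    case True
    then have "w y \<in> vertices n" using permutes_in_image[OF w] by blast
    then show ?thesis using bm perm_matching_eq_iff[OF w] by metis
  next
    case False
    then have "w y = y" "b y = y" "std_involution n y = y"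
      using permutes_not_in[OF w] permutes_not_in[OF bp] std_involution_simps(3) by blast+
    then show ?thesis using perm_matching_outside[OF v False] by simp
  qed
  define k' where "k' = inv' (b \<circ> w) \<circ> v"
  have bwp: "b \<circ> w permutes vertices n" using w bp by (rule permutes_compose)
  have k'p: "k' permutes vertices n" unfolding k'_def using v permutes_inv[OF bwp] by (rule permutes_compose)
  have v': "v = b \<circ> w \<circ> k'"
    unfolding k'_def by (rule ext) (use permutes_inverses(1)[OF bwp] in simp)
  have "k' (std_involution n x) = std_involution n (k' x)" for x
  proof -
    have "b (w (std_involution n (k' x))) = perm_matching n v (v x)" using bw v' by simp
    also have "\<dots> = v (std_involution n x)" by (rule perm_matching_eq_iff[OF v])
    also have "\<dots> = b (w (k' (std_involution n x)))" using v' by (metis comp_apply)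
    finally show ?thesis using permutes_inj[OF bwp] by (simp add: inj_def)
  qed
  then have "k' \<in> hyperoct n" using k'p by (auto simp: hyperoct_iff)
  then show thesis using that b v' by blast
qed

lemma component_swap_roles: "component s t x = component t s x"
proof
  show "component s t x \<subseteq> component t s x" by (rule component_least) (auto intro: component.intros)
  show "component t s x \<subseteq> component s t x" by (rule component_least) (auto intro: component.intros)
qed

lemma component_image:
  assumes "\<And>y. h (s y) = s' (h y)" "\<And>y. h (t y) = t' (h y)"
  shows "h ` component s t x = component s' t' (h x)"
proof
  show "component s' t' (h x) \<subseteq> h ` component s t x"
  proof (rule component_least)
    fix y assume "y \<in> h ` component s t x"
    then obtain z where z: "z \<in> component s t x" "y = h z" by blast
    have "s' y = h (s z)" "t' y = h (t z)" using z assms by simp_all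
    then show "s' y \<in> h ` component s t x" "t' y \<in> h ` component s t x"
      using component.fst[OF z(1)] component.snd[OF z(1)] by simp_all
  qed (simp add: component.base)
  show "h ` component s t x \<subseteq> component s' t' (h x)"
  proof
    fix y assume "y \<in> h ` component s t x"
    then obtain z where "z \<in> component s t x" "y = h z" by blast
    then show "y \<in> component s' t' (h x)"
    proof (induction arbitrary: y)
      case (fst z)
      then show ?case using component.fst[of "h z" s' t'] assms by simp
    next
      case (snd z)
      then show ?case using component.snd[of "h z" s' t'] assms by simp
    qed (simp add: component.base)
  qed
qed

lemma card_comps_conjugate:
  assumes b: "b permutes V" and "\<And>y. b (s y) = s' (b y)" "\<And>y. b (t y) = t' (b y)"
  shows "card (component s t ` V) = card (component s' t' ` V)"
proof -
  have "(`) b ` component s t ` V = component s' t' ` (b ` V)"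
    using component_image[of b s s' t t', OF assms(2,3)] by (simp add: image_image)
  moreover have "inj_on ((`) b) (component s t ` V)"
    using permutes_inj[OF b] by (meson inj_image_eq_iff inj_onI)
  ultimately show ?thesis using permutes_image[OF b] card_image by metis
qed

lemma pair_index:
  fixes v :: nat
  assumes "v \<in> vertices n" "k \<in> {1..n}"
  shows "v \<in> {2 * k - 1, 2 * k} \<longleftrightarrow> k = (v + 1) div 2"
    and "k = (v + 1) div 2 \<Longrightarrow> {2 * k - 1, 2 * k} = {v, std_involution n v}"
proof -
  show "v \<in> {2 * k - 1, 2 * k} \<longleftrightarrow> k = (v + 1) div 2" using assms by (cases "odd v"; auto elim!: oddE evenE; presburger)
  show "{2 * k - 1, 2 * k} = {v, std_involution n v}" if "k = (v + 1) div 2"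
    using that assms by (cases "odd v") (auto simp: std_involution_simps elim!: oddE evenE)
qed

lemma filter_pairs:
  assumes "v \<in> vertices n"
  shows "filter_mset (\<lambda>e. v \<in> e) {#{2 * k - 1, 2 * k}. k \<in># mset_set {1..n}#} = {#{v, std_involution n v}#}"
proof -
  let ?k = "(v + 1) div 2"
  have k: "?k \<in> {1..n}" using assms by (auto; presburger)
  have "{k \<in> {1..n}. v \<in> {2 * k - 1, 2 * k}} = {?k}" using pair_index(1)[OF assms] k by blast
  then have "filter_mset (\<lambda>k. v \<in> {2 * k - 1, 2 * k}) (mset_set {1..n}) = {#?k#}"
    by (simp add: filter_mset_mset_set)
  then show ?thesis using pair_index(2)[OF assms k] by (simp add: filter_mset_image_mset)
qed

text \<open>The multigraph is the union of t with \<open>inv' w \<circ> t \<circ> w\<close>, whereas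
  \<open>perm_matching\<close> is \<open>w \<circ> t \<circ> inv' w\<close>. Conjugation by w
  carries the first pair of involutions to the second with the roles exchanged, so the numbers of
  components agree.\<close>

lemma num_cycles_add_excess_degree:
  assumes w: "w permutes vertices n"
  shows "num_cycles n w + excess_degree n (perm_matching n w) = n"
proof -
  let ?t = "std_involution n" let ?m = "perm_matching n (inv' w)"
  have iw: "inv' w permutes vertices n" using permutes_inv[OF w] .
  have m: "?m = inv' w \<circ> ?t \<circ> w" by (simp add: perm_matching_def permutes_inv_inv[OF w])
  interpret P: matching n ?m using matching_perm[OF iw] .
  interpret Q: matching n "perm_matching n w" using matching_perm[OF w] .
  let ?E = "perm_multigraph n w"
  have at: "filter_mset (\<lambda>e. v \<in> e) ?E = {#{v, ?t v}, {v, ?m v}#}" if v: "v \<in> vertices n" for v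
  proof -
    have wv: "w v \<in> vertices n" using v permutes_in_image[OF w] by blast
    let ?P = "{#{2 * k - 1, 2 * k}. k \<in># mset_set {1..n}#}"
    have second: "{#{inv' w (2 * k - 1), inv' w (2 * k)}. k \<in># mset_set {1..n}#} = image_mset (\<lambda>e. inv' w ` e) ?P"
      by (simp add: image_mset.compositionality comp_def)
    have mem: "v \<in> inv' w ` e \<longleftrightarrow> w v \<in> e" for e
      using permutes_inverses[OF w] by (metis image_iff)
    have "filter_mset (\<lambda>e. v \<in> e) (image_mset (\<lambda>e. inv' w ` e) ?P) =
        image_mset (\<lambda>e. inv' w ` e) (filter_mset (\<lambda>e. w v \<in> e) ?P)"
      unfolding filter_mset_image_mset mem ..
    also have "\<dots> = {#{v, ?m v}#}"
      unfolding filter_pairs[OF wv] by (simp add: m permutes_inverses(2)[OF w])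
    finally show ?thesis
      unfolding perm_multigraph_def second filter_union_mset filter_pairs[OF v] by simp
  qed
  have sub: "e \<subseteq> vertices n" if "e \<in># ?E" for e
  proof -
    have inr: "{2 * k - 1, 2 * k} \<subseteq> vertices n" if "k \<in> {1..n}" for k using that by auto
    have "inv' w ` vertices n = vertices n" using permutes_image[OF iw] .
    then have "{inv' w (2 * k - 1), inv' w (2 * k)} \<subseteq> vertices n" if "k \<in> {1..n}" for k
      using inr[OF that] by blast
    then show ?thesis using that inr by (auto simp: perm_multigraph_def simp del: vertices_iff)
  qed
  have "num_cycles n w = card P.comps"
    unfolding num_cycles_def by (rule P.card_multigraph_cycles) (fact at sub)+
  also have "\<dots> = card Q.comps"
    unfolding P.comps_def Q.comps_def component_swap_roles[of _ "perm_matching n w"]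
    by (rule card_comps_conjugate[OF w])
      (simp_all add: perm_matching_eq_iff[OF w] m permutes_inverses[OF w])
  finally show ?thesis using Q.excess_degree_add_card_comps by simp
qed

section \<open>Symmetric functions\<close>

abbreviation lookup where "lookup \<equiv> Poly_Mapping.lookup"
abbreviation keys where "keys \<equiv> Poly_Mapping.keys"
abbreviation map_key where "map_key \<equiv> Poly_Mapping.map_key"

definition conv :: "(mono \<Rightarrow> int) \<Rightarrow> (mono \<Rightarrow> int) \<Rightarrow> mono \<Rightarrow> int" where
  "conv F G m = (\<Sum>(a, b)\<in>{(a, b). a + b = m}. F a * G b)"

definition mono_one :: "mono \<Rightarrow> int" where
  "mono_one m = of_bool (m = 0)"

definition bounded_degree :: "(mono \<Rightarrow> int) \<Rightarrow> bool" where
  "bounded_degree F \<longleftrightarrow> (\<exists>d. \<forall>m. F m \<noteq> 0 \<longrightarrow> mono_degree m \<le> d)"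

lemma mono_degree_eq: "finite A \<Longrightarrow> keys m \<subseteq> A \<Longrightarrow> mono_degree m = (\<Sum>i\<in>A. lookup m i)"
  unfolding mono_degree_def by (rule sum.mono_neutral_left) (auto simp: in_keys_iff)

lemma keys_add_nat: "keys (a + b :: mono) = keys a \<union> keys b"
  by (auto simp: in_keys_iff lookup_add)

lemma mono_degree_add: "mono_degree (a + b) = mono_degree a + mono_degree b"
  by (simp add: mono_degree_eq[of "keys a \<union> keys b"] keys_add_nat lookup_add sum.distrib)

lemma mono_degree_zero [simp]: "mono_degree 0 = 0"
  by (simp add: mono_degree_def)

lemma mono_degree_single [simp]: "mono_degree (Poly_Mapping.single i k) = k"
  by (simp add: mono_degree_def)

lemma lookup_map_key: "inj f \<Longrightarrow> lookup (map_key f m) = lookup m \<circ> f"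
  by (simp add: Poly_Mapping.map_key.rep_eq)

lemma map_key_inv:
  assumes "bij \<pi>"
  shows "map_key \<pi> (map_key (inv' \<pi>) m) = m" "map_key (inv' \<pi>) (map_key \<pi> m) = m"
  using assms bij_imp_bij_inv[OF assms]
  by (intro poly_mapping_eqI; simp add: lookup_map_key bij_is_inj bij_is_surj surj_f_inv_f)+

lemma mono_degree_map_key:
  assumes "bij \<pi>" shows "mono_degree (map_key \<pi> m) = mono_degree m"
proof -
  have k: "keys (map_key \<pi> m) = \<pi> -` keys m" by (rule keys_map_key[OF bij_is_inj[OF assms]])
  have "mono_degree (map_key \<pi> m) = (\<Sum>i\<in>\<pi> -` keys m. lookup m (\<pi> i))"
    unfolding mono_degree_def k by (simp add: lookup_map_key bij_is_inj[OF assms])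
  also have "\<dots> = (\<Sum>i\<in>keys m. lookup m i)"
    by (rule sum.reindex_bij_betw, rule bij_betw_subset[OF assms subset_UNIV])
      (rule surj_image_vimage_eq[OF bij_is_surj[OF assms]])
  finally show ?thesis by (simp add: mono_degree_def)
qed

lemma conv_assoc: "conv (conv F G) H = conv F (conv G H)"
proof
  fix m :: mono
  let ?T = "{(a, b, c). a + b + c = m}"
  have "conv (conv F G) H m =
    (\<Sum>((x, c), (a, b))\<in>(SIGMA p:{(x, c). x + c = m}. {(a, b). a + b = fst p}). F a * G b * H c)"
    unfolding conv_def
    by (subst sum.Sigma[symmetric])
      (auto simp: finite_mono_antidiagonal[unfolded case_prod_unfold] sum_distrib_right case_prod_unfold intro!: sum.cong)
  also have "\<dots> = (\<Sum>(a, b, c)\<in>?T. F a * G b * H c)"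
    by (rule sum.reindex_bij_witness[of _ "\<lambda>(a, b, c). ((a + b, c), (a, b))" "\<lambda>((x, c), (a, b)). (a, b, c)"]) auto
  also have "\<dots> = (\<Sum>((a, x), (b, c))\<in>(SIGMA p:{(a, x). a + x = m}. {(b, c). b + c = snd p}). F a * G b * H c)"
    by (rule sum.reindex_bij_witness[of _ "\<lambda>((a, x), (b, c)). (a, b, c)" "\<lambda>(a, b, c). ((a, b + c), (b, c))"])
      (auto simp: add.assoc)
  also have "\<dots> = conv F (conv G H) m"
    unfolding conv_def
    by (subst sum.Sigma[symmetric])
      (auto simp: finite_mono_antidiagonal[unfolded case_prod_unfold] sum_distrib_left case_prod_unfold mult.assoc intro!: sum.cong)
  finally show "conv (conv F G) H m = conv F (conv G H) m" .
qed

lemma conv_commute: "conv F G = conv G F"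
proof
  fix m
  show "conv F G m = conv G F m"
    unfolding conv_def
    by (rule sum.reindex_bij_witness[of _ "\<lambda>(a, b). (b, a)" "\<lambda>(a, b). (b, a)"]) (auto simp: ac_simps)
qed

text \<open>Multiplication by the monomial p shifts exponents. The existential condition says that p
  divides m; it guards the truncated subtraction.\<close>

lemma conv_delta: "conv (\<lambda>a. of_bool (a = p)) F m = (if \<exists>b. p + b = m then F (m - p) else 0)"
proof (cases "\<exists>b. p + b = m")
  case True
  then obtain b where b: "p + b = m" by blast
  have "conv (\<lambda>a. of_bool (a = p)) F m = (\<Sum>(a, c)\<in>{(p, b)}. of_bool (a = p) * F c)"
    unfolding conv_def using b finite_mono_antidiagonal
    by (intro sum.mono_neutral_right) auto
  then show ?thesis using b by auto
next
  case False
  then show ?thesis unfolding conv_def by (auto intro!: sum.neutral)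
qed

lemma conv_one: "conv mono_one F = F"
proof
  fix m
  show "conv mono_one F m = F m"
    using conv_delta[of 0 F m] by (simp add: mono_one_def[abs_def])
qed

lemma conv_one_right: "conv F mono_one = F"
  by (simp only: conv_commute[of F] conv_one)

lemma conv_add: "conv F (\<lambda>m. G m + H m) = (\<lambda>m. conv F G m + conv F H m)"
  by (simp add: fun_eq_iff conv_def sum.distrib case_prod_unfold distrib_left)

lemma conv_add_left: "conv (\<lambda>m. F m + G m) H = (\<lambda>m. conv F H m + conv G H m)"
  by (simp only: conv_commute[of _ H] conv_add)

lemma conv_nonzero:
  assumes "conv F G m \<noteq> 0" obtains a b where "a + b = m" "F a \<noteq> 0" "G b \<noteq> 0"
proof -
  have "\<exists>p\<in>{(a, b). a + b = m}. (case p of (a, b) \<Rightarrow> F a * G b) \<noteq> 0"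
    using assms unfolding conv_def by (rule contrapos_np) (auto intro!: sum.neutral)
  then show thesis using that by auto
qed

lemma bounded_degree_conv: "bounded_degree F \<Longrightarrow> bounded_degree G \<Longrightarrow> bounded_degree (conv F G)"
  unfolding bounded_degree_def
proof (elim exE)
  fix d e assume d: "\<forall>m. F m \<noteq> 0 \<longrightarrow> mono_degree m \<le> d" and e: "\<forall>m. G m \<noteq> 0 \<longrightarrow> mono_degree m \<le> e"
  show "\<exists>d. \<forall>m. conv F G m \<noteq> 0 \<longrightarrow> mono_degree m \<le> d"
  proof (intro exI allI impI)
    fix m assume "conv F G m \<noteq> 0"
    then obtain a b where "a + b = m" "F a \<noteq> 0" "G b \<noteq> 0" by (rule conv_nonzero)
    then show "mono_degree m \<le> d + e" using d e mono_degree_add[of a b] add_mono by metis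
  qed
qed

lemma bounded_degree_add: "bounded_degree F \<Longrightarrow> bounded_degree G \<Longrightarrow> bounded_degree (\<lambda>m. F m + G m)"
  unfolding bounded_degree_def
proof (elim exE)
  fix d e assume d: "\<forall>m. F m \<noteq> 0 \<longrightarrow> mono_degree m \<le> d" and e: "\<forall>m. G m \<noteq> 0 \<longrightarrow> mono_degree m \<le> e"
  have "mono_degree m \<le> max d e" if "F m + G m \<noteq> 0" for m
    using that d e by (cases "F m = 0") (auto simp: le_max_iff_disj)
  then show "\<exists>d. \<forall>m. F m + G m \<noteq> 0 \<longrightarrow> mono_degree m \<le> d" by blast
qed

lemma bounded_degree_uminus: "bounded_degree F \<Longrightarrow> bounded_degree (\<lambda>m. - F m)"
  by (simp add: bounded_degree_def)

lemma bounded_degree_one: "bounded_degree mono_one"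
  by (auto simp: bounded_degree_def mono_one_def)

lemma conv_map_key:
  assumes \<pi>: "bij \<pi>" and "\<And>m. F (map_key \<pi> m) = F m" "\<And>m. G (map_key \<pi> m) = G m"
  shows "conv F G (map_key \<pi> m) = conv F G m"
  unfolding conv_def
proof (rule sum.reindex_bij_witness[of _ "\<lambda>(a, b). (map_key \<pi> a, map_key \<pi> b)"
      "\<lambda>(a, b). (map_key (inv' \<pi>) a, map_key (inv' \<pi>) b)"])
  note plus = map_key_plus[OF bij_is_inj[OF \<pi>]] map_key_plus[OF bij_is_inj[OF bij_imp_bij_inv[OF \<pi>]]]
  fix p assume "p \<in> {(a, b). a + b = map_key \<pi> m}"
  then obtain a b where p: "p = (a, b)" "a + b = map_key \<pi> m" by blast
  then have "map_key (inv' \<pi>) a + map_key (inv' \<pi>) b = m"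
    using map_key_inv(2)[OF \<pi>] plus by metis
  then show "(case p of (a, b) \<Rightarrow> (map_key (inv' \<pi>) a, map_key (inv' \<pi>) b)) \<in> {(a, b). a + b = m}"
    using p by simp
  show "(case case p of (a, b) \<Rightarrow> (map_key (inv' \<pi>) a, map_key (inv' \<pi>) b) of
           (a, b) \<Rightarrow> (map_key \<pi> a, map_key \<pi> b)) = p"
    using p by (simp add: map_key_inv[OF \<pi>])
  show "(case case p of (a, b) \<Rightarrow> (map_key (inv' \<pi>) a, map_key (inv' \<pi>) b) of (a, b) \<Rightarrow> F a * G b) =
      (case p of (a, b) \<Rightarrow> F a * G b)"
    using p assms(2)[of "map_key (inv' \<pi>) a"] assms(3)[of "map_key (inv' \<pi>) b"] by (simp add: map_key_inv[OF \<pi>])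
next
  fix p assume "p \<in> {(a, b). a + b = m}"
  then show "(case p of (a, b) \<Rightarrow> (map_key \<pi> a, map_key \<pi> b)) \<in> {(a, b). a + b = map_key \<pi> m}"
    "(case case p of (a, b) \<Rightarrow> (map_key \<pi> a, map_key \<pi> b) of
           (a, b) \<Rightarrow> (map_key (inv' \<pi>) a, map_key (inv' \<pi>) b)) = p"
    by (auto simp: map_key_inv[OF \<pi>] map_key_plus[OF bij_is_inj[OF \<pi>]])
qed

subsection \<open>The ring structure\<close>

lemma sym_fun_ring_simps:
  "F \<in> carrier sym_fun_ring \<longleftrightarrow> bounded_degree F \<and> (\<forall>\<pi> m. bij \<pi> \<longrightarrow> F (map_key \<pi> m) = F m)"
  "F \<otimes>\<^bsub>sym_fun_ring\<^esub> G = conv F G"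
  "\<one>\<^bsub>sym_fun_ring\<^esub> = mono_one"
  "F \<oplus>\<^bsub>sym_fun_ring\<^esub> G = (\<lambda>m. F m + G m)"
  "\<zero>\<^bsub>sym_fun_ring\<^esub> = (\<lambda>m. 0)"
  by (auto simp: sym_fun_ring_def bounded_degree_def conv_def mono_one_def fun_eq_iff)

lemma map_key_eq_zero_iff:
  fixes m :: mono and \<pi> :: "nat \<Rightarrow> nat"
  assumes "bij \<pi>" shows "map_key \<pi> m = 0 \<longleftrightarrow> m = 0"
  using map_key_inv(2)[OF assms, of m] map_key_zero[OF bij_is_inj[OF assms]]
    map_key_zero[OF bij_is_inj[OF bij_imp_bij_inv[OF assms]]] by metis

lemma bounded_degree_zero: "bounded_degree (\<lambda>m. 0)"
  by (simp add: bounded_degree_def)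

lemma ring_sym_fun_ring: "ring sym_fun_ring"
proof (rule ringI)
  show "abelian_group sym_fun_ring"
  proof (rule abelian_groupI)
    fix F assume F: "F \<in> carrier sym_fun_ring"
    show "\<exists>y\<in>carrier sym_fun_ring. y \<oplus>\<^bsub>sym_fun_ring\<^esub> F = \<zero>\<^bsub>sym_fun_ring\<^esub>"
      by (rule bexI[of _ "\<lambda>m. - F m"]) (use F in \<open>auto simp: sym_fun_ring_simps bounded_degree_uminus\<close>)
  qed (auto simp: sym_fun_ring_simps bounded_degree_add bounded_degree_zero)
  show "monoid sym_fun_ring"
    by (rule monoidI)
      (auto simp: sym_fun_ring_simps bounded_degree_conv bounded_degree_one conv_map_key conv_assoc
        conv_one conv_one_right, auto simp: mono_one_def map_key_eq_zero_iff)
qed (simp_all add: sym_fun_ring_simps conv_add conv_add_left)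

subsection \<open>The fundamental theorem in finitely many variables\<close>

text \<open>Sets the variables with index at least n to zero. The result is symmetric in the first n
  variables only, so in general it lies outside \<open>sym_fun_ring\<close>.\<close>

definition restrict_vars :: "nat \<Rightarrow> (mono \<Rightarrow> int) \<Rightarrow> mono \<Rightarrow> int" where
  "restrict_vars n F m = (if keys m \<subseteq> {..<n} then F m else 0)"

definition squarefree_mono :: "nat set \<Rightarrow> mono" where
  "squarefree_mono A = (\<Sum>i\<in>A. Poly_Mapping.single i 1)"

lemma lookup_squarefree_mono: "finite A \<Longrightarrow> lookup (squarefree_mono A) i = of_bool (i \<in> A)"
  unfolding squarefree_mono_def by (induction A rule: finite_induct) (auto simp: lookup_add lookup_single when_def)

lemma keys_squarefree_mono: "finite A \<Longrightarrow> keys (squarefree_mono A) = A"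
  by (auto simp: in_keys_iff lookup_squarefree_mono)

lemma mono_degree_squarefree_mono: "finite A \<Longrightarrow> mono_degree (squarefree_mono A) = card A"
  by (simp add: mono_degree_def keys_squarefree_mono lookup_squarefree_mono)

lemma elem_sym_eq: "elem_sym k m = of_bool (\<exists>A. finite A \<and> card A = k \<and> m = squarefree_mono A)"
  by (simp add: elem_sym_def squarefree_mono_def)

lemma elem_sym_map_key:
  assumes "bij \<pi>" shows "elem_sym k (map_key \<pi> m) = elem_sym k m"
proof -
  have *: "\<exists>B. finite B \<and> card B = k \<and> map_key \<pi> m = squarefree_mono B"
    if "finite A" "card A = k" "m = squarefree_mono A" "bij \<pi>" for A m \<pi>
  proof (intro exI conjI)
    have "inj \<pi>" "surj \<pi>" using that(4) by (simp_all add: bij_is_inj bij_is_surj)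
    then show "finite (\<pi> -` A)" "card (\<pi> -` A) = k"
      using that by (simp_all add: finite_vimageI card_vimage_inj)
    then show "map_key \<pi> m = squarefree_mono (\<pi> -` A)"
      using \<open>inj \<pi>\<close> that(1,3) by (intro poly_mapping_eqI) (simp add: lookup_map_key lookup_squarefree_mono)
  qed
  have "(\<exists>A. finite A \<and> card A = k \<and> map_key \<pi> m = squarefree_mono A) \<longleftrightarrow>
      (\<exists>A. finite A \<and> card A = k \<and> m = squarefree_mono A)"
    using *[OF _ _ _ assms, of _ m] *[OF _ _ _ bij_imp_bij_inv[OF assms], of _ "map_key \<pi> m"]
      map_key_inv(2)[OF assms] by metis
  then show ?thesis unfolding elem_sym_eq by (rule arg_cong)
qed

lemma elem_sym_degree: "elem_sym k m \<noteq> 0 \<Longrightarrow> mono_degree m = k"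
  by (auto simp: elem_sym_eq mono_degree_squarefree_mono)

lemma elem_sym_carrier: "elem_sym k \<in> carrier sym_fun_ring"
  using elem_sym_degree by (auto simp: sym_fun_ring_simps bounded_degree_def elem_sym_map_key intro!: exI[of _ k])

lemma restrict_vars_elem_sym_self:
  "restrict_vars n (elem_sym n) = (\<lambda>m. of_bool (m = squarefree_mono {..<n}))"
proof
  fix m
  have "(keys m \<subseteq> {..<n} \<and> (\<exists>A. finite A \<and> card A = n \<and> m = squarefree_mono A)) \<longleftrightarrow> m = squarefree_mono {..<n}"
  proof
    assume "keys m \<subseteq> {..<n} \<and> (\<exists>A. finite A \<and> card A = n \<and> m = squarefree_mono A)"
    then obtain A where A: "finite A" "card A = n" "m = squarefree_mono A" "keys m \<subseteq> {..<n}" by blast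
    then have "A = {..<n}" using keys_squarefree_mono[OF A(1)] by (simp add: card_subset_eq)
    then show "m = squarefree_mono {..<n}" using A by simp
  qed (auto simp: keys_squarefree_mono)
  then show "restrict_vars n (elem_sym n) m = of_bool (m = squarefree_mono {..<n})"
    by (auto simp: restrict_vars_def elem_sym_eq)
qed

lemma restrict_vars_conv: "restrict_vars n (conv F G) = conv (restrict_vars n F) (restrict_vars n G)"
proof
  fix m
  show "restrict_vars n (conv F G) m = conv (restrict_vars n F) (restrict_vars n G) m"
  proof (cases "keys m \<subseteq> {..<n}")
    case True
    then show ?thesis
      unfolding conv_def restrict_vars_def by (auto simp: keys_add_nat intro!: sum.cong)
  next
    case False
    then have "conv (restrict_vars n F) (restrict_vars n G) m = 0"
      unfolding conv_def restrict_vars_def by (intro sum.neutral) (auto simp: keys_add_nat)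
    then show ?thesis using False by (simp add: restrict_vars_def)
  qed
qed

lemma restrict_vars_one: "restrict_vars n mono_one = mono_one"
  by (auto simp: restrict_vars_def mono_one_def fun_eq_iff)

text \<open>The degree index ensures that a lift to one more variable has the degree of the
  original, so that the difference formed below stays homogeneous.\<close>

inductive esym_poly :: "nat \<Rightarrow> nat \<Rightarrow> (mono \<Rightarrow> int) \<Rightarrow> bool" for n where
  zero: "esym_poly n d (\<lambda>m. 0)"
| one: "esym_poly n 0 mono_one"
| esym: "esym_poly n k (restrict_vars n (elem_sym k))"
| neg: "esym_poly n d F \<Longrightarrow> esym_poly n d (\<lambda>m. - F m)"
| add: "esym_poly n d F \<Longrightarrow> esym_poly n d G \<Longrightarrow> esym_poly n d (\<lambda>m. F m + G m)"
| mult: "esym_poly n d F \<Longrightarrow> esym_poly n e G \<Longrightarrow> esym_poly n (d + e) (conv F G)"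

definition homogeneous_sym :: "nat \<Rightarrow> nat \<Rightarrow> (mono \<Rightarrow> int) \<Rightarrow> bool" where
  "homogeneous_sym n d F \<longleftrightarrow> (\<forall>m. F m \<noteq> 0 \<longrightarrow> keys m \<subseteq> {..<n} \<and> mono_degree m = d) \<and>
    (\<forall>\<pi> m. \<pi> permutes {..<n} \<longrightarrow> F (map_key \<pi> m) = F m)"

lemma keys_map_key_permutes:
  assumes "\<pi> permutes {..<n}" shows "keys (map_key \<pi> m) \<subseteq> {..<n} \<longleftrightarrow> keys m \<subseteq> {..<n}"
proof -
  have "keys (map_key \<pi> m) = \<pi> -` keys m" by (rule keys_map_key[OF permutes_inj[OF assms]])
  moreover have "\<pi> -` keys m \<subseteq> {..<n} \<longleftrightarrow> keys m \<subseteq> {..<n}"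
    using permutes_in_image[OF assms] permutes_surj[OF assms] by (auto simp: subset_iff) (metis lessThan_iff surjD)
  ultimately show ?thesis by simp
qed

lemma esym_poly_homogeneous: "esym_poly n d F \<Longrightarrow> homogeneous_sym n d F"
proof (induction rule: esym_poly.induct)
  case one
  then show ?case using map_key_eq_zero_iff[OF permutes_bij] by (auto simp: homogeneous_sym_def mono_one_def)
next
  case (esym k)
  show ?case unfolding homogeneous_sym_def
  proof (intro conjI allI impI)
    fix \<pi> m assume \<pi>: "\<pi> permutes {..<n}"
    then show "restrict_vars n (elem_sym k) (map_key \<pi> m) = restrict_vars n (elem_sym k) m"
      by (simp add: restrict_vars_def keys_map_key_permutes elem_sym_map_key permutes_bij)
  qed (auto simp: restrict_vars_def elem_sym_degree split: if_splits)
next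
  case (add d F G)
  then show ?case unfolding homogeneous_sym_def by (metis add.right_neutral)
next
  case (mult d F e G)
  show ?case unfolding homogeneous_sym_def
  proof (intro conjI allI impI)
    fix m assume "conv F G m \<noteq> 0"
    then obtain a b where "a + b = m" "F a \<noteq> 0" "G b \<noteq> 0" by (rule conv_nonzero)
    then show "keys m \<subseteq> {..<n}" "mono_degree m = d + e"
      using mult.IH unfolding homogeneous_sym_def by (metis keys_add_nat Un_least, metis mono_degree_add)
  next
    fix \<pi> m assume "\<pi> permutes {..<n}"
    then show "conv F G (map_key \<pi> m) = conv F G m"
      using mult.IH by (intro conv_map_key) (auto simp: homogeneous_sym_def permutes_bij)
  qed
qed (auto simp: homogeneous_sym_def)

text \<open>Restriction respects sums and products and sends e_k in n+1 variables to e_k in n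
  variables, so a polynomial expression in the generators lifts term by term.\<close>

lemma esym_poly_lift:
  "esym_poly n d F \<Longrightarrow> \<exists>G. esym_poly (Suc n) d G \<and> restrict_vars n G = F"
proof (induction rule: esym_poly.induct)
  case (zero d)
  show ?case using esym_poly.zero by (intro exI[of _ "\<lambda>m. 0"]) (auto simp: restrict_vars_def)
next
  case one
  show ?case using esym_poly.one restrict_vars_one by blast
next
  case (esym k)
  have "restrict_vars n (restrict_vars (Suc n) (elem_sym k)) = restrict_vars n (elem_sym k)"
    by (auto simp: restrict_vars_def fun_eq_iff)
  then show ?case using esym_poly.esym by blast
next
  case (neg d F)
  then obtain G where "esym_poly (Suc n) d G" "restrict_vars n G = F" by blast
  then show ?case by (intro exI[of _ "\<lambda>m. - G m"]) (auto simp: restrict_vars_def intro: esym_poly.neg)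
next
  case (add d F F')
  then obtain G G' where "esym_poly (Suc n) d G" "restrict_vars n G = F"
    "esym_poly (Suc n) d G'" "restrict_vars n G' = F'" by blast
  then show ?case by (intro exI[of _ "\<lambda>m. G m + G' m"]) (auto simp: restrict_vars_def intro: esym_poly.add)
next
  case (mult d F e F')
  then obtain G G' where "esym_poly (Suc n) d G" "restrict_vars n G = F"
    "esym_poly (Suc n) e G'" "restrict_vars n G' = F'" by blast
  then show ?case by (intro exI[of _ "conv G G'"]) (auto simp: restrict_vars_conv intro: esym_poly.mult)
qed

lemma esym_poly_scale: "esym_poly n d F \<Longrightarrow> esym_poly n d (\<lambda>m. z * F m)"
proof (induction z rule: int_induct[of _ 0])
  case base
  show ?case using esym_poly.zero by simp
next
  case (step1 i)
  then have "esym_poly n d (\<lambda>m. i * F m + F m)" by (intro esym_poly.add) auto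
  then show ?case by (simp add: algebra_simps)
next
  case (step2 i)
  then have "esym_poly n d (\<lambda>m. i * F m + - F m)" by (intro esym_poly.add esym_poly.neg) auto
  then show ?case by (simp add: algebra_simps)
qed

text \<open>A symmetric polynomial that vanishes for \<open>x\<^sub>n = 0\<close> is divisible by \<open>x\<^sub>0 \<dots> x\<^sub>n\<close>; subtracting a lift
  of the specialisation to \<open>n\<close> variables reduces to this case.\<close>

lemma homogeneous_sym_esym_poly: "homogeneous_sym n d F \<Longrightarrow> esym_poly n d F"
proof (induction n arbitrary: d F)
  case 0
  then have supp: "m = 0 \<and> d = 0" if "F m \<noteq> 0" for m
    using that by (auto simp: homogeneous_sym_def)
  show ?case
  proof (cases "F 0 = 0")
    case True
    then have "F = (\<lambda>m. 0)" using supp by (auto simp: fun_eq_iff)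
    then show ?thesis using esym_poly.zero by simp
  next
    case False
    then have "d = 0" using supp by simp
    moreover have "F = (\<lambda>m. F 0 * mono_one m)"
    proof
      fix m show "F m = F 0 * mono_one m" using supp[of m] by (auto simp: mono_one_def)
    qed
    ultimately show ?thesis using esym_poly_scale[OF esym_poly.one] by metis
  qed
next
  case (Suc n)
  \<comment> \<open>The outer induction is on the number of variables, the inner one on the degree:
    the lift starts from one variable less, the quotient by the product of all variables has smaller
    degree.\<close>
  show ?case using Suc.prems
  proof (induction d arbitrary: F rule: less_induct)
    case (less d)
    let ?N = "Suc n" let ?e = "squarefree_mono {..<Suc n}"
    have "homogeneous_sym n d (restrict_vars n F)"
      unfolding homogeneous_sym_def
    proof (intro conjI allI impI)
      fix \<pi> m assume \<pi>: "\<pi> permutes {..<n}"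
      then have "\<pi> permutes {..<Suc n}" by (rule permutes_subset) auto
      then show "restrict_vars n F (map_key \<pi> m) = restrict_vars n F m"
        using less.prems \<pi> by (simp add: restrict_vars_def keys_map_key_permutes homogeneous_sym_def)
    qed (use less.prems in \<open>auto simp: restrict_vars_def homogeneous_sym_def split: if_splits\<close>)
    then obtain Q where Q: "esym_poly ?N d Q" "restrict_vars n Q = restrict_vars n F"
      using Suc.IH esym_poly_lift by blast
    define G where "G m = F m - Q m" for m
    have G: "homogeneous_sym ?N d G"
      using less.prems esym_poly_homogeneous[OF Q(1)] unfolding homogeneous_sym_def G_def
      by (metis diff_self)
    have FG: "F = (\<lambda>m. Q m + G m)" by (simp add: G_def)
    have vanish: "G m = 0" if "keys m \<subseteq> {..<n}" for m
      using fun_cong[OF Q(2), of m] that by (simp add: restrict_vars_def G_def)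
    \<comment> \<open>If a monomial of G omitted the variable i, exchanging i with the last variable
      n would give a monomial that omits n, where G vanishes.\<close>
    have pos: "lookup m i > 0" if "G m \<noteq> 0" "i < ?N" for m i
    proof (rule ccontr)
      assume "\<not> lookup m i > 0"
      let ?\<pi> = "Transposition.transpose i n"
      have \<pi>: "?\<pi> permutes {..<?N}" using that(2) by (intro permutes_swap_id) auto
      have "keys m \<subseteq> {..<?N}" using G that(1) by (simp add: homogeneous_sym_def)
      then have "keys (map_key ?\<pi> m) \<subseteq> {..<?N}" using keys_map_key_permutes[OF \<pi>, of m] by simp
      moreover have "n \<notin> keys (map_key ?\<pi> m)"
        using \<open>\<not> lookup m i > 0\<close> by (simp add: in_keys_iff lookup_map_key permutes_inj[OF \<pi>])
      ultimately have "keys (map_key ?\<pi> m) \<subseteq> {..<n}" by (auto simp: subset_iff less_Suc_eq)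
      then have "G (map_key ?\<pi> m) = 0" by (rule vanish)
      moreover have "G (map_key ?\<pi> m) = G m" using G \<pi> by (simp add: homogeneous_sym_def)
      ultimately show False using that(1) by simp
    qed
    have ex: "?e + (m - ?e) = m" if "\<And>i. i < ?N \<Longrightarrow> lookup m i > 0" for m
      using that by (intro poly_mapping_eqI) (auto simp: lookup_add lookup_minus lookup_squarefree_mono Suc_le_eq)
    show ?case
    proof (cases "\<exists>m. G m \<noteq> 0")
      case False
      then have "F = Q" using FG by simp
      then show ?thesis using Q by simp
    next
      case True
      then obtain m0 where m0: "G m0 \<noteq> 0" by blast
      then have "mono_degree (?e + (m0 - ?e)) = d" using ex[of m0] pos G by (simp add: homogeneous_sym_def)
      then have d: "d \<ge> ?N" by (simp add: mono_degree_add mono_degree_squarefree_mono)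
      \<comment> \<open>In n+1 variables e_(n+1) is the single invariant monomial \<open>?e\<close>;
        dividing G by it shifts the exponents and keeps the symmetry.\<close>
      define R where "R m = G (?e + m)" for m
      have "homogeneous_sym ?N (d - ?N) R"
        unfolding homogeneous_sym_def
      proof (intro conjI allI impI)
        fix m assume "R m \<noteq> 0"
        then have "keys (?e + m) \<subseteq> {..<?N}" "mono_degree (?e + m) = d"
          using G by (simp_all add: R_def homogeneous_sym_def)
        then show "keys m \<subseteq> {..<?N}" "mono_degree m = d - ?N"
          by (simp_all add: keys_add_nat mono_degree_add mono_degree_squarefree_mono)
      next
        fix \<pi> m assume \<pi>: "\<pi> permutes {..<?N}"
        have "map_key \<pi> ?e = ?e"
          using permutes_in_image[OF \<pi>]
          by (intro poly_mapping_eqI) (simp add: lookup_map_key permutes_inj[OF \<pi>] lookup_squarefree_mono)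
        then have "?e + map_key \<pi> m = map_key \<pi> (?e + m)"
          using map_key_plus[OF permutes_inj[OF \<pi>]] by metis
        then show "R (map_key \<pi> m) = R m" using G \<pi> by (simp add: R_def homogeneous_sym_def)
      qed
      then have "esym_poly ?N (d - ?N) R" using less.IH[of "d - ?N"] d by simp
      then have "esym_poly ?N (?N + (d - ?N)) (conv (restrict_vars ?N (elem_sym ?N)) R)"
        by (intro esym_poly.mult esym_poly.esym)
      moreover have "conv (restrict_vars ?N (elem_sym ?N)) R = G"
      proof
        fix m
        have "G m = 0" if "\<nexists>b. ?e + b = m" using that ex[of m] pos[of m] by blast
        moreover have "?e + (m - ?e) = m" if "\<exists>b. ?e + b = m" using that by auto
        ultimately show "conv (restrict_vars ?N (elem_sym ?N)) R m = G m"
          unfolding restrict_vars_elem_sym_self conv_delta by (auto simp: R_def)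
      qed
      ultimately have "esym_poly ?N d G" using d by simp
      then show ?thesis using esym_poly.add[OF Q(1)] FG by metis
    qed
  qed
qed

text \<open>Bounded degree makes the restriction a finite sum of homogeneous parts, each a
  polynomial in the e_k. The induction runs through polynomials in n variables, since evaluation
  sees nothing else; the degree bounds in the premises are those under which evaluation respects
  sums and products.\<close>

theorem symmetric_function_induct [consumes 1, case_names one elem_sym neg add mult]:
  assumes F: "F \<in> carrier sym_fun_ring"
    and one: "P mono_one"
    and elem: "\<And>k. P (restrict_vars n (elem_sym k))"
    and neg: "\<And>F. bounded_degree F \<Longrightarrow> P F \<Longrightarrow> P (\<lambda>m. - F m)"
    and add: "\<And>F G. bounded_degree F \<Longrightarrow> bounded_degree G \<Longrightarrow> P F \<Longrightarrow> P G \<Longrightarrow> P (\<lambda>m. F m + G m)"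
    and mult: "\<And>F G. bounded_degree F \<Longrightarrow> bounded_degree G \<Longrightarrow> P F \<Longrightarrow> P G \<Longrightarrow> P (conv F G)"
  shows "P (restrict_vars n F)"
proof -
  have bd: "bounded_degree F" if "esym_poly n d F" for d F
    using esym_poly_homogeneous[OF that] by (auto simp: homogeneous_sym_def bounded_degree_def)
  \<comment> \<open>Zero is obtained from the closure rules as 1 + (-1).\<close>
  have zero: "P (\<lambda>m. 0)"
    using add[OF bounded_degree_one bounded_degree_uminus[OF bounded_degree_one] one neg[OF bounded_degree_one one]]
    by simp
  have P: "P F" if "esym_poly n d F" for d F
    using that by induction (use bd zero one elem neg add mult in auto)
  obtain D where D: "\<And>m. F m \<noteq> 0 \<Longrightarrow> mono_degree m \<le> D"
    using F by (auto simp: sym_fun_ring_simps bounded_degree_def)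
  define H where "H d m = (if mono_degree m = d then restrict_vars n F m else 0)" for d m
  have "homogeneous_sym n d (H d)" for d
    using F by (auto simp: homogeneous_sym_def H_def restrict_vars_def keys_map_key_permutes
        mono_degree_map_key permutes_bij sym_fun_ring_simps)
  then have H: "esym_poly n d (H d)" for d by (rule homogeneous_sym_esym_poly)
  have "P (\<lambda>m. \<Sum>d<k. H d m) \<and> bounded_degree (\<lambda>m. \<Sum>d<k. H d m)" for k
  proof (induction k)
    case 0
    show ?case using zero by (simp add: bounded_degree_def)
  next
    case (Suc k)
    then show ?case using add[of "\<lambda>m. \<Sum>d<k. H d m" "H k"] bd[OF H] P[OF H] bounded_degree_add by simp
  qed
  moreover have "restrict_vars n F = (\<lambda>m. \<Sum>d<Suc D. H d m)"
  proof (rule ext, rule sym)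
    fix m
    show "(\<Sum>d<Suc D. H d m) = restrict_vars n F m"
    proof (cases "F m = 0")
    case True
    then show ?thesis by (simp add: H_def restrict_vars_def)
  next
    case False
    then have "mono_degree m < Suc D" using D by (simp add: le_imp_less_Suc)
    then show ?thesis by (simp add: H_def del: sum.lessThan_Suc)
    qed
  qed
  ultimately show ?thesis by (simp only:)
qed

section \<open>The group algebra of a finite group\<close>

lemma group_algebra_simps:
  "f \<in> carrier (group_algebra G) \<longleftrightarrow> (\<forall>w. w \<notin> carrier G \<longrightarrow> f w = 0)"
  "f \<oplus>\<^bsub>group_algebra G\<^esub> g = (\<lambda>w. f w + g w)"
  "\<zero>\<^bsub>group_algebra G\<^esub> = (\<lambda>w. 0)"
  "\<one>\<^bsub>group_algebra G\<^esub> = (\<lambda>w. of_bool (w = \<one>\<^bsub>G\<^esub>))"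
  by (simp_all add: group_algebra_def)

locale finite_group = group G for G (structure) +
  assumes fin: "finite (carrier G)"
begin

abbreviation ga_mult (infixl "\<star>" 70) where "f \<star> g \<equiv> f \<otimes>\<^bsub>group_algebra G\<^esub> g"

lemma mult_outside: "w \<notin> carrier G \<Longrightarrow> (f \<star> g) w = 0"
  unfolding group_algebra_def by (auto intro!: sum.neutral)

lemma mult_eq:
  assumes "w \<in> carrier G"
  shows "(f \<star> g) w = (\<Sum>u\<in>carrier G. f u * g (inv u \<otimes> w))"
proof -
  have "(f \<star> g) w = (\<Sum>(u, v)\<in>{(u, v). u \<in> carrier G \<and> v \<in> carrier G \<and> u \<otimes> v = w}. f u * g v)"
    by (simp add: group_algebra_def)
  also have "\<dots> = (\<Sum>u\<in>carrier G. f u * g (inv u \<otimes> w))"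
    by (rule sum.reindex_bij_witness[of _ "\<lambda>u. (u, inv u \<otimes> w)" fst])
      (use assms in \<open>auto simp: m_assoc[symmetric]\<close>)
  finally show ?thesis .
qed

lemma mult_closed: "f \<star> g \<in> carrier (group_algebra G)"
  by (simp add: group_algebra_simps mult_outside)

lemma mult_assoc: "(f \<star> g) \<star> h = f \<star> (g \<star> h)"
proof
  fix w
  show "((f \<star> g) \<star> h) w = (f \<star> (g \<star> h)) w"
  proof (cases "w \<in> carrier G")
    case w: True
    have "((f \<star> g) \<star> h) w = (\<Sum>u\<in>carrier G. \<Sum>v\<in>carrier G. f v * g (inv v \<otimes> u) * h (inv u \<otimes> w))"
      by (simp add: mult_eq w sum_distrib_right)
    also have "\<dots> = (\<Sum>v\<in>carrier G. \<Sum>u\<in>carrier G. f v * g (inv v \<otimes> u) * h (inv u \<otimes> w))"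
      by (rule sum.swap)
    also have "\<dots> = (\<Sum>v\<in>carrier G. f v * (g \<star> h) (inv v \<otimes> w))"
    proof (rule sum.cong[OF refl])
      fix v assume v: "v \<in> carrier G"
      have "(\<Sum>u\<in>carrier G. f v * g (inv v \<otimes> u) * h (inv u \<otimes> w)) =
          (\<Sum>x\<in>carrier G. f v * (g x * h (inv x \<otimes> (inv v \<otimes> w))))"
      proof (rule sum.reindex_bij_witness[of _ "\<lambda>x. v \<otimes> x" "\<lambda>u. inv v \<otimes> u"])
        fix u assume u: "u \<in> carrier G"
        have "inv (inv v \<otimes> u) \<otimes> (inv v \<otimes> w) = inv u \<otimes> (v \<otimes> inv v) \<otimes> w"
          using u v w by (simp only: inv_mult_group inv_inv inv_closed m_closed m_assoc)
        then show "f v * (g (inv v \<otimes> u) * h (inv (inv v \<otimes> u) \<otimes> (inv v \<otimes> w))) =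
            f v * g (inv v \<otimes> u) * h (inv u \<otimes> w)"
          using u v w by simp
      qed (use v w in \<open>auto simp: m_assoc[symmetric]\<close>)
      then show "(\<Sum>u\<in>carrier G. f v * g (inv v \<otimes> u) * h (inv u \<otimes> w)) = f v * (g \<star> h) (inv v \<otimes> w)"
        using v w by (simp add: mult_eq sum_distrib_left)
    qed
    also have "\<dots> = (f \<star> (g \<star> h)) w" by (simp add: mult_eq w)
    finally show ?thesis .
  qed (simp add: mult_outside)
qed

lemma one_mult:
  assumes "f \<in> carrier (group_algebra G)" shows "\<one>\<^bsub>group_algebra G\<^esub> \<star> f = f"
proof
  fix w show "(\<one>\<^bsub>group_algebra G\<^esub> \<star> f) w = f w"
  proof (cases "w \<in> carrier G")
    case True
    have "(\<one>\<^bsub>group_algebra G\<^esub> \<star> f) w = (\<Sum>u\<in>{\<one>}. of_bool (u = \<one>) * f (inv u \<otimes> w))"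
      unfolding mult_eq[OF True] group_algebra_simps
      using fin by (intro sum.mono_neutral_right) auto
    then show ?thesis using True by simp
  next
    case False
    then show ?thesis using assms by (simp add: mult_outside group_algebra_simps)
  qed
qed

lemma mult_one:
  assumes "f \<in> carrier (group_algebra G)" shows "f \<star> \<one>\<^bsub>group_algebra G\<^esub> = f"
proof
  fix w show "(f \<star> \<one>\<^bsub>group_algebra G\<^esub>) w = f w"
  proof (cases "w \<in> carrier G")
    case True
    have "(f \<star> \<one>\<^bsub>group_algebra G\<^esub>) w = (\<Sum>u\<in>{w}. f u * of_bool (inv u \<otimes> w = \<one>))"
      unfolding mult_eq[OF True] group_algebra_simps
    proof (intro sum.mono_neutral_right ballI)
      fix u assume "u \<in> carrier G - {w}"
      then have "inv u \<otimes> w \<noteq> \<one>" using True by (metis DiffE insertI1 inv_closed inv_equality inv_inv)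
      then show "f u * of_bool (inv u \<otimes> w = \<one>) = 0" by simp
    qed (use fin True in auto)
    then show ?thesis using True by simp
  next
    case False
    then show ?thesis using assms by (simp add: mult_outside group_algebra_simps)
  qed
qed

lemma mult_add_left: "(\<lambda>w. f w + g w) \<star> h = (\<lambda>w. (f \<star> h) w + (g \<star> h) w)"
  by (auto simp: group_algebra_def fun_eq_iff sum.distrib[symmetric] distrib_right case_prod_unfold)

lemma mult_add_right: "h \<star> (\<lambda>w. f w + g w) = (\<lambda>w. (h \<star> f) w + (h \<star> g) w)"
  by (auto simp: group_algebra_def fun_eq_iff sum.distrib[symmetric] distrib_left case_prod_unfold)

lemma mult_sum_left:
  "((\<lambda>w. \<Sum>i\<in>I. c i * f i w) \<star> h) w = (\<Sum>i\<in>I. c i * (f i \<star> h) w)"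
proof (cases "w \<in> carrier G")
  case True
  then show ?thesis
    by (simp add: mult_eq sum_distrib_left sum_distrib_right mult.assoc sum.swap[of _ I])
qed (simp add: mult_outside)

lemma mult_sum_right:
  "(h \<star> (\<lambda>w. \<Sum>i\<in>I. c i * f i w)) w = (\<Sum>i\<in>I. c i * (h \<star> f i) w)"
proof (cases "w \<in> carrier G")
  case True
  then show ?thesis
    by (simp add: mult_eq sum_distrib_left mult.left_commute sum.swap[of _ I])
qed (simp add: mult_outside)

lemma ring_group_algebra: "ring (group_algebra G)"
proof (rule ringI)
  show "abelian_group (group_algebra G)"
  proof (rule abelian_groupI)
    fix f assume "f \<in> carrier (group_algebra G)"
    then show "\<exists>y\<in>carrier (group_algebra G). y \<oplus>\<^bsub>group_algebra G\<^esub> f = \<zero>\<^bsub>group_algebra G\<^esub>"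
      by (intro bexI[of _ "\<lambda>w. - f w"]) (auto simp: group_algebra_simps)
  qed (auto simp: group_algebra_simps)
  show "monoid (group_algebra G)"
  proof (rule monoidI)
    show "\<one>\<^bsub>group_algebra G\<^esub> \<in> carrier (group_algebra G)" by (auto simp: group_algebra_simps)
  qed (simp_all add: mult_closed mult_assoc one_mult mult_one)
qed (simp_all add: group_algebra_simps(2) mult_add_left mult_add_right)

sublocale A: ring "group_algebra G"
  by (rule ring_group_algebra)

end

subsection \<open>Evaluation of polynomials at commuting elements\<close>

context monoid
begin

abbreviation pow_prod :: "(nat \<Rightarrow> 'a) \<Rightarrow> (nat \<Rightarrow> nat) \<Rightarrow> nat list \<Rightarrow> 'a" where
  "pow_prod a k is \<equiv> foldr (\<lambda>i p. (a i [^] k i) \<otimes> p) is \<one>"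

lemma pow_prod_closed: "\<forall>i\<in>set is. a i \<in> carrier G \<Longrightarrow> pow_prod a k is \<in> carrier G"
  by (induction "is") auto

lemma pow_prod_commute:
  assumes "x \<in> carrier G" "\<forall>i\<in>set is. a i \<in> carrier G \<and> x \<otimes> a i = a i \<otimes> x"
  shows "x \<otimes> pow_prod a k is = pow_prod a k is \<otimes> x"
  using assms(2)
proof (induction "is")
  case (Cons i "is")
  then have i: "a i \<in> carrier G" "x \<otimes> a i = a i \<otimes> x" and c: "pow_prod a k is \<in> carrier G"
    and IH: "x \<otimes> pow_prod a k is = pow_prod a k is \<otimes> x"
    using pow_prod_closed[of "is" a k] by auto
  have "x \<otimes> a i [^] k i = a i [^] k i \<otimes> x"
    using group_commutes_pow[OF i(2)[symmetric] i(1) assms(1), of "k i"] by simp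
  then have "x \<otimes> (a i [^] k i \<otimes> pow_prod a k is) = a i [^] k i \<otimes> (x \<otimes> pow_prod a k is)"
    using i c assms(1) by (simp add: m_assoc[symmetric])
  then show ?case using IH i c assms(1) by (simp add: m_assoc)
qed (use assms in simp)

lemma pow_prod_add:
  assumes "\<forall>i\<in>set is. a i \<in> carrier G" "\<forall>i\<in>set is. \<forall>j\<in>set is. a i \<otimes> a j = a j \<otimes> a i"
  shows "pow_prod a (\<lambda>i. k i + l i) is = pow_prod a k is \<otimes> pow_prod a l is"
  using assms
proof (induction "is")
  case (Cons i "is")
  have a: "a i \<in> carrier G" using Cons.prems by simp
  have c: "pow_prod a k is \<in> carrier G" "pow_prod a l is \<in> carrier G"
    using Cons.prems pow_prod_closed[of "is" a] by auto
  have "a i \<otimes> a j = a j \<otimes> a i" "a j \<in> carrier G" if "j \<in> set is" for j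
    using Cons.prems that by (meson list.set_intros)+
  then have "a i \<otimes> pow_prod a k is = pow_prod a k is \<otimes> a i"
    by (intro pow_prod_commute[OF a]) blast
  then have "a i [^] l i \<otimes> pow_prod a k is = pow_prod a k is \<otimes> a i [^] l i"
    using group_commutes_pow[of "a i" "pow_prod a k is" "l i"] a c by simp
  then have "a i [^] k i \<otimes> (a i [^] l i \<otimes> pow_prod a k is) \<otimes> pow_prod a l is =
      a i [^] k i \<otimes> (pow_prod a k is \<otimes> a i [^] l i) \<otimes> pow_prod a l is" by simp
  then show ?case
    using Cons a c by (simp add: nat_pow_mult[symmetric] m_assoc)
qed simp

lemma pow_prod_cong: "\<forall>i\<in>set is. k i = l i \<Longrightarrow> pow_prod a k is = pow_prod a l is"
  by (induction "is") auto

lemma pow_prod_single: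
  assumes "distinct is" "j \<in> set is" "a j \<in> carrier G"
  shows "pow_prod a (\<lambda>i. of_bool (i = j)) is = a j"
  using assms
proof (induction "is")
  case (Cons i "is")
  have zero: "pow_prod a (\<lambda>i. of_bool (i = j)) is = \<one>" if "j \<notin> set is" for "is"
    using that by (induction "is") auto
  show ?case
  proof (cases "i = j")
    case True
    then show ?thesis using Cons.prems zero by simp
  next
    case False
    then show ?thesis using Cons by simp
  qed
qed simp

end

locale commuting_eval = finite_group G for G (structure) +
  fixes n :: nat and a :: "nat \<Rightarrow> 'a \<Rightarrow> rat"
  assumes a_closed: "i < n \<Longrightarrow> a i \<in> carrier (group_algebra G)"
    and a_comm: "i < n \<Longrightarrow> j < n \<Longrightarrow> a i \<star> a j = a j \<star> a i"
begin

abbreviation ev :: "mono \<Rightarrow> 'a \<Rightarrow> rat" where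
  "ev m \<equiv> mono_eval G n m a"

lemma ev_eq: "ev m = A.pow_prod a (lookup m) [0..<n]"
  by (simp add: mono_eval_def)

lemma ev_add: "ev (m + m') = ev m \<star> ev m'"
  unfolding ev_eq lookup_add using a_closed a_comm by (intro A.pow_prod_add) auto

lemma ev_zero: "ev 0 = \<one>\<^bsub>group_algebra G\<^esub>"
proof -
  have "A.pow_prod a (\<lambda>i. 0) is = \<one>\<^bsub>group_algebra G\<^esub>" for "is" by (induction "is") auto
  then show ?thesis by (simp add: ev_eq)
qed

lemma ev_single:
  assumes "i < n" shows "ev (Poly_Mapping.single i 1) = a i"
proof -
  have "ev (Poly_Mapping.single i 1) = A.pow_prod a (\<lambda>j. of_bool (j = i)) [0..<n]"
    unfolding ev_eq by (intro A.pow_prod_cong) (auto simp: lookup_single when_def)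
  also have "\<dots> = a i" using assms a_closed by (intro A.pow_prod_single) auto
  finally show ?thesis .
qed

abbreviation sev :: "(mono \<Rightarrow> int) \<Rightarrow> 'a \<Rightarrow> rat" where
  "sev F \<equiv> sym_fun_eval G n F a"

lemma sev_restrict: "sev (restrict_vars n F) = sev F"
  unfolding sym_fun_eval_def restrict_vars_def
  by (rule ext, rule sum.cong) auto

lemma finite_supp: "bounded_degree F \<Longrightarrow> finite {m. keys m \<subseteq> {..<n} \<and> F m \<noteq> 0}"
proof -
  assume "bounded_degree F"
  then obtain d where d: "\<And>m. F m \<noteq> 0 \<Longrightarrow> mono_degree m \<le> d" by (auto simp: bounded_degree_def)
  have "{m. keys m \<subseteq> {..<n} \<and> F m \<noteq> 0} \<subseteq> {m. keys m \<subseteq> {..<n} \<and> (\<forall>i. lookup m i \<le> d)}"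
    using d lookup_le_mono_degree order_trans by blast
  then show ?thesis by (rule finite_subset) (intro finite_bounded_monos, simp)
qed

lemma sev_eq_superset:
  assumes "finite S" "{m. keys m \<subseteq> {..<n} \<and> F m \<noteq> 0} \<subseteq> S" "\<And>m. m \<in> S \<Longrightarrow> keys m \<subseteq> {..<n}"
  shows "sev F w = (\<Sum>m\<in>S. of_int (F m) * ev m w)"
  unfolding sym_fun_eval_def using assms by (intro sum.mono_neutral_left) auto

lemma sev_one: "sev mono_one = \<one>\<^bsub>group_algebra G\<^esub>"
proof -
  have "{m. keys m \<subseteq> {..<n} \<and> mono_one m \<noteq> 0} = {0}" by (auto simp: mono_one_def)
  then show ?thesis by (simp add: sym_fun_eval_def ev_zero mono_one_def)
qed

lemma sev_uminus: "sev (\<lambda>m. - F m) = (\<lambda>w. - sev F w)"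
  by (simp add: sym_fun_eval_def sum_negf)

lemma sev_add:
  assumes "bounded_degree F" "bounded_degree G'"
  shows "sev (\<lambda>m. F m + G' m) = (\<lambda>w. sev F w + sev G' w)"
proof
  fix w
  let ?S = "{m. keys m \<subseteq> {..<n} \<and> F m \<noteq> 0} \<union> {m. keys m \<subseteq> {..<n} \<and> G' m \<noteq> 0}"
  have fin: "finite ?S" using assms finite_supp by blast
  have "sev (\<lambda>m. F m + G' m) w = (\<Sum>m\<in>?S. of_int (F m + G' m) * ev m w)"
    by (rule sev_eq_superset[OF fin]) auto
  also have "\<dots> = (\<Sum>m\<in>?S. of_int (F m) * ev m w) + (\<Sum>m\<in>?S. of_int (G' m) * ev m w)"
    by (simp add: distrib_right sum.distrib)
  also have "(\<Sum>m\<in>?S. of_int (F m) * ev m w) = sev F w"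
    by (rule sev_eq_superset[OF fin, symmetric]) auto
  also have "(\<Sum>m\<in>?S. of_int (G' m) * ev m w) = sev G' w"
    by (rule sev_eq_superset[OF fin, symmetric]) auto
  finally show "sev (\<lambda>m. F m + G' m) w = sev F w + sev G' w" .
qed

text \<open>Pairs of monomials are grouped by their product. Summation runs over all products of
  monomials from the two supports, which may exceed the support of the convolution by
  cancellation.\<close>

lemma sev_conv:
  assumes "bounded_degree F" "bounded_degree G'"
  shows "sev (conv F G') = sev F \<star> sev G'"
proof
  fix w
  let ?M = "{m. keys m \<subseteq> {..<n} \<and> F m \<noteq> 0}" and ?N = "{m. keys m \<subseteq> {..<n} \<and> G' m \<noteq> 0}"
  let ?S = "(\<lambda>(a, b). a + b) ` (?M \<times> ?N)"
  have fin: "finite ?M" "finite ?N" using assms finite_supp by blast+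
  have "sev (conv F G') w = (\<Sum>m\<in>?S. of_int (conv F G' m) * ev m w)"
  proof (rule sev_eq_superset)
    show "{m. keys m \<subseteq> {..<n} \<and> conv F G' m \<noteq> 0} \<subseteq> ?S"
    proof
      fix m assume "m \<in> {m. keys m \<subseteq> {..<n} \<and> conv F G' m \<noteq> 0}"
      then have m: "keys m \<subseteq> {..<n}" "conv F G' m \<noteq> 0" by auto
      obtain a b where ab: "a + b = m" "F a \<noteq> 0" "G' b \<noteq> 0" using conv_nonzero[OF m(2)] .
      then have "(a, b) \<in> ?M \<times> ?N" using m(1) keys_add_nat[of a b] by auto
      then show "m \<in> ?S" using ab(1) by force
    qed
  qed (use fin in \<open>auto simp: keys_add_nat\<close>)
  also have "\<dots> = (\<Sum>m\<in>?S. \<Sum>p | p \<in> ?M \<times> ?N \<and> (case p of (a, b) \<Rightarrow> a + b) = m.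
      of_int (F (fst p)) * of_int (G' (snd p)) * ev (fst p + snd p) w)"
  proof (rule sum.cong[OF refl])
    fix m assume "m \<in> ?S"
    then have km: "keys m \<subseteq> {..<n}" by (auto simp: keys_add_nat)
    have "conv F G' m = (\<Sum>p | p \<in> ?M \<times> ?N \<and> (case p of (a, b) \<Rightarrow> a + b) = m. F (fst p) * G' (snd p))"
      unfolding conv_def case_prod_unfold
      using finite_mono_antidiagonal[of m] km
      by (intro sum.mono_neutral_right) (auto simp: keys_add_nat case_prod_unfold)
    then show "of_int (conv F G' m) * ev m w = (\<Sum>p | p \<in> ?M \<times> ?N \<and> (case p of (a, b) \<Rightarrow> a + b) = m.
      of_int (F (fst p)) * of_int (G' (snd p)) * ev (fst p + snd p) w)"
      by (auto simp: sum_distrib_right case_prod_unfold intro!: sum.cong)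
  qed
  also have "\<dots> = (\<Sum>p\<in>?M \<times> ?N. of_int (F (fst p)) * of_int (G' (snd p)) * ev (fst p + snd p) w)"
    by (rule sum.group) (use fin in auto)
  also have "\<dots> = (\<Sum>(a, b)\<in>?M \<times> ?N. of_int (F a) * (of_int (G' b) * (ev a \<star> ev b) w))"
    by (simp add: case_prod_unfold ev_add mult.assoc)
  also have "\<dots> = (\<Sum>a\<in>?M. \<Sum>b\<in>?N. of_int (F a) * (of_int (G' b) * (ev a \<star> ev b) w))"
    by (rule sum.cartesian_product[symmetric])
  also have "\<dots> = (\<Sum>a\<in>?M. of_int (F a) * (\<Sum>b\<in>?N. of_int (G' b) * (ev a \<star> ev b) w))"
    by (simp only: sum_distrib_left)
  also have "\<dots> = (sev F \<star> sev G') w"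
    unfolding sym_fun_eval_def mult_sum_left mult_sum_right ..
  finally show "sev (conv F G') w = (sev F \<star> sev G') w" .
qed

end

section \<open>Odd Jucys--Murphy elements\<close>

lemma finite_group_sym_group: "finite_group (sym_group N)"
  using sym_group_is_group unfolding finite_group_def finite_group_axioms_def sym_group_def
  by (simp add: finite_permutations)

lemma sym_algebra_mult_eq:
  assumes "w permutes vertices n"
  shows "(f \<otimes>\<^bsub>sym_algebra n\<^esub> g) w = (\<Sum>u\<in>carrier (sym_group (2 * n)). f u * g (inv' u \<circ> w))"
  using finite_group.mult_eq[OF finite_group_sym_group, of w "2 * n" f g] assms
  by (simp add: carrier_iff_vertices sym_group_mult)

lemma transpose_permutes_vertices:
  "1 \<le> a \<Longrightarrow> a < c \<Longrightarrow> c \<le> 2 * n \<Longrightarrow> Transposition.transpose a c permutes vertices n"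
  by (intro permutes_swap_id) auto

lemma jucys_murphy_mult:
  assumes c: "c \<le> 2 * n" and w: "w permutes vertices n"
  shows "(jucys_murphy c \<otimes>\<^bsub>sym_algebra n\<^esub> f) w = (\<Sum>a\<in>{1..<c}. f (Transposition.transpose a c \<circ> w))"
proof -
  have "(jucys_murphy c \<otimes>\<^bsub>sym_algebra n\<^esub> f) w =
      (\<Sum>u\<in>carrier (sym_group (2 * n)). \<Sum>a\<in>{1..<c}. of_bool (u = Transposition.transpose a c) * f (inv' u \<circ> w))"
    unfolding sym_algebra_mult_eq[OF w] jucys_murphy_def sum_distrib_right ..
  also have "\<dots> = (\<Sum>a\<in>{1..<c}. \<Sum>u\<in>carrier (sym_group (2 * n)). of_bool (u = Transposition.transpose a c) * f (inv' u \<circ> w))"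
    by (rule sum.swap)
  also have "\<dots> = (\<Sum>a\<in>{1..<c}. f (Transposition.transpose a c \<circ> w))"
  proof (rule sum.cong[OF refl])
    fix a assume a: "a \<in> {1..<c}"
    let ?\<tau> = "Transposition.transpose a c"
    have "?\<tau> \<in> carrier (sym_group (2 * n))"
      unfolding carrier_iff_vertices using a c by (intro transpose_permutes_vertices) auto
    then have "(\<Sum>u\<in>carrier (sym_group (2 * n)). of_bool (u = ?\<tau>) * f (inv' u \<circ> w)) =
        (\<Sum>u\<in>{?\<tau>}. of_bool (u = ?\<tau>) * f (inv' u \<circ> w))"
      by (intro sum.mono_neutral_right finite_carrier) auto
    then show "(\<Sum>u\<in>carrier (sym_group (2 * n)). of_bool (u = ?\<tau>) * f (inv' u \<circ> w)) = f (?\<tau> \<circ> w)"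
      by simp
  qed
  finally show ?thesis .
qed

lemma jucys_murphy_closed: "c \<le> 2 * n \<Longrightarrow> jucys_murphy c \<in> carrier (sym_algebra n)"
  unfolding group_algebra_simps carrier_iff_vertices jucys_murphy_def
  using transpose_permutes_vertices by (auto intro!: sum.neutral)

text \<open>For i < j < k conjugation by (i j) fixes k and permutes the points below k, hence
  permutes the transpositions (a k) that make up the larger element.\<close>

lemma jucys_murphy_commute_less:
  assumes "j < k" "k \<le> 2 * n"
  shows "jucys_murphy j \<otimes>\<^bsub>sym_algebra n\<^esub> jucys_murphy k = jucys_murphy k \<otimes>\<^bsub>sym_algebra n\<^esub> jucys_murphy j"
proof -
  interpret finite_group "sym_group (2 * n)" by (rule finite_group_sym_group)
  let ?\<tau> = Transposition.transpose
  have "(jucys_murphy j \<otimes>\<^bsub>sym_algebra n\<^esub> (jucys_murphy k \<otimes>\<^bsub>sym_algebra n\<^esub> f)) w = (jucys_murphy k \<otimes>\<^bsub>sym_algebra n\<^esub> (jucys_murphy j \<otimes>\<^bsub>sym_algebra n\<^esub> f)) w" for f w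
  proof (cases "w permutes vertices n")
    case w: True
    have p: "?\<tau> a c \<circ> w permutes vertices n" if "a \<in> {1..<c}" "c \<le> 2 * n" for a c
      using permutes_compose[OF w transpose_permutes_vertices] that by auto
    have "(jucys_murphy j \<otimes>\<^bsub>sym_algebra n\<^esub> (jucys_murphy k \<otimes>\<^bsub>sym_algebra n\<^esub> f)) w = (\<Sum>i\<in>{1..<j}. \<Sum>a\<in>{1..<k}. f (?\<tau> a k \<circ> (?\<tau> i j \<circ> w)))"
      using assms by (simp add: jucys_murphy_mult w p)
    also have "\<dots> = (\<Sum>i\<in>{1..<j}. \<Sum>a\<in>{1..<k}. f (?\<tau> i j \<circ> (?\<tau> a k \<circ> w)))"
    proof (rule sum.cong[OF refl])
      fix i assume i: "i \<in> {1..<j}"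
      have perm: "?\<tau> i j permutes {1..<k}" using i assms by (intro permutes_swap_id) auto
      have "?\<tau> (?\<tau> i j a) k \<circ> ?\<tau> i j = ?\<tau> i j \<circ> ?\<tau> a k" for a
        using i assms by (auto simp: fun_eq_iff Transposition.transpose_def)
      then have eq: "?\<tau> (?\<tau> i j a) k \<circ> (?\<tau> i j \<circ> w) = ?\<tau> i j \<circ> (?\<tau> a k \<circ> w)" for a
        by (metis comp_assoc)
      show "(\<Sum>a\<in>{1..<k}. f (?\<tau> a k \<circ> (?\<tau> i j \<circ> w))) = (\<Sum>a\<in>{1..<k}. f (?\<tau> i j \<circ> (?\<tau> a k \<circ> w)))"
        unfolding eq[symmetric] by (rule sum.reindex_bij_betw[OF permutes_imp_bij[OF perm], symmetric])
    qed
    also have "\<dots> = (\<Sum>a\<in>{1..<k}. \<Sum>i\<in>{1..<j}. f (?\<tau> i j \<circ> (?\<tau> a k \<circ> w)))"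
      by (rule sum.swap)
    also have "\<dots> = (jucys_murphy k \<otimes>\<^bsub>sym_algebra n\<^esub> (jucys_murphy j \<otimes>\<^bsub>sym_algebra n\<^esub> f)) w"
      using assms by (simp add: jucys_murphy_mult w p)
    finally show ?thesis .
  qed (simp add: mult_outside carrier_iff_vertices)
  \<comment> \<open>Both products act alike on every f; f = 1 recovers the elements
    themselves.\<close>
  then have "jucys_murphy j \<otimes>\<^bsub>sym_algebra n\<^esub> (jucys_murphy k \<otimes>\<^bsub>sym_algebra n\<^esub> \<one>\<^bsub>sym_algebra n\<^esub>) = jucys_murphy k \<otimes>\<^bsub>sym_algebra n\<^esub> (jucys_murphy j \<otimes>\<^bsub>sym_algebra n\<^esub> \<one>\<^bsub>sym_algebra n\<^esub>)"
    by (intro ext)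
  then show ?thesis using assms by (simp add: mult_one jucys_murphy_closed)
qed

lemma jucys_murphy_commute:
  assumes "j \<le> 2 * n" "k \<le> 2 * n"
  shows "jucys_murphy j \<otimes>\<^bsub>sym_algebra n\<^esub> jucys_murphy k = jucys_murphy k \<otimes>\<^bsub>sym_algebra n\<^esub> jucys_murphy j"
  using jucys_murphy_commute_less[of j k n] jucys_murphy_commute_less[of k j n] assms
  by (cases j k rule: linorder_cases) auto

definition odd_jucys_murphy_elem :: "nat \<Rightarrow> (nat \<Rightarrow> nat) \<Rightarrow> rat" where
  "odd_jucys_murphy_elem i = jucys_murphy (2 * i + 1)"

locale odd_jucys_murphy =
  fixes n :: nat
begin

sublocale commuting_eval "sym_group (2 * n)" n odd_jucys_murphy_elem
  unfolding commuting_eval_def commuting_eval_axioms_def odd_jucys_murphy_elem_def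
  by (intro conjI allI impI finite_group_sym_group jucys_murphy_closed jucys_murphy_commute) auto

abbreviation mult_sym_algebra (infixl "\<star>" 70) where
  "f \<star> g \<equiv> f \<otimes>\<^bsub>sym_algebra n\<^esub> g"

text \<open>The idempotent times the order of the group. Without the normalising factor all values
  stay integers, and \<open>hecke_embed\<close> restores it.\<close>

definition B_sum :: "(nat \<Rightarrow> nat) \<Rightarrow> rat" where
  "B_sum w = of_bool (w \<in> hyperoct n)"

definition mono_action :: "mono \<Rightarrow> (nat \<Rightarrow> nat) \<Rightarrow> rat" where
  "mono_action \<gamma> = ev \<gamma> \<star> B_sum"

lemma B_sum_closed: "B_sum \<in> carrier (sym_algebra n)"
  by (auto simp: group_algebra_simps B_sum_def hyperoct_def)

lemma mono_action_zero: "mono_action 0 = B_sum"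
  unfolding mono_action_def ev_zero by (rule one_mult[OF B_sum_closed])

text \<open>The factors commute, so the new one may stand at the left end, where it acts on w by the
  transpositions (a, 2i+1).\<close>

lemma mono_action_step:
  assumes "i < n" "w permutes vertices n"
  shows "mono_action (\<gamma> + Poly_Mapping.single i 1) w =
    (\<Sum>a\<in>{1..<2 * i + 1}. mono_action \<gamma> (Transposition.transpose a (2 * i + 1) \<circ> w))"
proof -
  have "mono_action (\<gamma> + Poly_Mapping.single i 1) = jucys_murphy (2 * i + 1) \<star> mono_action \<gamma>"
    unfolding mono_action_def add.commute[of \<gamma>] ev_add ev_single[OF assms(1)] mult_assoc odd_jucys_murphy_elem_def ..
  then show ?thesis using jucys_murphy_mult[of "2 * i + 1" n w] assms by simp
qed

lemma sev_mult_B_sum: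
  "(sev F \<star> B_sum) w = (\<Sum>\<gamma> | keys \<gamma> \<subseteq> {..<n} \<and> F \<gamma> \<noteq> 0. of_int (F \<gamma>) * mono_action \<gamma> w)"
  unfolding sym_fun_eval_def mult_sum_left mono_action_def ..

end

subsection \<open>Elementary symmetric polynomials\<close>

lemma std_above_Suc: "i < n \<Longrightarrow> matching n m \<Longrightarrow>
  std_above n i m \<longleftrightarrow> std_above n (Suc i) m \<and> m (2 * i + 2) = 2 * i + 1"
proof -
  assume i: "i < n" and "matching n m"
  interpret matching n m by fact
  show ?thesis
  proof
    assume s: "std_above n i m"
    then have "m (2 * i + 2) = std_involution n (2 * i + 2)" using i by (simp add: std_above_def)
    then show "std_above n (Suc i) m \<and> m (2 * i + 2) = 2 * i + 1"
      using s std_involution_pair(2)[OF i] by (simp add: std_above_def)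
  next
    assume s: "std_above n (Suc i) m \<and> m (2 * i + 2) = 2 * i + 1"
    then have "m (2 * i + 1) = 2 * i + 2" using m_simps(3)[of "2 * i + 2"] i by simp
    show "std_above n i m"
      unfolding std_above_def
    proof (intro ballI impI)
      fix x assume x: "x \<in> vertices n" "2 * i < x"
      then consider "x = 2 * i + 1" | "x = 2 * i + 2" | "2 * Suc i < x" by force
      then show "m x = std_involution n x"
        using x s \<open>m (2 * i + 1) = 2 * i + 2\<close> std_involution_pair[OF i] by cases (auto simp: std_above_def)
    qed
  qed
qed

text \<open>The swap sends the partner of 2i+2 to 2i+1 exactly when this partner is a, so at most
  one a makes pair i standard.\<close>

lemma std_above_swap_iff:
  assumes i: "i < n" and m: "matching n m" and a: "1 \<le> a" "a < 2 * i + 1"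
  shows "std_above n i (swap_conj a (2 * i + 1) m) \<longleftrightarrow> std_above n (Suc i) m \<and> m (2 * i + 2) = a"
proof -
  have "matching n (swap_conj a (2 * i + 1) m)" using matching_swap(2)[OF m] i a by simp
  moreover have "std_above n (Suc i) (swap_conj a (2 * i + 1) m) \<longleftrightarrow> std_above n (Suc i) m"
    using a by (intro std_above_swap) auto
  moreover have "swap_conj a (2 * i + 1) m (2 * i + 2) = 2 * i + 1 \<longleftrightarrow> m (2 * i + 2) = a"
    using a by (auto simp: Transposition.transpose_def)
  ultimately show ?thesis using std_above_Suc[OF i] by blast
qed

text \<open>After the swap the component of a stays within the vertices up to 2i and misses 2i+1.
  Swapping back is therefore a merge.\<close>

lemma excess_degree_swap_std_above:
  assumes i: "i < n" and m: "matching n m" and a: "1 \<le> a" "a < 2 * i + 1"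
    and std: "std_above n i (swap_conj a (2 * i + 1) m)"
  shows "excess_degree n m = excess_degree n (swap_conj a (2 * i + 1) m) + 1"
proof -
  let ?u = "swap_conj a (2 * i + 1) m"
  have V: "a \<in> vertices n" "2 * i + 1 \<in> vertices n" "a \<noteq> 2 * i + 1" using i a by auto
  interpret U: matching n ?u using matching_swap(2)[OF m V] .
  have "2 * i + 1 \<notin> U.comp_of a" using U.comp_le[OF std V(1)] a by fastforce
  then have "excess_degree n (swap_conj a (2 * i + 1) ?u) = excess_degree n ?u + 1"
    using excess_degree_swap(1)[OF U.matching_axioms V] by simp
  then show ?thesis unfolding swap_conj_swap_conj .
qed

lemma excess_zero_if_std_above_0:
  assumes "matching n m" "std_above n 0 m" shows "excess n m i = 0"
proof -
  interpret matching n m by fact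
  show ?thesis
  proof (cases "i \<in> tops")
    case True
    then have i: "i < n" by (simp add: tops_def)
    then have "m (2 * i + 1) = 2 * i + 2"
      using assms(2) std_involution_pair(1)[OF i] by (simp add: std_above_def)
    then show ?thesis using excess_pos_iff[OF True] by simp
  qed (rule excess_not_tops)
qed

lemma sum_of_bool_eq:
  "finite S \<Longrightarrow> (\<Sum>a\<in>S. of_bool (x = a) * (c :: rat)) = of_bool (x \<in> S) * c"
  by (induction S rule: finite_induct) auto

context odd_jucys_murphy
begin

lemma sum_squarefree_mono_action:
  assumes "i \<le> n" "w permutes vertices n"
  shows "(\<Sum>A | A \<subseteq> {..<i} \<and> card A = k. mono_action (squarefree_mono A) w) =
    of_bool (std_above n i (perm_matching n w) \<and> excess_degree n (perm_matching n w) = k)"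
  using assms
proof (induction i arbitrary: k w)
  case 0
  have sq: "squarefree_mono {} = 0" by (simp add: squarefree_mono_def)
  have "excess_degree n (perm_matching n w) = 0" if "std_above n 0 (perm_matching n w)"
    using excess_zero_if_std_above_0[OF matching_perm[OF 0(2)] that] by (simp add: excess_degree_def)
  moreover have "{A :: nat set. A \<subseteq> {..<0} \<and> card A = k} = (if k = 0 then {{}} else {})" by auto
  ultimately show ?case
    by (auto simp: sq mono_action_zero B_sum_def std_above_0_iff[OF 0(2)])
next
  case (Suc i)
  note w = Suc.prems(2)
  let ?m = "perm_matching n w" let ?c = "2 * i + 1" let ?\<tau> = "\<lambda>a. Transposition.transpose a (2 * i + 1)"
  have i: "i < n" using Suc.prems by simp
  have m: "matching n ?m" using matching_perm[OF w] .
  interpret matching n ?m by (rule m)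
  have old: "(\<Sum>A | A \<subseteq> {..<i} \<and> card A = k. mono_action (squarefree_mono A) w) =
      of_bool (std_above n (Suc i) ?m \<and> ?m (2 * i + 2) = ?c \<and> excess_degree n ?m = k)"
    using Suc.IH[of w k] i w std_above_Suc[OF i m] by simp
  \<comment> \<open>Either pair i is standard, which is counted by the sets without i, or the
    partner of 2i+2 lies in the summation range of the factor for i and is counted by the sets
    containing i.\<close>
  have "?m (2 * i + 2) \<in> {1..<?c} \<or> ?m (2 * i + 2) = ?c" if s: "std_above n (Suc i) ?m"
  proof -
    have V: "2 * i + 2 \<in> vertices n" using i by simp
    have "?m (2 * i + 2) \<le> 2 * Suc i"
      by (rule comp_le[OF s V]) (auto intro: component.intros)
    moreover have "?m (2 * i + 2) \<noteq> 2 * i + 2" "?m (2 * i + 2) \<in> vertices n"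
      using m_simps[OF V] by simp_all
    ultimately show ?thesis by auto
  qed
  note range = this
  show ?case
  proof (cases k)
    \<comment> \<open>For k = 0 no set contains i, so a nonstandard pair i has to be excluded: it
      would force positive degree.\<close>
    case 0
    have "{A. A \<subseteq> {..<Suc i} \<and> card A = k} = {A. A \<subseteq> {..<i} \<and> card A = k}"
      using 0 finite_subset[OF _ finite_lessThan] by auto
    moreover have "?m (2 * i + 2) = ?c" if s: "std_above n (Suc i) ?m" "excess_degree n ?m = 0"
    proof (rule ccontr)
      assume "?m (2 * i + 2) \<noteq> ?c"
      then have a: "1 \<le> ?m (2 * i + 2)" "?m (2 * i + 2) < ?c" using range[OF s(1)] by auto
      then have "std_above n i (swap_conj (?m (2 * i + 2)) ?c ?m)"
        using std_above_swap_iff[OF i m a] s by simp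
      then show False using excess_degree_swap_std_above[OF i m a] s(2) by simp
    qed
    ultimately show ?thesis using old 0 by auto
  next
    case (Suc k')
    let ?\<A> = "{A. A \<subseteq> {..<i} \<and> card A = k'}"
    have split: "{A. A \<subseteq> {..<Suc i} \<and> card A = k} = {A. A \<subseteq> {..<i} \<and> card A = k} \<union> insert i ` ?\<A>"
    proof (intro equalityI subsetI)
      fix A assume A: "A \<in> {A. A \<subseteq> {..<Suc i} \<and> card A = k}"
      show "A \<in> {A. A \<subseteq> {..<i} \<and> card A = k} \<union> insert i ` ?\<A>"
      proof (cases "i \<in> A")
        case True
        have "finite A" using A finite_subset[OF _ finite_lessThan] by blast
        then have "A - {i} \<in> ?\<A>" using A True Suc by (auto simp: less_Suc_eq)
        moreover have "A = insert i (A - {i})" using True by auto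
        ultimately show ?thesis by blast
      next
        case False
        then show ?thesis using A by (auto simp: less_Suc_eq)
      qed
    next
      fix A assume "A \<in> {A. A \<subseteq> {..<i} \<and> card A = k} \<union> insert i ` ?\<A>"
      then show "A \<in> {A. A \<subseteq> {..<Suc i} \<and> card A = k}"
      proof
        assume "A \<in> insert i ` ?\<A>"
        then obtain A' where A': "A = insert i A'" "A' \<subseteq> {..<i}" "card A' = k'" by blast
        then have "finite A'" "i \<notin> A'" using finite_subset[OF _ finite_lessThan] by auto
        then show ?thesis using A' Suc by auto
      qed auto
    qed
    have inj: "inj_on (insert i) ?\<A>" by (rule inj_onI) (auto simp: insert_eq_iff subset_iff)
    have "(\<Sum>A\<in>insert i ` ?\<A>. mono_action (squarefree_mono A) w) =
        (\<Sum>A\<in>?\<A>. \<Sum>a\<in>{1..<?c}. mono_action (squarefree_mono A) (?\<tau> a \<circ> w))"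
      unfolding sum.reindex[OF inj] comp_def[of _ "insert i"]
    proof (rule sum.cong[OF refl])
      fix A assume "A \<in> ?\<A>"
      then have "finite A" "i \<notin> A" using finite_subset[OF _ finite_lessThan] by auto
      then have "squarefree_mono (insert i A) = squarefree_mono A + Poly_Mapping.single i 1"
        by (simp add: squarefree_mono_def add.commute)
      then show "mono_action (squarefree_mono (insert i A)) w = (\<Sum>a\<in>{1..<?c}. mono_action (squarefree_mono A) (?\<tau> a \<circ> w))"
        using mono_action_step[OF i w] by simp
    qed
    also have "\<dots> = (\<Sum>a\<in>{1..<?c}. \<Sum>A\<in>?\<A>. mono_action (squarefree_mono A) (?\<tau> a \<circ> w))"
      by (rule sum.swap)
    \<comment> \<open>At most one summand survives, the one in which a is the partner of
      2i+2.\<close>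
    also have "\<dots> = (\<Sum>a\<in>{1..<?c}. of_bool (?m (2 * i + 2) = a) * of_bool (std_above n (Suc i) ?m \<and> excess_degree n ?m = k))"
    proof (rule sum.cong[OF refl])
      fix a assume "a \<in> {1..<?c}"
      then have a: "1 \<le> a" "a < ?c" by auto
      have p: "?\<tau> a \<circ> w permutes vertices n"
        using a i by (intro permutes_compose[OF w] transpose_permutes_vertices) auto
      have "(\<Sum>A\<in>?\<A>. mono_action (squarefree_mono A) (?\<tau> a \<circ> w)) =
          of_bool (std_above n i (swap_conj a ?c ?m) \<and> excess_degree n (swap_conj a ?c ?m) = k')"
        using Suc.IH[OF less_imp_le[OF i] p, of k'] unfolding perm_matching_transpose[OF w] .
      also have "\<dots> = of_bool (?m (2 * i + 2) = a) * of_bool (std_above n (Suc i) ?m \<and> excess_degree n ?m = k)"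
        using std_above_swap_iff[OF i m a] excess_degree_swap_std_above[OF i m a] Suc by auto
      finally show "(\<Sum>A\<in>?\<A>. mono_action (squarefree_mono A) (?\<tau> a \<circ> w)) =
        of_bool (?m (2 * i + 2) = a) * of_bool (std_above n (Suc i) ?m \<and> excess_degree n ?m = k)" .
    qed
    also have "\<dots> = of_bool (?m (2 * i + 2) \<in> {1..<?c} \<and> std_above n (Suc i) ?m \<and> excess_degree n ?m = k)"
      by (subst sum_of_bool_eq) (simp_all only: finite_atLeastLessThan of_bool_conj)
    finally have new: "(\<Sum>A\<in>insert i ` ?\<A>. mono_action (squarefree_mono A) w) =
      of_bool (?m (2 * i + 2) \<in> {1..<?c} \<and> std_above n (Suc i) ?m \<and> excess_degree n ?m = k)" .
    have fin: "finite {A. A \<subseteq> {..<i} \<and> card A = k}" "finite (insert i ` ?\<A>)" by simp_all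
    have dis: "{A. A \<subseteq> {..<i} \<and> card A = k} \<inter> insert i ` ?\<A> = {}" by auto
    show ?thesis
      unfolding split sum.union_disjoint[OF fin dis] old new using range by auto
  qed
qed

end

subsection \<open>Leading terms of monomials\<close>

lemma std_above_mono: "std_above n i m \<Longrightarrow> i \<le> j \<Longrightarrow> std_above n j m"
  by (auto simp: std_above_def)

text \<open>A merge only enlarges components, and a vertex has its standard partner just when its
  component has two elements. The merged component is larger than that.\<close>

lemma merge_nontrivial:
  assumes "matching n m" "a \<in> vertices n" "c \<in> vertices n" "a \<noteq> c"
    and conn: "c \<notin> component (std_involution n) m a"
  shows "x \<in> vertices n \<Longrightarrow> m x \<noteq> std_involution n x \<Longrightarrow> swap_conj a c m x \<noteq> std_involution n x"
    and "swap_conj a c m c \<noteq> std_involution n c"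
proof -
  interpret P: matching n m by fact
  interpret Q: matching n "swap_conj a c m" using matching_swap(2)[OF assms(1-4)] .
  interpret S: involution_pair_swap "vertices n" "std_involution n" m a c using matching_swap(1)[OF assms(1-4)] .
  note eqs = matching_swap(3)[OF assms(1-4)]
  have sub: "P.comp_of x \<subseteq> Q.comp_of x" if "x \<in> vertices n" for x
  proof (cases "x \<in> P.comp_of a \<union> P.comp_of c")
    case True
    then have "Q.comp_of x = P.comp_of a \<union> P.comp_of c" using S.comp_merged(1)[OF conn True] eqs by simp
    moreover have "P.comp_of x = P.comp_of a \<or> P.comp_of x = P.comp_of c"
      using True P.comp_eq[OF assms(2), of x] P.comp_eq[OF assms(3), of x] by auto
    ultimately show ?thesis by auto
  next
    case False
    then show ?thesis using S.comp_merged(2)[OF conn that] eqs by simp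
  qed
  show "swap_conj a c m x \<noteq> std_involution n x" if x: "x \<in> vertices n" "m x \<noteq> std_involution n x"
  proof
    assume "swap_conj a c m x = std_involution n x"
    then have "Q.comp_of x = {x, std_involution n x}" by (rule Q.comp_trivial[OF x(1)])
    moreover have "m x \<in> P.comp_of x" by (intro component.intros)
    ultimately show False using sub[OF x(1)] x(2) P.m_simps(2)[OF x(1)] by auto
  qed
  show "swap_conj a c m c \<noteq> std_involution n c"
  proof
    assume "swap_conj a c m c = std_involution n c"
    then have "Q.comp_of c = {c, std_involution n c}" by (rule Q.comp_trivial[OF assms(3)])
    moreover have "Q.comp_of c = P.comp_of a \<union> P.comp_of c"
      using S.comp_merged(1)[OF conn, of c] component.base[of c "std_involution n" m] eqs by simp
    ultimately have "a = std_involution n c"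
      using component.base[of a "std_involution n" m] assms(4) by auto
    then have "a \<in> P.comp_of c" using component.fst[OF component.base[of c "std_involution n" m]] by simp
    then show False using P.comp_sym[OF assms(3)] conn by simp
  qed
qed

lemma excess_eq_lookup:
  assumes "keys \<gamma> \<subseteq> {..<n}" "excess n m = lookup \<gamma>"
  shows "excess_degree n m = mono_degree \<gamma>" "excess_length n m = card (keys \<gamma>)"
proof -
  show "excess_degree n m = mono_degree \<gamma>"
    using assms by (simp add: excess_degree_def mono_degree_eq[of "{..<n}"])
  have "{i. excess n m i \<noteq> 0} = keys \<gamma>" unfolding assms(2) by (auto simp: in_keys_iff)
  then show "excess_length n m = card (keys \<gamma>)" by (simp add: excess_length_def)
qed

text \<open>In \<open>mono_action_leading\<close> the choice of the largest variable matters: all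
  pairs beyond i are then standard and 2i+2 is the top of its component, as
  \<open>excess_merge\<close> requires.\<close>

lemma mono_split_max:
  assumes "\<gamma> \<noteq> (0 :: mono)"
  obtains \<delta> i where "\<gamma> = \<delta> + Poly_Mapping.single i 1" "keys \<delta> \<subseteq> {..<Suc i}" "i \<in> keys \<gamma>"
proof -
  define i where "i = Max (keys \<gamma>)"
  have i: "i \<in> keys \<gamma>" unfolding i_def using assms by (intro Max_in) auto
  have "\<gamma> = (\<gamma> - Poly_Mapping.single i 1) + Poly_Mapping.single i 1"
    using i by (intro poly_mapping_eqI) (auto simp: lookup_add lookup_minus lookup_single when_def in_keys_iff)
  moreover have "keys (\<gamma> - Poly_Mapping.single i 1) \<subseteq> keys \<gamma>"
    by (auto simp: in_keys_iff lookup_minus)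
  then have "keys (\<gamma> - Poly_Mapping.single i 1) \<subseteq> {..<Suc i}"
    unfolding i_def by (auto simp: less_Suc_eq_le)
  ultimately show thesis using that i by blast
qed

context odd_jucys_murphy
begin

text \<open>Each factor of the monomial merges at most two components. In the top degree all factors merge,
  and a merge with a nontrivial second component lowers the number of nontrivial components.\<close>

lemma mono_action_leading:
  assumes "keys \<gamma> \<subseteq> {..<n}" "w permutes vertices n"
  defines "m \<equiv> perm_matching n w"
  shows "(\<forall>i. keys \<gamma> \<subseteq> {..<i} \<longrightarrow> mono_action \<gamma> w \<noteq> 0 \<longrightarrow> std_above n i m) \<and>
    (mono_action \<gamma> w \<noteq> 0 \<longrightarrow> excess_degree n m \<le> mono_degree \<gamma>) \<and>
    (mono_action \<gamma> w \<noteq> 0 \<longrightarrow> excess_degree n m = mono_degree \<gamma> \<longrightarrow>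
      (\<forall>i\<in>keys \<gamma>. m (2 * i + 1) \<noteq> std_involution n (2 * i + 1))) \<and>
    (excess_degree n m = mono_degree \<gamma> \<longrightarrow> card (keys \<gamma>) \<le> excess_length n m \<longrightarrow>
      mono_action \<gamma> w = of_bool (excess n m = lookup \<gamma>))"
  using assms(1,2) unfolding m_def
proof (induction "mono_degree \<gamma>" arbitrary: \<gamma> w)
  case 0
  note w = 0(3)
  let ?m = "perm_matching n w"
  have M: "matching n ?m" using matching_perm[OF w] .
  have \<gamma>: "\<gamma> = 0"
    using 0(1) by (intro poly_mapping_eqI) (use lookup_le_mono_degree[of \<gamma>] in auto)
  have v: "mono_action 0 w = of_bool (std_above n 0 ?m)"
    by (simp add: mono_action_zero B_sum_def std_above_0_iff[OF w])
  have "std_above n 0 ?m \<longleftrightarrow> (\<forall>i. excess n ?m i = 0)"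
    using matching.std_above_if_excess[OF M] excess_zero_if_std_above_0[OF M] by auto
  moreover have "(\<forall>i. excess n ?m i = 0) \<longleftrightarrow> (\<forall>i\<in>{..<n}. excess n ?m i = 0)"
    using matching.excess_ge[OF M] by (meson lessThan_iff not_le)
  ultimately have "std_above n 0 ?m \<longleftrightarrow> excess_degree n ?m = 0" "std_above n 0 ?m \<longleftrightarrow> excess n ?m = lookup 0"
    by (simp_all add: excess_degree_def fun_eq_iff)
  then show ?case using std_above_mono[of n 0 ?m] unfolding \<gamma> v by auto
next
  case (Suc d)
  note w = Suc.prems(2)
  let ?m = "perm_matching n w" let ?t = "std_involution n"
  have "\<gamma> \<noteq> 0" using Suc.hyps(2) by auto
  then obtain \<delta> i where \<gamma>: "\<gamma> = \<delta> + Poly_Mapping.single i 1" "keys \<delta> \<subseteq> {..<Suc i}" "i \<in> keys \<gamma>"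
    by (rule mono_split_max)
  have i: "i < n" using \<gamma>(3) Suc.prems(1) by auto
  have k\<gamma>: "keys \<gamma> = insert i (keys \<delta>)" unfolding \<gamma>(1) keys_add_nat by auto
  have k\<delta>: "keys \<delta> \<subseteq> {..<n}" using Suc.prems(1) k\<gamma> by auto
  have deg: "mono_degree \<gamma> = mono_degree \<delta> + 1" unfolding \<gamma>(1) mono_degree_add by simp
  have lk: "lookup \<gamma> = (lookup \<delta>)(i := lookup \<delta> i + 1)"
    unfolding \<gamma>(1) by (auto simp: fun_eq_iff lookup_add lookup_single when_def)
  let ?c = "2 * i + 1" let ?u = "\<lambda>a. Transposition.transpose a (2 * i + 1) \<circ> w"
  let ?mu = "\<lambda>a. swap_conj a (2 * i + 1) (perm_matching n w)"
  have M: "matching n ?m" using matching_perm[OF w] .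
  interpret P: matching n ?m by (rule M)
  have cV: "?c \<in> vertices n" using i by simp
  have sum: "mono_action \<gamma> w = (\<Sum>a\<in>{1..<?c}. mono_action \<delta> (?u a))"
    unfolding \<gamma>(1) by (rule mono_action_step[OF i w])
  have pu: "?u a permutes vertices n" and Mu: "matching n (?mu a)" and aV: "a \<in> vertices n" "a \<noteq> ?c"
    if "a \<in> {1..<?c}" for a
    using that i by (auto intro!: permutes_compose[OF w] transpose_permutes_vertices matching_swap(2)[OF M])
  have IH: "\<forall>j. keys \<delta> \<subseteq> {..<j} \<longrightarrow> mono_action \<delta> (?u a) \<noteq> 0 \<longrightarrow> std_above n j (?mu a)"
    "mono_action \<delta> (?u a) \<noteq> 0 \<longrightarrow> excess_degree n (?mu a) \<le> mono_degree \<delta>"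
    "mono_action \<delta> (?u a) \<noteq> 0 \<longrightarrow> excess_degree n (?mu a) = mono_degree \<delta> \<longrightarrow>
      (\<forall>j\<in>keys \<delta>. ?mu a (2 * j + 1) \<noteq> ?t (2 * j + 1))"
    "excess_degree n (?mu a) = mono_degree \<delta> \<longrightarrow> card (keys \<delta>) \<le> excess_length n (?mu a) \<longrightarrow>
      mono_action \<delta> (?u a) = of_bool (excess n (?mu a) = lookup \<delta>)"
    if "a \<in> {1..<?c}" for a
    using Suc.hyps(1)[OF _ k\<delta> pu[OF that]] deg Suc.hyps(2)
    unfolding perm_matching_transpose[OF w] by simp_all
  \<comment> \<open>Undoing the swap raises the degree by at most one. In top degree a nonzero
    summand thus comes from a matching of top degree for \<open>\<delta>\<close>, by a genuine
    merge.\<close>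
  have nz: "std_above n (Suc i) (?mu a) \<and> std_above n (Suc i) ?m \<and> excess_degree n ?m \<le> mono_degree \<gamma> \<and>
      (excess_degree n ?m = mono_degree \<gamma> \<longrightarrow> excess_degree n (?mu a) = mono_degree \<delta> \<and> ?c \<notin> component ?t (?mu a) a)"
    if a: "a \<in> {1..<?c}" "mono_action \<delta> (?u a) \<noteq> 0" for a
  proof -
    have s: "std_above n (Suc i) (?mu a)" using IH(1)[OF a(1)] a(2) \<gamma>(2) by blast
    have "std_above n (Suc i) (?mu a) \<longleftrightarrow> std_above n (Suc i) ?m" using a(1) by (intro std_above_swap) auto
    then have s': "std_above n (Suc i) ?m" using s by blast
    have "excess_degree n (?mu a) \<le> mono_degree \<delta>" using IH(2)[OF a(1)] a(2) by blast
    then show ?thesis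
      using excess_degree_swap[OF Mu[OF a(1)] aV(1)[OF a(1)] cV aV(2)[OF a(1)]] s s' deg
      unfolding swap_conj_swap_conj by linarith
  qed
  show ?case
  proof (intro conjI allI impI ballI)
    fix j assume "keys \<gamma> \<subseteq> {..<j}" "mono_action \<gamma> w \<noteq> 0"
    then obtain a where "a \<in> {1..<?c}" "mono_action \<delta> (?u a) \<noteq> 0"
      unfolding sum by (meson sum.neutral)
    then have "std_above n (Suc i) ?m" using nz by blast
    moreover have "Suc i \<le> j" using \<open>keys \<gamma> \<subseteq> {..<j}\<close> \<gamma>(3) by auto
    ultimately show "std_above n j ?m" by (rule std_above_mono)
  next
    assume "mono_action \<gamma> w \<noteq> 0"
    then obtain a where "a \<in> {1..<?c}" "mono_action \<delta> (?u a) \<noteq> 0"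
      unfolding sum by (meson sum.neutral)
    then show "excess_degree n ?m \<le> mono_degree \<gamma>" using nz by blast
  next
    fix j assume "mono_action \<gamma> w \<noteq> 0" and d: "excess_degree n ?m = mono_degree \<gamma>" and j: "j \<in> keys \<gamma>"
    then obtain a where a: "a \<in> {1..<?c}" "mono_action \<delta> (?u a) \<noteq> 0"
      unfolding sum by (meson sum.neutral)
    then have du: "excess_degree n (?mu a) = mono_degree \<delta>" and conn: "?c \<notin> component ?t (?mu a) a"
      using nz d by blast+
    note mn = merge_nontrivial[OF Mu[OF a(1)] aV(1)[OF a(1)] cV aV(2)[OF a(1)] conn, unfolded swap_conj_swap_conj]
    show "?m (2 * j + 1) \<noteq> ?t (2 * j + 1)"
    proof (cases "j = i")
      case True
      then show ?thesis using mn(2) by simp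
    next
      case False
      then have jk: "j \<in> keys \<delta>" using j k\<gamma> by blast
      then have "2 * j + 1 \<in> vertices n" using k\<delta> by auto
      moreover have "?mu a (2 * j + 1) \<noteq> ?t (2 * j + 1)" using IH(3)[OF a(1)] a(2) du jk by blast
      ultimately show ?thesis by (rule mn(1))
    qed
  next
    assume d: "excess_degree n ?m = mono_degree \<gamma>" and l: "card (keys \<gamma>) \<le> excess_length n ?m"
    \<comment> \<open>In a surviving summand a has the trivial component {a, t a} before the merge.
      Afterwards the partner of 2i+1 is t a, which determines a.\<close>
    define a0 where "a0 = ?t (?m ?c)"
    have only: "a = a0 \<and> excess n ?m = lookup \<gamma>" if a: "a \<in> {1..<?c}" "mono_action \<delta> (?u a) \<noteq> 0" for a
    proof -
      interpret U: matching n "?mu a" using Mu[OF a(1)] .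
      have du: "excess_degree n (?mu a) = mono_degree \<delta>" and conn: "?c \<notin> U.comp_of a"
        and s: "std_above n (Suc i) (?mu a)"
        using nz[OF a] d by blast+
      have a1: "1 \<le> a" "a < ?c" using a(1) by auto
      obtain j where j: "j < i" "excess n (?mu a) j = 0 \<longleftrightarrow> ?mu a a = ?t a"
        "excess n ?m = (excess n (?mu a))(j := 0, i := excess n (?mu a) i + excess n (?mu a) j + 1)"
        using excess_merge[OF Mu[OF a(1)] i a1 s conn] unfolding swap_conj_swap_conj .
      \<comment> \<open>If \<open>\<delta>\<close> contains the variable i, the third part of the
        induction hypothesis keeps pair i nonstandard; otherwise \<open>\<delta>\<close> lives below
        i and the first part makes this pair standard.\<close>
      have ei: "excess n (?mu a) i = 0 \<longleftrightarrow> i \<notin> keys \<delta>"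
      proof -
        have "excess n (?mu a) i = 0 \<longleftrightarrow> ?mu a ?c = ?t ?c"
          using U.excess_pos_iff[OF U.top_if_std_above[OF i s]] std_involution_pair(1)[OF i] by simp
        moreover have "?mu a ?c \<noteq> ?t ?c" if "i \<in> keys \<delta>" using IH(3)[OF a(1)] a(2) du that by blast
        moreover have "?mu a ?c = ?t ?c" if "i \<notin> keys \<delta>"
        proof -
          have "keys \<delta> \<subseteq> {..<i}" using \<gamma>(2) that by (auto simp: subset_iff less_Suc_eq)
          then have "std_above n i (?mu a)" using IH(1)[OF a(1)] a(2) by blast
          then show ?thesis using cV unfolding std_above_def by auto
        qed
        ultimately show ?thesis by blast
      qed
      let ?E = "{k. excess n (?mu a) k \<noteq> 0}"
      have finE: "finite ?E" by (rule U.finite_excess)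
      have Em: "{k. excess n ?m k \<noteq> 0} = insert i (?E - {j})" using j(1) unfolding j(3) by auto
      \<comment> \<open>The merge loses the nontrivial component with top j, if it was one, and
        gains one with top i, if that was trivial before.\<close>
      have lm: "excess_length n ?m + of_bool (j \<in> ?E) = excess_length n (?mu a) + of_bool (i \<notin> keys \<delta>)"
      proof -
        have "card (insert i (?E - {j})) = card (?E - {j}) + of_bool (i \<notin> keys \<delta>)"
          using finE ei j(1) by (cases "i \<in> keys \<delta>") (simp_all add: card_insert_if)
        moreover have "card (?E - {j}) + of_bool (j \<in> ?E) = card ?E"
        proof (cases "j \<in> ?E")
          case True
          show ?thesis using card_Suc_Diff1[OF finE True] True by simp
        qed simp
        ultimately show ?thesis unfolding excess_length_def Em by simp
      qed
      have "card (keys \<gamma>) = card (keys \<delta>) + of_bool (i \<notin> keys \<delta>)" unfolding k\<gamma> by (simp add: card_insert_if)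
      then have lu: "card (keys \<delta>) + of_bool (j \<in> ?E) \<le> excess_length n (?mu a)" using l lm by linarith
      then have "mono_action \<delta> (?u a) = of_bool (excess n (?mu a) = lookup \<delta>)"
        using IH(4)[OF a(1)] du by simp
      then have eq: "excess n (?mu a) = lookup \<delta>" using a(2) by (auto split: if_splits simp: of_bool_def)
      then have "excess_length n (?mu a) = card (keys \<delta>)" using excess_eq_lookup(2)[OF k\<delta>] by blast
      \<comment> \<open>With a nonzero entry at j the merge would leave fewer nontrivial components
        than \<open>l\<close> demands.\<close>
      then have ej: "excess n (?mu a) j = 0" using lu by (auto simp: of_bool_def split: if_splits)
      then have "?mu a a = ?t a" using j(2) by blast
      then have tr: "Transposition.transpose a ?c (?m ?c) = ?t a" by simp
      have "?t a \<noteq> ?c" using conn component.fst[OF component.base[of a ?t "?mu a"]] by auto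
      moreover have "?t a \<noteq> a" using P.t_simps(2)[OF aV(1)[OF a(1)]] .
      ultimately have "?m ?c = ?t a" using tr by (auto simp: Transposition.transpose_def split: if_splits)
      then have "a = a0" by (simp add: a0_def std_involution_involution)
      moreover have "excess n ?m = lookup \<gamma>"
        unfolding j(3) lk using eq ej by (auto simp: fun_eq_iff)
      ultimately show ?thesis by blast
    qed
    show "mono_action \<gamma> w = of_bool (excess n ?m = lookup \<gamma>)"
    proof (cases "excess n ?m = lookup \<gamma>")
      case False
      then have "mono_action \<delta> (?u a) = 0" if "a \<in> {1..<?c}" for a using only[OF that] by blast
      then show ?thesis using False unfolding sum by (simp add: sum.neutral)
    next
      \<comment> \<open>Existence of the surviving summand: swapping with \<open>a0\<close> splits
        off the standard pair {a0, m (2i+1)}, and the matching that remains has the entries of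
        \<open>\<delta>\<close>.\<close>
      case True
      have above: "std_above n (Suc i) ?m"
      proof (rule P.std_above_if_excess)
        fix k assume "Suc i \<le> k"
        then have "k \<notin> keys \<gamma>" using k\<gamma> \<gamma>(2) by auto
        then show "excess n ?m k = 0" unfolding True by (simp add: in_keys_iff)
      qed
      have ei: "excess n ?m i \<noteq> 0" unfolding True lk by simp
      then have "i \<in> P.tops" using P.excess_not_tops[of i] by argo
      then have "?m ?c \<noteq> 2 * i + 2" using P.excess_pos_iff[of i] ei by argo
      moreover have "?m ?c \<noteq> ?c" by (rule P.m_simps(2)[OF cV])
      moreover have "?m ?c \<in> vertices n" by (rule P.m_simps(1)[OF cV])
      moreover have "?m ?c \<le> 2 * Suc i"
        by (rule P.comp_le[OF above cV]) (auto intro: component.intros)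
      ultimately have z: "1 \<le> ?m ?c" "?m ?c \<le> 2 * i" by auto
      have zV: "?m ?c \<in> vertices n" by fact
      have "a0 \<in> vertices n" unfolding a0_def by (rule P.t_simps(1)[OF zV])
      moreover have "a0 \<le> 2 * i" unfolding a0_def by (rule std_involution_le[OF z(2)])
      ultimately have a0: "a0 \<in> {1..<?c}" by simp
      then have a1: "1 \<le> a0" "a0 < ?c" by auto
      interpret U: matching n "?mu a0" using Mu[OF a0] .
      have ta0: "?t a0 = ?m ?c" by (simp add: a0_def std_involution_involution)
      have "?m ?c \<noteq> a0" unfolding a0_def using P.t_simps(2)[OF zV] by metis
      then have mu: "?mu a0 a0 = ?t a0" using ta0 \<open>?m ?c \<noteq> ?c\<close> by (auto simp: Transposition.transpose_def)
      have "U.comp_of a0 = {a0, ?t a0}" using U.comp_trivial[OF aV(1)[OF a0] mu] .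
      then have conn: "?c \<notin> U.comp_of a0" using aV(2)[OF a0] ta0 \<open>?m ?c \<noteq> ?c\<close> by auto
      have "std_above n (Suc i) (?mu a0) \<longleftrightarrow> std_above n (Suc i) ?m" using a1 by (intro std_above_swap) auto
      then have s: "std_above n (Suc i) (?mu a0)" using above by blast
      obtain j where j: "j < i" "excess n (?mu a0) j = 0 \<longleftrightarrow> ?mu a0 a0 = ?t a0"
        "excess n ?m = (excess n (?mu a0))(j := 0, i := excess n (?mu a0) i + excess n (?mu a0) j + 1)"
        using excess_merge[OF Mu[OF a0] i a1 s conn] unfolding swap_conj_swap_conj .
      have ej: "excess n (?mu a0) j = 0" using j(2) mu by blast
      have eq: "excess n (?mu a0) = lookup \<delta>"
      proof
        fix k
        have "((excess n (?mu a0))(j := 0, i := excess n (?mu a0) i + 1)) k = ((lookup \<delta>)(i := lookup \<delta> i + 1)) k"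
          using True j(3) lk ej by simp
        then show "excess n (?mu a0) k = lookup \<delta> k" using ej j(1) by (auto split: if_splits)
      qed
      then have "mono_action \<delta> (?u a0) = 1"
        using IH(4)[OF a0] excess_eq_lookup[OF k\<delta> eq] by simp
      moreover have "mono_action \<gamma> w = (\<Sum>a\<in>{a0}. mono_action \<delta> (?u a))"
        unfolding sum using a0 only by (intro sum.mono_neutral_right) auto
      ultimately show ?thesis using True by simp
    qed
  qed
qed

end

section \<open>The Hecke ring\<close>

lemma hyperoct_compose: "b \<in> hyperoct n \<Longrightarrow> b' \<in> hyperoct n \<Longrightarrow> b \<circ> b' \<in> hyperoct n"
  unfolding hyperoct_iff by (auto simp: permutes_compose fun_eq_iff)

lemma hyperoct_permutes: "b \<in> hyperoct n \<Longrightarrow> b permutes vertices n"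
  by (simp add: hyperoct_iff)

lemma hyperoct_inv: assumes "b \<in> hyperoct n" shows "inv' b \<in> hyperoct n"
proof -
  have b: "b permutes vertices n" "\<And>x. b (std_involution n x) = std_involution n (b x)"
    using assms unfolding hyperoct_iff by (blast, metis comp_apply)
  have "inv' b (std_involution n x) = std_involution n (inv' b x)" for x
    using b(2)[of "inv' b x"] permutes_inverses[OF b(1)] by metis
  then show ?thesis using permutes_inv[OF b(1)] by (auto simp: hyperoct_iff)
qed

lemma id_in_hyperoct: "id \<in> hyperoct n"
  by (simp add: hyperoct_iff permutes_id)

lemma hyperoct_compose_right_iff:
  assumes "b \<in> hyperoct n" shows "v \<circ> b \<in> hyperoct n \<longleftrightarrow> v \<in> hyperoct n"
proof
  assume "v \<circ> b \<in> hyperoct n"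
  then have "v \<circ> b \<circ> inv' b \<in> hyperoct n" using hyperoct_inv[OF assms] by (rule hyperoct_compose)
  then show "v \<in> hyperoct n" using permutes_inv_o(1)[OF hyperoct_permutes[OF assms]] by (simp add: comp_assoc)
qed (rule hyperoct_compose[OF _ assms])

lemma hyperoct_compose_left_iff:
  assumes "b \<in> hyperoct n" shows "b \<circ> v \<in> hyperoct n \<longleftrightarrow> v \<in> hyperoct n"
proof
  assume "b \<circ> v \<in> hyperoct n"
  then have "inv' b \<circ> (b \<circ> v) \<in> hyperoct n" 
    by (rule hyperoct_compose[OF hyperoct_inv[OF assms]])
  then show "v \<in> hyperoct n"
    using permutes_inv_o(2)[OF hyperoct_permutes[OF assms]] by (simp add: comp_assoc[symmetric])
qed (rule hyperoct_compose[OF assms])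

text \<open>Conjugation by b carries the matching of w to that of b w and commutes with the standard
  involution, so the components correspond. This is the left invariance of the values of the
  e_k.\<close>

lemma excess_degree_hyperoct:
  assumes b: "b \<in> hyperoct n" and w: "w permutes vertices n"
  shows "excess_degree n (perm_matching n (b \<circ> w)) = excess_degree n (perm_matching n w)"
proof -
  have bp: "b permutes vertices n" and bt: "\<And>x. b (std_involution n x) = std_involution n (b x)"
    using b unfolding hyperoct_iff by (blast, metis comp_apply)
  have bw: "b \<circ> w permutes vertices n" using w bp by (rule permutes_compose)
  interpret P: matching n "perm_matching n w" using matching_perm[OF w] .
  interpret Q: matching n "perm_matching n (b \<circ> w)" using matching_perm[OF bw] .
  have "inv' (b \<circ> w) = inv' w \<circ> inv' b"
    using o_inv_distrib[OF permutes_bij[OF bp] permutes_bij[OF w]] .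
  then have "b (perm_matching n w y) = perm_matching n (b \<circ> w) (b y)" for y
    by (simp add: perm_matching_def permutes_inverses[OF bp])
  then have "card P.comps = card Q.comps"
    unfolding P.comps_def Q.comps_def using bt by (intro card_comps_conjugate[OF bp])
  then show ?thesis using P.excess_degree_add_card_comps Q.excess_degree_add_card_comps by simp
qed

lemma hecke_ring_simps:
  "f \<in> carrier (hecke_ring n) \<longleftrightarrow> (\<forall>w. f w \<in> \<int>) \<and> (\<forall>w. \<not> w permutes vertices n \<longrightarrow> f w = 0) \<and>
    (\<forall>w k k'. w permutes vertices n \<longrightarrow> k \<in> hyperoct n \<longrightarrow> k' \<in> hyperoct n \<longrightarrow> f (k \<circ> w \<circ> k') = f w)"
  "f \<oplus>\<^bsub>hecke_ring n\<^esub> g = (\<lambda>w. f w + g w)"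
  "\<zero>\<^bsub>hecke_ring n\<^esub> = (\<lambda>w. 0)"
  "\<one>\<^bsub>hecke_ring n\<^esub> = (\<lambda>w. of_bool (w \<in> hyperoct n))"
  unfolding hecke_ring_def by (auto simp: carrier_iff_vertices)

lemma hecke_double_coset:
  assumes "f \<in> carrier (hecke_ring n)" "w permutes vertices n" "v permutes vertices n" "bij \<pi>"
    "excess n (perm_matching n w) \<circ> \<pi> = excess n (perm_matching n v)"
  shows "f w = f v"
proof -
  obtain k k' where "k \<in> hyperoct n" "k' \<in> hyperoct n" "v = k \<circ> w \<circ> k'"
    using excess_rearrangement_double_coset[OF assms(2-5)] .
  then show ?thesis using assms(1,2) unfolding hecke_ring_simps by metis
qed

text \<open>The entries of the matching of w read as an exponent: the monomial in whose leading part
  this matching occurs.\<close>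

definition excess_mono :: "nat \<Rightarrow> (nat \<Rightarrow> nat) \<Rightarrow> mono" where
  "excess_mono n w = Abs_poly_mapping (excess n (perm_matching n w))"

lemma lookup_excess_mono:
  assumes "w permutes vertices n" shows "lookup (excess_mono n w) = excess n (perm_matching n w)"
  unfolding excess_mono_def using matching.finite_excess[OF matching_perm[OF assms]]
  by (simp add: Abs_poly_mapping_inverse)

lemma keys_excess_mono:
  assumes "w permutes vertices n" shows "keys (excess_mono n w) \<subseteq> {..<n}"
  using matching.excess_support[OF matching_perm[OF assms]] lookup_excess_mono[OF assms]
  by (auto simp: in_keys_iff subset_iff)

lemma card_keys_map_key: "bij \<pi> \<Longrightarrow> card (keys (map_key \<pi> m)) = card (keys m)"
  by (simp add: keys_map_key bij_is_inj card_vimage_inj bij_is_surj)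

section \<open>Invariance and integrality of the values\<close>

context odd_jucys_murphy
begin

lemma mult_B_sum_right_invariant:
  assumes "w permutes vertices n" "b \<in> hyperoct n"
  shows "(x \<star> B_sum) (w \<circ> b) = (x \<star> B_sum) w"
proof -
  have "w \<circ> b permutes vertices n" using hyperoct_permutes[OF assms(2)] assms(1) by (rule permutes_compose)
  then show ?thesis
    using assms by (simp add: sym_algebra_mult_eq B_sum_def comp_assoc[symmetric] hyperoct_compose_right_iff)
qed

definition left_invariant :: "((nat \<Rightarrow> nat) \<Rightarrow> rat) \<Rightarrow> bool" where
  "left_invariant h \<longleftrightarrow> (\<forall>b\<in>hyperoct n. \<forall>w. w permutes vertices n \<longrightarrow> h (b \<circ> w) = h w)"

text \<open>Translation by b is absorbed by reindexing the sum over the left factor.\<close>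

lemma left_invariant_mult:
  assumes "left_invariant h" shows "left_invariant (h \<star> y)"
  unfolding left_invariant_def
proof (intro ballI allI impI)
  fix b w assume b: "b \<in> hyperoct n" and w: "w permutes vertices n"
  have bp: "b permutes vertices n" by (rule hyperoct_permutes[OF b])
  have bw: "b \<circ> w permutes vertices n" using w bp by (rule permutes_compose)
  have "(h \<star> y) (b \<circ> w) = (\<Sum>u\<in>carrier (sym_group (2 * n)). h u * y (inv' u \<circ> (b \<circ> w)))"
    by (rule sym_algebra_mult_eq[OF bw])
  also have "\<dots> = (\<Sum>u\<in>carrier (sym_group (2 * n)). h u * y (inv' u \<circ> w))"
  proof (rule sum.reindex_bij_witness[of _ "\<lambda>u. b \<circ> u" "\<lambda>u. inv' b \<circ> u"])
    fix u assume "u \<in> carrier (sym_group (2 * n))"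
    then have u: "u permutes vertices n" by (simp add: carrier_iff_vertices)
    show "b \<circ> (inv' b \<circ> u) = u" "inv' b \<circ> (b \<circ> u) = u"
      using permutes_inv_o[OF bp] by (simp_all add: comp_assoc[symmetric])
    have ibu: "inv' b \<circ> u permutes vertices n" using u permutes_inv[OF bp] by (rule permutes_compose)
    then show "inv' b \<circ> u \<in> carrier (sym_group (2 * n))" by (simp add: carrier_iff_vertices)
    show "b \<circ> u \<in> carrier (sym_group (2 * n))"
      unfolding carrier_iff_vertices using u bp by (rule permutes_compose)
    have "h (inv' b \<circ> u) = h u"
      using assms hyperoct_inv[OF b] u unfolding left_invariant_def by blast
    moreover have "inv' (inv' b \<circ> u) \<circ> w = inv' u \<circ> (b \<circ> w)"
      using o_inv_distrib[OF permutes_bij[OF permutes_inv[OF bp]] permutes_bij[OF u]]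
      by (simp add: comp_assoc permutes_inv_inv[OF bp])
    ultimately show "h (inv' b \<circ> u) * y (inv' (inv' b \<circ> u) \<circ> w) = h u * y (inv' u \<circ> (b \<circ> w))"
      by simp
  qed
  also have "\<dots> = (h \<star> y) w" by (rule sym_algebra_mult_eq[OF w, symmetric])
  finally show "(h \<star> y) (b \<circ> w) = (h \<star> y) w" .
qed

abbreviation card_B :: rat where "card_B \<equiv> of_nat (card (hyperoct n))"

lemma card_B_nonzero: "card_B \<noteq> 0"
  using card_hyperoct_pos[of n] by simp

text \<open>Used to insert the subgroup sum between two factors, at the cost of the group
  order.\<close>

lemma B_sum_mult_left_invariant:
  assumes "left_invariant h" "h \<in> carrier (sym_algebra n)"
  shows "B_sum \<star> h = (\<lambda>w. card_B * h w)"
proof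
  fix w
  show "(B_sum \<star> h) w = card_B * h w"
  proof (cases "w permutes vertices n")
    case True
    have "(B_sum \<star> h) w = (\<Sum>u\<in>hyperoct n. h (inv' u \<circ> w))"
      unfolding sym_algebra_mult_eq[OF True] B_sum_def
      using finite_carrier by (intro sum.mono_neutral_cong_right) (auto simp: hyperoct_def)
    also have "\<dots> = (\<Sum>u\<in>hyperoct n. h w)"
      using assms(1) hyperoct_inv True unfolding left_invariant_def by (intro sum.cong) blast+
    finally show ?thesis by simp
  next
    case False
    then show ?thesis
      using assms(2) mult_outside[of w B_sum h] by (simp add: group_algebra_simps carrier_iff_vertices)
  qed
qed

lemma mult_scale_right: "h \<star> (\<lambda>w. c * f w) = (\<lambda>w. c * (h \<star> f) w)"
  using mult_sum_right[of h "\<lambda>_. c" "\<lambda>_. f" "{()}"] by (simp add: fun_eq_iff)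

lemma mult_scale_left: "(\<lambda>w. c * f w) \<star> h = (\<lambda>w. c * (f \<star> h) w)"
  using mult_sum_left[of "\<lambda>_. c" "\<lambda>_. f" "{()}" h] by (simp add: fun_eq_iff)

lemma jm_eval_eq: "jm_eval n F = (\<lambda>w. 1 / card_B * (sev F \<star> B_sum) w)"
proof -
  have "hyperoct_idem n = (\<lambda>w. 1 / card_B * B_sum w)"
    by (simp add: hyperoct_idem_def B_sum_def)
  moreover have "odd_jucys_murphy_elem = (\<lambda>i. jucys_murphy (2 * i + 1))"
    by (rule ext) (rule odd_jucys_murphy_elem_def)
  ultimately show ?thesis unfolding jm_eval_def by (simp only: mult_scale_right)
qed

lemma jm_eval_eq_embed: "jm_eval n F = hecke_embed n (sev F \<star> B_sum)"
  by (simp add: jm_eval_eq hecke_embed_def)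

lemma elem_sym_eval:
  assumes "w permutes vertices n"
  shows "(sev (elem_sym k) \<star> B_sum) w = of_bool (excess_degree n (perm_matching n w) = k)"
proof -
  have set: "{\<gamma>. keys \<gamma> \<subseteq> {..<n} \<and> elem_sym k \<gamma> \<noteq> 0} = squarefree_mono ` {A. A \<subseteq> {..<n} \<and> card A = k}"
    using finite_subset[OF _ finite_lessThan[of n]]
    by (auto simp: elem_sym_eq keys_squarefree_mono) 
  have inj: "inj_on squarefree_mono {A. A \<subseteq> {..<n} \<and> card A = k}"
    using keys_squarefree_mono finite_subset[OF _ finite_lessThan[of n]] by (intro inj_onI) (metis mem_Collect_eq)
  have "(sev (elem_sym k) \<star> B_sum) w =
      (\<Sum>\<gamma>\<in>squarefree_mono ` {A. A \<subseteq> {..<n} \<and> card A = k}. mono_action \<gamma> w)"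
    unfolding sev_mult_B_sum set
  proof (rule sum.cong[OF refl])
    fix \<gamma> assume "\<gamma> \<in> squarefree_mono ` {A. A \<subseteq> {..<n} \<and> card A = k}"
    then have "elem_sym k \<gamma> = 1" unfolding set[symmetric] by (auto simp: elem_sym_eq of_bool_def split: if_splits)
    then show "of_int (elem_sym k \<gamma>) * mono_action \<gamma> w = mono_action \<gamma> w" by simp
  qed
  also have "\<dots> = of_bool (excess_degree n (perm_matching n w) = k)"
    unfolding sum.reindex[OF inj] comp_def using sum_squarefree_mono_action[of n w k] assms std_above_n by simp
  finally show ?thesis .
qed

lemma sev_one_mult_B_sum: "sev mono_one \<star> B_sum = B_sum"
  unfolding sev_one by (rule one_mult[OF B_sum_closed])

lemma sev_B_sum_left_invariant:
  assumes "F \<in> carrier sym_fun_ring" shows "left_invariant (sev F \<star> B_sum)"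
proof -
  have "left_invariant (sev (restrict_vars n F) \<star> B_sum)"
    using assms
  proof (induction rule: symmetric_function_induct)
    case one
    then show ?case
      unfolding sev_one_mult_B_sum by (simp add: left_invariant_def B_sum_def hyperoct_compose_left_iff)
  next
    case (elem_sym k)
    show ?case unfolding sev_restrict left_invariant_def
    proof (intro ballI allI impI)
      fix b w assume b: "b \<in> hyperoct n" and w: "w permutes vertices n"
      have "b \<circ> w permutes vertices n" using w hyperoct_permutes[OF b] by (rule permutes_compose)
      then show "(sev (elem_sym k) \<star> B_sum) (b \<circ> w) = (sev (elem_sym k) \<star> B_sum) w"
        using elem_sym_eval w excess_degree_hyperoct[OF b w] by simp
    qed
  next
    case (neg F)
    then show ?case using mult_scale_left[of "- 1" "sev F" B_sum]
      by (simp add: sev_uminus left_invariant_def)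
  next
    case (add F G)
    then show ?case by (simp add: sev_add mult_add_left left_invariant_def)
  next
    case (mult F G)
    \<comment> \<open>As the value of G is left invariant, \<open>B_sum\<close> may be inserted in
      front of it. The product then begins with the value of F, whose left invariance is the other
      induction hypothesis.\<close>
    have G: "sev G \<star> B_sum = (\<lambda>w. 1 / card_B * (B_sum \<star> (sev G \<star> B_sum)) w)"
      using B_sum_mult_left_invariant[OF mult.IH(2) mult_closed] card_B_nonzero by simp
    have "sev (conv F G) \<star> B_sum = sev F \<star> (sev G \<star> B_sum)"
      using mult by (simp add: sev_conv mult_assoc)
    also have "\<dots> = (\<lambda>w. 1 / card_B * (sev F \<star> (B_sum \<star> (sev G \<star> B_sum))) w)"
      by (subst G) (rule mult_scale_right)
    also have "\<dots> = (\<lambda>w. 1 / card_B * ((sev F \<star> B_sum) \<star> (sev G \<star> B_sum)) w)"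
      by (simp only: mult_assoc)
    finally show ?case
      using left_invariant_mult[OF mult.IH(1), of "sev G \<star> B_sum"] by (simp add: left_invariant_def)
  qed
  then show ?thesis by (simp add: sev_restrict)
qed

lemma mono_action_int: "keys \<gamma> \<subseteq> {..<n} \<Longrightarrow> w permutes vertices n \<Longrightarrow> mono_action \<gamma> w \<in> \<int>"
proof (induction "mono_degree \<gamma>" arbitrary: \<gamma> w rule: less_induct)
  case less
  show ?case
  proof (cases "\<gamma> = 0")
    case True
    then show ?thesis by (simp add: mono_action_zero B_sum_def)
  next
    case False
    then obtain \<delta> i where \<gamma>: "\<gamma> = \<delta> + Poly_Mapping.single i 1" "i \<in> keys \<gamma>" by (rule mono_split_max)
    have k: "keys \<delta> \<subseteq> {..<n}" "i < n" using less.prems(1) \<gamma> keys_add_nat[of \<delta>] by auto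
    have d: "mono_degree \<delta> < mono_degree \<gamma>"
      unfolding \<gamma>(1) mono_degree_add by simp
    have "mono_action \<delta> (Transposition.transpose a (2 * i + 1) \<circ> w) \<in> \<int>" if "a \<in> {1..<2 * i + 1}" for a
      using that k less.prems(2)
      by (intro less.hyps[OF d k(1)] permutes_compose[OF less.prems(2)] transpose_permutes_vertices) auto
    then show ?thesis
      unfolding \<gamma>(1) mono_action_step[OF k(2) less.prems(2)] by (rule Ints_sum)
  qed
qed

lemma sev_B_sum_in_hecke:
  assumes "F \<in> carrier sym_fun_ring" shows "sev F \<star> B_sum \<in> carrier (hecke_ring n)"
  unfolding hecke_ring_simps
proof (intro conjI allI impI)
  fix w
  have out: "(sev F \<star> B_sum) w = 0" if "\<not> w permutes vertices n"
    using mult_outside[of w] that by (simp add: carrier_iff_vertices)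
  show "(sev F \<star> B_sum) w \<in> \<int>"
  proof (cases "w permutes vertices n")
    case True
    show ?thesis unfolding sev_mult_B_sum
      using mono_action_int[OF _ True] by (intro Ints_sum Ints_mult) auto
  qed (simp add: out)
  show "(sev F \<star> B_sum) w = 0" if "\<not> w permutes vertices n" by (rule out[OF that])
next
  fix w k k' assume w: "w permutes vertices n" and k: "k \<in> hyperoct n" "k' \<in> hyperoct n"
  have "k \<circ> w permutes vertices n" using w hyperoct_permutes[OF k(1)] by (rule permutes_compose)
  then show "(sev F \<star> B_sum) (k \<circ> w \<circ> k') = (sev F \<star> B_sum) w"
    using mult_B_sum_right_invariant[OF _ k(2)] sev_B_sum_left_invariant[OF assms] k w
    unfolding left_invariant_def by metis
qed

section \<open>The homomorphism into the Hecke ring\<close>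

lemma jm_eval_in_image:
  "F \<in> carrier sym_fun_ring \<Longrightarrow> jm_eval n F \<in> hecke_embed n ` carrier (hecke_ring n)"
  using sev_B_sum_in_hecke jm_eval_eq_embed by blast

text \<open>The normalising factors of the idempotent and of the embedding cancel, so the preimage
  is the product with the unnormalised subgroup sum.\<close>

lemma jm_map_eq:
  assumes "F \<in> carrier sym_fun_ring" shows "jm_map n F = sev F \<star> B_sum"
  unfolding jm_map_def jm_eval_eq_embed
  by (intro inv_into_f_f inj_on_subset[OF inj_hecke_embed] subset_UNIV sev_B_sum_in_hecke assms)

lemma jm_map_closed: "F \<in> carrier sym_fun_ring \<Longrightarrow> jm_map n F \<in> carrier (hecke_ring n)"
  by (simp add: jm_map_eq sev_B_sum_in_hecke)

lemma jm_map_add: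
  assumes "F \<in> carrier sym_fun_ring" "G \<in> carrier sym_fun_ring"
  shows "jm_map n (F \<oplus>\<^bsub>sym_fun_ring\<^esub> G) = jm_map n F \<oplus>\<^bsub>hecke_ring n\<^esub> jm_map n G"
proof -
  interpret L: ring sym_fun_ring by (rule ring_sym_fun_ring)
  have "bounded_degree F" "bounded_degree G" using assms by (simp_all add: sym_fun_ring_simps)
  then have "sev (F \<oplus>\<^bsub>sym_fun_ring\<^esub> G) \<star> B_sum = (\<lambda>w. (sev F \<star> B_sum) w + (sev G \<star> B_sum) w)"
    by (simp add: sym_fun_ring_simps sev_add mult_add_left)
  then show ?thesis using assms by (simp add: jm_map_eq hecke_ring_simps(2))
qed

text \<open>The hypotheses concern the values rather than F and G because
  \<open>generate_hecke_ring\<close> applies this to restricted polynomials, which need not belong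
  to \<open>sym_fun_ring\<close>.\<close>

lemma hecke_mult_eval:
  assumes bd: "bounded_degree F" "bounded_degree G"
    and f: "sev F \<star> B_sum \<in> carrier (hecke_ring n)" and g: "sev G \<star> B_sum \<in> carrier (hecke_ring n)"
  shows "(sev F \<star> B_sum) \<otimes>\<^bsub>hecke_ring n\<^esub> (sev G \<star> B_sum) = sev (conv F G) \<star> B_sum"
proof -
  let ?f = "sev F \<star> B_sum" and ?g = "sev G \<star> B_sum"
  have "left_invariant ?g" unfolding left_invariant_def
  proof (intro ballI allI impI)
    fix b w assume "b \<in> hyperoct n" "w permutes vertices n"
    then have "?g (b \<circ> w \<circ> id) = ?g w" using g id_in_hyperoct unfolding hecke_ring_simps by blast
    then show "?g (b \<circ> w) = ?g w" by simp
  qed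
  then have "B_sum \<star> ?g = (\<lambda>w. card_B * ?g w)" by (rule B_sum_mult_left_invariant[OF _ mult_closed])
  then have eq: "?f \<star> ?g = (\<lambda>w. card_B * (sev (conv F G) \<star> B_sum) w)"
    by (simp add: mult_assoc mult_scale_right sev_conv bd)
  have "hecke_embed n (?f \<otimes>\<^bsub>hecke_ring n\<^esub> ?g) = hecke_embed n ?f \<star> hecke_embed n ?g"
    by (rule hecke_embed_mult[OF f g])
  also have "\<dots> = (\<lambda>w. 1 / card_B * (1 / card_B * (?f \<star> ?g) w))"
    unfolding hecke_embed_def mult_scale_left mult_scale_right ..
  also have "\<dots> = hecke_embed n (sev (conv F G) \<star> B_sum)"
    unfolding eq hecke_embed_def using card_B_nonzero by simp
  finally show ?thesis using inj_hecke_embed by (simp add: inj_eq)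
qed

lemma jm_map_mult:
  assumes "F \<in> carrier sym_fun_ring" "G \<in> carrier sym_fun_ring"
  shows "jm_map n (F \<otimes>\<^bsub>sym_fun_ring\<^esub> G) = jm_map n F \<otimes>\<^bsub>hecke_ring n\<^esub> jm_map n G"
proof -
  interpret L: ring sym_fun_ring by (rule ring_sym_fun_ring)
  have "bounded_degree F" "bounded_degree G" using assms by (simp_all add: sym_fun_ring_simps)
  then show ?thesis
    using hecke_mult_eval[OF _ _ sev_B_sum_in_hecke[OF assms(1)] sev_B_sum_in_hecke[OF assms(2)]]
      jm_map_eq[OF L.m_closed[OF assms]] jm_map_eq[OF assms(1)] jm_map_eq[OF assms(2)]
    by (simp add: sym_fun_ring_simps(2))
qed

lemma jm_map_one: "jm_map n \<one>\<^bsub>sym_fun_ring\<^esub> = \<one>\<^bsub>hecke_ring n\<^esub>"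
proof -
  interpret L: ring sym_fun_ring by (rule ring_sym_fun_ring)
  have "jm_map n \<one>\<^bsub>sym_fun_ring\<^esub> = sev mono_one \<star> B_sum"
    using jm_map_eq[OF L.one_closed] by (simp add: sym_fun_ring_simps)
  then show ?thesis unfolding sev_one_mult_B_sum by (simp add: hecke_ring_simps B_sum_def fun_eq_iff)
qed

lemma jm_map_elem_sym:
  assumes "k \<le> n" shows "jm_map n (elem_sym k) = hecke_H n (n - k)"
proof
  fix w
  have eq: "jm_map n (elem_sym k) = sev (elem_sym k) \<star> B_sum" by (rule jm_map_eq[OF elem_sym_carrier])
  show "jm_map n (elem_sym k) w = hecke_H n (n - k) w"
  proof (cases "w permutes vertices n")
    case True
    have "excess_degree n (perm_matching n w) = k \<longleftrightarrow> num_cycles n w = n - k"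
      using num_cycles_add_excess_degree[OF True] assms by linarith
    then show ?thesis unfolding eq elem_sym_eval[OF True] using True by (simp add: hecke_H_def carrier_iff_vertices)
  next
    case False
    then show ?thesis unfolding eq using mult_outside[of w] by (simp add: hecke_H_def carrier_iff_vertices)
  qed
qed

subsection \<open>Surjectivity\<close>

text \<open>The lexicographic order of degree and number of nontrivial components in one number: the
  second entry is at most n, so the weight n+1 keeps the first entry dominant.\<close>

definition coset_rank :: "(nat \<Rightarrow> nat) \<Rightarrow> nat" where
  "coset_rank w = mono_degree (excess_mono n w) * (n + 1) + card (keys (excess_mono n w))"

lemma card_keys_excess_mono: "w permutes vertices n \<Longrightarrow> card (keys (excess_mono n w)) \<le> n"
  using card_mono[OF finite_lessThan keys_excess_mono] by simp

text \<open>Unitriangularity. A monomial of smaller degree does not reach w at all, and in equal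
  degree the rank bound is just the condition on the number of variables in
  \<open>mono_action_leading\<close>.\<close>

lemma mono_action_rank:
  assumes w: "w permutes vertices n" and k: "keys \<gamma> \<subseteq> {..<n}"
    and r: "mono_degree \<gamma> * (n + 1) + card (keys \<gamma>) \<le> coset_rank w"
  shows "mono_action \<gamma> w = of_bool (\<gamma> = excess_mono n w)"
proof -
  let ?\<epsilon> = "excess_mono n w"
  note ex = excess_eq_lookup[OF keys_excess_mono[OF w] lookup_excess_mono[OF w, symmetric]]
  have eq: "\<gamma> = ?\<epsilon> \<longleftrightarrow> excess n (perm_matching n w) = lookup \<gamma>"
    unfolding lookup_excess_mono[OF w, symmetric] by (auto intro: poly_mapping_eqI)
  note lead = mono_action_leading[OF k w]
  have "mono_degree \<gamma> \<le> mono_degree ?\<epsilon>"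
  proof (rule ccontr)
    assume "\<not> mono_degree \<gamma> \<le> mono_degree ?\<epsilon>"
    then have "(mono_degree ?\<epsilon> + 1) * (n + 1) \<le> mono_degree \<gamma> * (n + 1)" by (intro mult_le_mono) auto
    then show False using r card_keys_excess_mono[OF w] unfolding coset_rank_def by (simp add: algebra_simps)
  qed
  then consider "mono_degree \<gamma> < mono_degree ?\<epsilon>" | "mono_degree \<gamma> = mono_degree ?\<epsilon>" by linarith
  then show ?thesis
  proof cases
    case 1
    then have "mono_action \<gamma> w = 0" using lead ex(1) by auto
    then show ?thesis using 1 by auto
  next
    case 2
    then have "card (keys \<gamma>) \<le> card (keys ?\<epsilon>)" using r by (simp add: coset_rank_def)
    then show ?thesis using lead ex 2 unfolding eq by simp
  qed
qed

text \<open>F is the combination of the monomial symmetric functions of rank r whose coefficients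
  are the values of f on the corresponding double cosets; monomials of rank r are seen at rank r or
  higher only through their own exponent.\<close>

lemma hecke_leading_term:
  assumes f: "f \<in> carrier (hecke_ring n)"
    and supp: "\<And>w. w permutes vertices n \<Longrightarrow> f w \<noteq> 0 \<Longrightarrow> coset_rank w \<le> r"
  shows "\<exists>F\<in>carrier sym_fun_ring. \<forall>w. w permutes vertices n \<longrightarrow> r \<le> coset_rank w \<longrightarrow>
    (sev F \<star> B_sum) w = f w"
proof -
  define R where "R \<gamma> w \<longleftrightarrow> w permutes vertices n \<and> coset_rank w = r \<and>
      (\<exists>\<pi>. bij \<pi> \<and> \<gamma> = map_key \<pi> (excess_mono n w))" for \<gamma> :: mono and w
  \<comment> \<open>The value does not depend on the chosen w by \<open>R_eq\<close>. The floor only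
    converts an integral rational to an integer.\<close>
  define F where "F \<gamma> = (if \<exists>w. R \<gamma> w then \<lfloor>f (SOME w. R \<gamma> w)\<rfloor> else 0)" for \<gamma>
  have R_deg: "mono_degree \<gamma> = mono_degree (excess_mono n w)" "card (keys \<gamma>) = card (keys (excess_mono n w))"
    if "R \<gamma> w" for \<gamma> w
    using that mono_degree_map_key card_keys_map_key unfolding R_def by blast+
  have R_rank: "mono_degree \<gamma> * (n + 1) + card (keys \<gamma>) = r" if "R \<gamma> w" for \<gamma> w
    using R_deg[OF that] that by (simp add: R_def coset_rank_def)
  have R_eq: "f w = f v" if R: "R \<gamma> w" "R \<gamma> v" for \<gamma> w v
  proof -
    obtain \<pi> where \<pi>: "bij \<pi>" "\<gamma> = map_key \<pi> (excess_mono n w)" using R(1) unfolding R_def by blast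
    obtain \<sigma> where \<sigma>: "bij \<sigma>" "\<gamma> = map_key \<sigma> (excess_mono n v)" using R(2) unfolding R_def by blast
    note ps = \<pi>(1) \<sigma>(1) \<pi>(2)[symmetric, unfolded \<sigma>(2)]
    have wv: "w permutes vertices n" "v permutes vertices n" using R by (simp_all add: R_def)
    have "excess n (perm_matching n w) \<circ> \<pi> = excess n (perm_matching n v) \<circ> \<sigma>"
      using arg_cong[OF ps(3), of lookup]
      by (simp add: lookup_map_key bij_is_inj ps(1,2) lookup_excess_mono wv)
    then have "excess n (perm_matching n w) \<circ> (\<pi> \<circ> inv' \<sigma>) = excess n (perm_matching n v)"
      using bij_is_surj[OF ps(2)] by (auto simp: fun_eq_iff surj_f_inv_f)
    then show ?thesis
      using hecke_double_coset[OF f wv] bij_comp[OF bij_imp_bij_inv[OF ps(2)] ps(1)] by blast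
  qed
  have R_map: "R (map_key \<sigma> \<gamma>) w \<longleftrightarrow> R \<gamma> w" if \<sigma>: "bij \<sigma>" for \<sigma> \<gamma> w
  proof -
    have imp: "R (map_key \<sigma> \<gamma>) w" if "R \<gamma> w" "bij \<sigma>" for \<sigma> \<gamma>
    proof -
      obtain \<pi> where "bij \<pi>" "\<gamma> = map_key \<pi> (excess_mono n w)" using \<open>R \<gamma> w\<close> unfolding R_def by blast
      then have "map_key \<sigma> \<gamma> = map_key (\<pi> \<circ> \<sigma>) (excess_mono n w)" "bij (\<pi> \<circ> \<sigma>)"
        using \<open>bij \<sigma>\<close> by (simp_all add: map_key_compose bij_is_inj bij_comp)
      then show ?thesis using \<open>R \<gamma> w\<close> unfolding R_def by blast
    qed
    show ?thesis using imp[OF _ \<sigma>] imp[OF _ bij_imp_bij_inv[OF \<sigma>], of "map_key \<sigma> \<gamma>"] map_key_inv(2)[OF \<sigma>] by metis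
  qed
  then have R_map_key: "R (map_key \<sigma> \<gamma>) = R \<gamma>" if "bij \<sigma>" for \<sigma> \<gamma>
    using that by (intro ext) blast
  have F_carrier: "F \<in> carrier sym_fun_ring"
  proof -
    have "mono_degree \<gamma> \<le> r" if "F \<gamma> \<noteq> 0" for \<gamma>
    proof -
      obtain w where "R \<gamma> w" using \<open>F \<gamma> \<noteq> 0\<close> unfolding F_def by (auto split: if_splits)
      then have "mono_degree \<gamma> * (n + 1) \<le> r" using R_rank by fastforce
      then show ?thesis by simp
    qed
    then have "bounded_degree F" unfolding bounded_degree_def by blast
    moreover have "F (map_key \<sigma> \<gamma>) = F \<gamma>" if "bij \<sigma>" for \<sigma> \<gamma>
      unfolding F_def R_map_key[OF that] ..
    ultimately show ?thesis by (simp add: sym_fun_ring_simps)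
  qed
  have "(sev F \<star> B_sum) w = f w" if w: "w permutes vertices n" and rk: "r \<le> coset_rank w" for w
  proof -
    let ?\<epsilon> = "excess_mono n w" let ?S = "{\<gamma>. keys \<gamma> \<subseteq> {..<n} \<and> F \<gamma> \<noteq> 0}"
    have fin: "finite ?S" using F_carrier by (intro finite_supp) (simp add: sym_fun_ring_simps)
    have "(sev F \<star> B_sum) w = (\<Sum>\<gamma>\<in>?S. of_int (F \<gamma>) * of_bool (\<gamma> = ?\<epsilon>))"
      unfolding sev_mult_B_sum
    proof (rule sum.cong[OF refl])
      fix \<gamma> assume g: "\<gamma> \<in> ?S"
      then obtain v where "R \<gamma> v" unfolding F_def by (auto split: if_splits)
      then have "mono_action \<gamma> w = of_bool (\<gamma> = ?\<epsilon>)"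
        using R_rank rk g by (intro mono_action_rank[OF w]) auto
      then show "of_int (F \<gamma>) * mono_action \<gamma> w = of_int (F \<gamma>) * of_bool (\<gamma> = ?\<epsilon>)" by simp
    qed
    also have "\<dots> = of_int (F ?\<epsilon>)"
    proof (cases "?\<epsilon> \<in> ?S")
      case True
      then have "(\<Sum>\<gamma>\<in>?S. of_int (F \<gamma>) * of_bool (\<gamma> = ?\<epsilon>)) = (\<Sum>\<gamma>\<in>{?\<epsilon>}. of_int (F \<gamma>) * (of_bool (\<gamma> = ?\<epsilon>) :: rat))"
        using fin by (intro sum.mono_neutral_right) auto
      then show ?thesis by simp
    next
      case False
      then have "F ?\<epsilon> = 0" using keys_excess_mono[OF w] by simp
      moreover have "(\<Sum>\<gamma>\<in>?S. of_int (F \<gamma>) * of_bool (\<gamma> = ?\<epsilon>)) = (0 :: rat)"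
        using False by (intro sum.neutral) auto
      ultimately show ?thesis by simp
    qed
    also have "\<dots> = f w"
    proof (cases "coset_rank w = r")
      case True
      have R: "R ?\<epsilon> w"
        unfolding R_def using w True
        by (intro conjI exI[of _ "\<lambda>x. x"]) (simp_all add: map_key_id bij_id[unfolded id_def])
      then have "R ?\<epsilon> (SOME v. R ?\<epsilon> v)" by (rule someI[where P = "R ?\<epsilon>"])
      then have "f (SOME v. R ?\<epsilon> v) = f w" using R_eq R by blast
      then have "F ?\<epsilon> = \<lfloor>f w\<rfloor>" using R unfolding F_def by auto
      then show ?thesis using f unfolding hecke_ring_simps by (simp add: of_int_floor)
    next
      \<comment> \<open>Above rank r both sides vanish: the support of F has rank r throughout, and
        f is zero there by \<open>supp\<close>.\<close>
      case False
      have "\<not> R ?\<epsilon> v" for v using False R_rank[of ?\<epsilon> v] by (auto simp: coset_rank_def)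
      moreover have "f w = 0" using supp[OF w] False rk by fastforce
      ultimately show ?thesis by (simp add: F_def)
    qed
    finally show ?thesis .
  qed
  then show ?thesis using F_carrier by blast
qed

lemma hecke_diff_closed:
  "f \<in> carrier (hecke_ring n) \<Longrightarrow> g \<in> carrier (hecke_ring n) \<Longrightarrow> (\<lambda>w. f w - g w) \<in> carrier (hecke_ring n)"
  by (simp add: hecke_ring_simps)

text \<open>Subtracting a symmetric function that matches f from its top rank upwards lowers the
  rank of the support.\<close>

lemma jm_map_surj_aux:
  assumes "f \<in> carrier (hecke_ring n)"
    and "\<And>w. w permutes vertices n \<Longrightarrow> f w \<noteq> 0 \<Longrightarrow> coset_rank w < r"
  shows "f \<in> jm_map n ` carrier sym_fun_ring"
  using assms
proof (induction r arbitrary: f)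
  interpret L: ring sym_fun_ring by (rule ring_sym_fun_ring)
  case 0
  have "jm_map n \<zero>\<^bsub>sym_fun_ring\<^esub> = (\<lambda>w. 0)"
    using jm_map_eq[OF L.zero_closed] by (simp add: sym_fun_ring_simps fun_eq_iff sev_mult_B_sum)
  moreover have "f = (\<lambda>w. 0)" using 0 unfolding hecke_ring_simps by (metis not_less_zero)
  ultimately show ?case using L.zero_closed by (metis imageI)
next
  interpret L: ring sym_fun_ring by (rule ring_sym_fun_ring)
  case (Suc r)
  obtain F where F: "F \<in> carrier sym_fun_ring"
    "\<And>w. w permutes vertices n \<Longrightarrow> r \<le> coset_rank w \<Longrightarrow> (sev F \<star> B_sum) w = f w"
    using hecke_leading_term[OF Suc.prems(1), of r] Suc.prems(2) by (metis less_Suc_eq_le)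
  let ?g = "\<lambda>w. f w - jm_map n F w"
  have "?g \<in> jm_map n ` carrier sym_fun_ring"
  proof (rule Suc.IH)
    show "?g \<in> carrier (hecke_ring n)" using Suc.prems(1) jm_map_closed[OF F(1)] by (rule hecke_diff_closed)
    show "coset_rank w < r" if "w permutes vertices n" "?g w \<noteq> 0" for w
      using F(2)[OF that(1)] that(2) jm_map_eq[OF F(1)] by (metis eq_iff_diff_eq_0 not_le)
  qed
  then obtain G where G: "G \<in> carrier sym_fun_ring" "?g = jm_map n G" by blast
  have "jm_map n (F \<oplus>\<^bsub>sym_fun_ring\<^esub> G) = f"
    using jm_map_add[OF F(1) G(1)] by (simp add: hecke_ring_simps(2) G(2)[symmetric])
  then show ?case using L.a_closed[OF F(1) G(1)] by blast
qed

lemma jm_map_image: "jm_map n ` carrier sym_fun_ring = carrier (hecke_ring n)"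
proof
  show "carrier (hecke_ring n) \<subseteq> jm_map n ` carrier sym_fun_ring"
  proof
    fix f assume f: "f \<in> carrier (hecke_ring n)"
    have "finite (coset_rank ` {w. w permutes vertices n})"
      by (simp add: finite_permutations vertices_def)
    then obtain r where "\<And>w. w permutes vertices n \<Longrightarrow> coset_rank w < r"
      unfolding finite_nat_set_iff_bounded by auto
    then show "f \<in> jm_map n ` carrier sym_fun_ring" using jm_map_surj_aux[OF f] by blast
  qed
qed (auto intro: jm_map_closed)

section \<open>Ring axioms and generators of the Hecke ring\<close>

lemma hecke_mult_closed:
  assumes "f \<in> carrier (hecke_ring n)" "g \<in> carrier (hecke_ring n)"
  shows "f \<otimes>\<^bsub>hecke_ring n\<^esub> g \<in> carrier (hecke_ring n)"
proof -
  interpret L: ring sym_fun_ring by (rule ring_sym_fun_ring)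
  obtain F G where "F \<in> carrier sym_fun_ring" "f = jm_map n F" "G \<in> carrier sym_fun_ring" "g = jm_map n G"
    using assms unfolding jm_map_image[symmetric] by blast
  then show ?thesis using jm_map_closed[OF L.m_closed] by (simp add: jm_map_mult[symmetric])
qed

lemma hecke_embed_closed: "f \<in> carrier (hecke_ring n) \<Longrightarrow> hecke_embed n f \<in> carrier (sym_algebra n)"
  by (simp add: hecke_ring_simps group_algebra_simps hecke_embed_def carrier_iff_vertices)

text \<open>Each axiom is taken from where it is cheap: closure and the unit laws from the
  surjection \<open>jm_map\<close>, associativity and distributivity from the injective embedding
  into the group algebra.\<close>

lemma ring_hecke_ring: "ring (hecke_ring n)"
proof (rule ringI)
  let ?H = "hecke_ring n"
  note emb = hecke_embed_mult hecke_embed_add hecke_mult_closed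
  have eqI: "f = g" if "hecke_embed n f = hecke_embed n g" for f g
    using that inj_hecke_embed by (simp add: inj_eq)
  have add_closed: "f \<oplus>\<^bsub>?H\<^esub> g \<in> carrier ?H" if "f \<in> carrier ?H" "g \<in> carrier ?H" for f g
    using that by (simp add: hecke_ring_simps)
  have one_closed: "\<one>\<^bsub>?H\<^esub> \<in> carrier ?H"
    using jm_map_one jm_map_closed[OF ring.ring_simprules(6)[OF ring_sym_fun_ring]] by simp
  show "abelian_group ?H"
  proof (rule abelian_groupI)
    fix f assume "f \<in> carrier ?H"
    then show "\<exists>y\<in>carrier ?H. y \<oplus>\<^bsub>?H\<^esub> f = \<zero>\<^bsub>?H\<^esub>"
      by (intro bexI[of _ "\<lambda>w. - f w"]) (simp_all add: hecke_ring_simps)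
  qed (simp_all add: add_closed, simp_all add: hecke_ring_simps ac_simps)
  have surj: "\<exists>F\<in>carrier sym_fun_ring. f = jm_map n F" if "f \<in> carrier ?H" for f
    using that unfolding jm_map_image[symmetric] by blast
  interpret L: ring sym_fun_ring by (rule ring_sym_fun_ring)
  show "monoid ?H"
  proof (rule monoidI)
    show "\<one>\<^bsub>?H\<^esub> \<otimes>\<^bsub>?H\<^esub> f = f" if f: "f \<in> carrier ?H" for f
    proof -
      obtain F where "F \<in> carrier sym_fun_ring" "f = jm_map n F" using surj[OF f] by blast
      then show ?thesis using jm_map_mult[of "\<one>\<^bsub>sym_fun_ring\<^esub>" F] by (simp add: jm_map_one)
    qed
    show "f \<otimes>\<^bsub>?H\<^esub> \<one>\<^bsub>?H\<^esub> = f" if f: "f \<in> carrier ?H" for f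
    proof -
      obtain F where "F \<in> carrier sym_fun_ring" "f = jm_map n F" using surj[OF f] by blast
      then show ?thesis using jm_map_mult[of F "\<one>\<^bsub>sym_fun_ring\<^esub>"] by (simp add: jm_map_one)
    qed
    show "f \<otimes>\<^bsub>?H\<^esub> g \<otimes>\<^bsub>?H\<^esub> h = f \<otimes>\<^bsub>?H\<^esub> (g \<otimes>\<^bsub>?H\<^esub> h)"
      if "f \<in> carrier ?H" "g \<in> carrier ?H" "h \<in> carrier ?H" for f g h
      by (rule eqI) (use that in \<open>simp add: emb mult_assoc\<close>)
  qed (use one_closed hecke_mult_closed in auto)
  show "(f \<oplus>\<^bsub>?H\<^esub> g) \<otimes>\<^bsub>?H\<^esub> h = f \<otimes>\<^bsub>?H\<^esub> h \<oplus>\<^bsub>?H\<^esub> g \<otimes>\<^bsub>?H\<^esub> h"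
    if "f \<in> carrier ?H" "g \<in> carrier ?H" "h \<in> carrier ?H" for f g h
    by (rule eqI) (use that in \<open>simp add: emb add_closed A.l_distr hecke_embed_closed\<close>)
  show "h \<otimes>\<^bsub>?H\<^esub> (f \<oplus>\<^bsub>?H\<^esub> g) = h \<otimes>\<^bsub>?H\<^esub> f \<oplus>\<^bsub>?H\<^esub> h \<otimes>\<^bsub>?H\<^esub> g"
    if "f \<in> carrier ?H" "g \<in> carrier ?H" "h \<in> carrier ?H" for f g h
    by (rule eqI) (use that in \<open>simp add: emb add_closed A.r_distr hecke_embed_closed\<close>)
qed

lemma ring_hom_jm_map: "ring_hom_ring sym_fun_ring (hecke_ring n) (jm_map n)"
  by (intro ring_hom_ringI2 ring_sym_fun_ring ring_hecke_ring ring_hom_memI)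
    (auto simp: jm_map_closed jm_map_mult jm_map_add jm_map_one)

text \<open>For positive n a matching has at least one component, so its degree is at most n-1.
  Hence the generators with index from n on are not missed.\<close>

lemma elem_sym_eval_ge:
  assumes "n \<ge> 1" "k \<ge> n" shows "sev (elem_sym k) \<star> B_sum = (\<lambda>w. 0)"
proof
  fix w
  show "(sev (elem_sym k) \<star> B_sum) w = 0"
  proof (cases "w permutes vertices n")
    case True
    interpret matching n "perm_matching n w" using matching_perm[OF True] .
    have "1 \<in> vertices n" using assms(1) by simp
    then have "comps \<noteq> {}" unfolding comps_def by blast
    then have "card comps > 0" using finite_comps by (simp add: card_gt_0_iff)
    then have "excess_degree n (perm_matching n w) \<noteq> k"
      using excess_degree_add_card_comps assms(2) by linarith
    then show ?thesis by (simp add: elem_sym_eval[OF True])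
  next
    case False
    then show ?thesis using mult_outside[of w] by (simp add: carrier_iff_vertices)
  qed
qed

text \<open>Every element is a value by surjectivity, and the induction on symmetric polynomials
  builds that value inside the generated subring. The subring lies in the Hecke ring, which supplies
  the hypotheses of \<open>hecke_mult_eval\<close>.\<close>

lemma generate_hecke_ring:
  assumes "n \<ge> 1"
  shows "generate_ring (hecke_ring n) {jm_map n (elem_sym k) | k. k \<in> {0..n - 1}} = carrier (hecke_ring n)"
proof
  interpret H: ring "hecke_ring n" by (rule ring_hecke_ring)
  let ?E = "{jm_map n (elem_sym k) | k. k \<in> {0..n - 1}}"
  let ?G = "generate_ring (hecke_ring n) ?E"
  have sub: "?G \<subseteq> carrier (hecke_ring n)"
    by (rule H.generate_ring_incl) (use jm_map_closed elem_sym_carrier in auto)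
  then show "?G \<subseteq> carrier (hecke_ring n)" .
  have zero: "(\<lambda>w. 0) \<in> ?G"
    using H.zero_in_generate by (simp add: hecke_ring_simps(3))
  have minus: "(\<lambda>w. - f w) \<in> ?G" if "f \<in> ?G" for f
  proof -
    have f: "f \<in> carrier (hecke_ring n)" "(\<lambda>w. - f w) \<in> carrier (hecke_ring n)"
      using sub that by (auto simp: hecke_ring_simps)
    then have "\<ominus>\<^bsub>hecke_ring n\<^esub> f = (\<lambda>w. - f w)"
      by (intro H.minus_equality) (simp_all add: hecke_ring_simps(2,3))
    then show ?thesis using generate_ring.a_inv[OF that] by simp
  qed
  show "carrier (hecke_ring n) \<subseteq> ?G"
  proof
    fix f assume "f \<in> carrier (hecke_ring n)"
    then obtain F where F: "F \<in> carrier sym_fun_ring" "f = jm_map n F" using jm_map_image by blast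
    have "sev (restrict_vars n F) \<star> B_sum \<in> ?G"
      using F(1)
    proof (induction rule: symmetric_function_induct)
      case one
      have "sev mono_one \<star> B_sum = \<one>\<^bsub>hecke_ring n\<^esub>"
        unfolding sev_one_mult_B_sum by (simp add: hecke_ring_simps B_sum_def fun_eq_iff)
      then show ?case using generate_ring.one by metis
    next
      case (elem_sym k)
      show ?case unfolding sev_restrict
      proof (cases "k \<le> n - 1")
        case True
        then have "jm_map n (elem_sym k) \<in> ?E" by auto
        then have "jm_map n (elem_sym k) \<in> ?G" by (rule generate_ring.incl)
        then show "sev (elem_sym k) \<star> B_sum \<in> ?G"
          by (subst jm_map_eq[OF elem_sym_carrier, symmetric])
      next
        case False
        then show "sev (elem_sym k) \<star> B_sum \<in> ?G" using elem_sym_eval_ge[OF assms] zero by simp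
      qed
    next
      case (neg F)
      have "sev (\<lambda>m. - F m) \<star> B_sum = (\<lambda>w. - (sev F \<star> B_sum) w)"
        using mult_scale_left[of "- 1" "sev F" B_sum] by (simp add: sev_uminus)
      then show ?case using minus[OF neg.IH] by simp
    next
      case (add F G)
      have "sev (\<lambda>m. F m + G m) \<star> B_sum = (sev F \<star> B_sum) \<oplus>\<^bsub>hecke_ring n\<^esub> (sev G \<star> B_sum)"
        using add.hyps by (simp add: sev_add mult_add_left hecke_ring_simps(2))
      then show ?case using generate_ring.eng_add[OF add.IH] by simp
    next
      case (mult F G)
      have "(sev F \<star> B_sum) \<otimes>\<^bsub>hecke_ring n\<^esub> (sev G \<star> B_sum) = sev (conv F G) \<star> B_sum"
        using mult.IH sub by (intro hecke_mult_eval mult.hyps) blast+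
      then show ?case using generate_ring.eng_mult[OF mult.IH] by simp
    qed
    then show "f \<in> ?G" using F jm_map_eq by (simp add: sev_restrict)
  qed
qed

end

theorem theorem4p10:
  fixes n :: nat
  assumes "n \<ge> 1"
  shows "(\<forall>F\<in>carrier sym_fun_ring. jm_eval n F \<in> hecke_embed n ` carrier (hecke_ring n)) \<and>
    ring_hom_ring sym_fun_ring (hecke_ring n) (jm_map n) \<and>
    jm_map n ` carrier sym_fun_ring = carrier (hecke_ring n) \<and>
    (\<forall>k\<in>{0..n - 1}. elem_sym k \<in> carrier sym_fun_ring \<and> jm_map n (elem_sym k) = hecke_H n (n - k)) \<and>
    generate_ring (hecke_ring n) {jm_map n (elem_sym k) | k. k \<in> {0..n - 1}} = carrier (hecke_ring n)"
proof -
  interpret odd_jucys_murphy n .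
  have "jm_map n (elem_sym k) = hecke_H n (n - k)" if "k \<in> {0..n - 1}" for k
    using that by (intro jm_map_elem_sym) auto
  then show ?thesis
    using jm_eval_in_image ring_hom_jm_map jm_map_image elem_sym_carrier generate_hecke_ring[OF assms] by blast
qed

end
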